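(* Suppose that $G=\mathbb Z^d$ or $G$ is a transitive, unimodular (and infinitely accessible) graph on which the simple random walk is transient. Consider the diffusion-limited annihilating-coalescing system $(\xi_t)$ on $G$ with $M=N=\infty$, $\lambda_A=\lambda_B=1$, $p=1/2$ and simple random walk steps, and let $(\zeta_t)$ be the coalescing random walk on $G$. Then, as $t\to\infty$, $$\mathbb P(\xi_t(\mathbf 0)\neq0)\ \sim\ \tfrac23\,\mathbb P(\zeta_t(\mathbf 0)=1),$$ i.e. the ratio of the two sides tends to $1$.
   Context: Graph. $G=(\mathcal V,\mathcal E)$ is a simple, locally finite, connected graph with root $\mathbf 0$, and $K(u,v)=1/\deg(u)$ for neighbors $u,v$ (zero otherwise) is the simple random walk kernel. $\Gamma_K$ is a subgroup of the group of $K$-preserving automorphisms of $G$, and $\Gamma_K(u,v)=\{\varphi\in\Gamma_K:\varphi(u)=v\}$. Transitive: $\Gamma_K(u,v)\ne\varnothing$ for all $u,v\in\mathcal V$. Unimodular: $|\Gamma_K(u,u)v|=|\Gamma_K(v,v)u|<\infty$ for all $u,v\in\mathcal V$. Infinitely accessible: there are $\varphi\in\Gamma_K$ and $u\in\mathcal V$ such that $\{\varphi^n(u):n\ge0\}$ is infinite and $u$ is accessible from $\varphi(u)$, meaning that there is a path of adjacent vertices from $\varphi(u)$ to $u$ with all steps of positive $K$-probability. DLACS with these parameters. Independently at each site there is initially one particle, of type $A$ with probability $1/2$ and otherwise of type $B$. All particles perform independent rate-$1$ continuous-time simple random walks, subject to the following reactions when two particles meet: $A+A\to A$ and $B+B\to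 B$ (two particles of the same type coalesce into one particle of that type, which moves as a single random walk), and $A+B\to\varnothing$ (mutual annihilation). $\xi_t(x)$ is the number of $A$-particles minus the number of $B$-particles at $x$ at time $t$; since at most one particle is present at a site, $\xi_t(x)\ne0$ iff $x$ is occupied at time $t$. Coalescing random walk. $\zeta_t(x)=1$ if there is a particle at $x$ at time $t$ and $\zeta_t(x)=0$ otherwise. Initially $\zeta_0(x)=1$ for all $x\in\mathcal V$. Particles jump at rate $1$ to a uniformly random neighbor; when two particles meet they coalesce into a single particle, which moves as a single random walk. *)

theory Defs
  imports "HOL-Probability.Probability" "HOL-Library.Landau_Symbols" "HOL-Algebra.Bij"
begin

section \<open>Graphs and simple random walk\<close>

text \<open>A graph is given by its adjacency relation; its vertex set is the whole type of vertices.\<close>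

definition nbrs :: "('v \<Rightarrow> 'v \<Rightarrow> bool) \<Rightarrow> 'v \<Rightarrow> 'v set" where
  "nbrs adj u = {v. adj u v}"

definition simple_connected_graph :: "('v \<Rightarrow> 'v \<Rightarrow> bool) \<Rightarrow> bool" where
  "simple_connected_graph adj \<longleftrightarrow>
     (\<forall>u v. adj u v \<longrightarrow> adj v u) \<and> (\<forall>u. \<not> adj u u) \<and>
     (\<forall>u. finite (nbrs adj u)) \<and>
     (\<forall>u v. adj\<^sup>*\<^sup>* u v)"

definition srw_kernel :: "('v \<Rightarrow> 'v \<Rightarrow> bool) \<Rightarrow> 'v \<Rightarrow> 'v \<Rightarrow> real" where
  "srw_kernel adj u v = (if adj u v then 1 / real (card (nbrs adj u)) else 0)"

text \<open>The law of one step from \<open>u\<close>. It is meaningful when \<open>u\<close> has a neighbour, which is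
  automatic in an infinite connected graph; its mass function is then \<^const>\<open>srw_kernel\<close>.\<close>

definition srw_step :: "('v \<Rightarrow> 'v \<Rightarrow> bool) \<Rightarrow> 'v \<Rightarrow> 'v pmf" where
  "srw_step adj u = pmf_of_set (nbrs adj u)"

lemma pmf_srw_step:
  assumes "finite (nbrs adj u)" "nbrs adj u \<noteq> {}"
  shows "pmf (srw_step adj u) v = srw_kernel adj u v"
  using assms by (simp add: srw_step_def srw_kernel_def pmf_of_set nbrs_def indicator_def)

text \<open>The law of the trajectory \<open>[X\<^sub>0, \<dots>, X\<^sub>n]\<close> of the discrete-time walk started at \<open>u\<close>.\<close>

primrec srw_path :: "('v \<Rightarrow> 'v \<Rightarrow> bool) \<Rightarrow> nat \<Rightarrow> 'v \<Rightarrow> 'v list pmf" where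
  "srw_path adj 0 u = return_pmf [u]"
| "srw_path adj (Suc n) u = bind_pmf (srw_step adj u) (\<lambda>v. map_pmf ((#) u) (srw_path adj n v))"

text \<open>The probability of ever returning to the starting point is the increasing limit of the
  probabilities of returning within \<open>n\<close> steps.\<close>

definition return_probability :: "('v \<Rightarrow> 'v \<Rightarrow> bool) \<Rightarrow> 'v \<Rightarrow> real" where
  "return_probability adj u =
     (SUP n. measure_pmf.prob (srw_path adj n u) {xs. \<exists>k\<in>{1..n}. xs ! k = u})"

definition srw_transient :: "('v \<Rightarrow> 'v \<Rightarrow> bool) \<Rightarrow> bool" where
  "srw_transient adj \<longleftrightarrow> (\<forall>u. return_probability adj u < 1)"


section \<open>Integer lattices, and groups of automorphisms\<close>

text \<open>The graph is the nearest-neighbour lattice of some dimension \<open>d \<ge> 1\<close>, up to renaming of the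
  vertices; points of the lattice are integer lists of length \<open>d\<close>.\<close>

definition is_integer_lattice :: "('v \<Rightarrow> 'v \<Rightarrow> bool) \<Rightarrow> bool" where
  "is_integer_lattice adj \<longleftrightarrow>
     (\<exists>d>0. \<exists>f :: 'v \<Rightarrow> int list. bij_betw f UNIV {xs. length xs = d} \<and>
        (\<forall>u v. adj u v \<longleftrightarrow> (\<Sum>i<d. \<bar>f u ! i - f v ! i\<bar>) = 1))"

definition kernel_automorphisms :: "('v \<Rightarrow> 'v \<Rightarrow> bool) \<Rightarrow> ('v \<Rightarrow> 'v) set" where
  "kernel_automorphisms adj =
     {\<phi>. bij \<phi> \<and> (\<forall>u v. adj (\<phi> u) (\<phi> v) \<longleftrightarrow> adj u v) \<and>
         (\<forall>u v. srw_kernel adj (\<phi> u) (\<phi> v) = srw_kernel adj u v)}"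

definition automorphism_subgroup :: "('v \<Rightarrow> 'v \<Rightarrow> bool) \<Rightarrow> ('v \<Rightarrow> 'v) set \<Rightarrow> bool" where
  "automorphism_subgroup adj \<Gamma> \<longleftrightarrow> subgroup \<Gamma> (BijGroup UNIV) \<and> \<Gamma> \<subseteq> kernel_automorphisms adj"

definition moving :: "('v \<Rightarrow> 'v) set \<Rightarrow> 'v \<Rightarrow> 'v \<Rightarrow> ('v \<Rightarrow> 'v) set" where
  "moving \<Gamma> u v = {\<phi> \<in> \<Gamma>. \<phi> u = v}"

definition transitive_action :: "('v \<Rightarrow> 'v) set \<Rightarrow> bool" where
  "transitive_action \<Gamma> \<longleftrightarrow> (\<forall>u v. moving \<Gamma> u v \<noteq> {})"

definition unimodular_action :: "('v \<Rightarrow> 'v) set \<Rightarrow> bool" where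
  "unimodular_action \<Gamma> \<longleftrightarrow>
     (\<forall>u v. finite {\<phi> v | \<phi>. \<phi> \<in> moving \<Gamma> u u} \<and> finite {\<phi> u | \<phi>. \<phi> \<in> moving \<Gamma> v v} \<and>
        card {\<phi> v | \<phi>. \<phi> \<in> moving \<Gamma> u u} = card {\<phi> u | \<phi>. \<phi> \<in> moving \<Gamma> v v})"

definition accessible :: "('v \<Rightarrow> 'v \<Rightarrow> bool) \<Rightarrow> 'v \<Rightarrow> 'v \<Rightarrow> bool" where
  "accessible adj v u \<longleftrightarrow> (\<lambda>a b. adj a b \<and> srw_kernel adj a b > 0)\<^sup>*\<^sup>* v u"

definition infinitely_accessible :: "('v \<Rightarrow> 'v \<Rightarrow> bool) \<Rightarrow> ('v \<Rightarrow> 'v) set \<Rightarrow> bool" where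
  "infinitely_accessible adj \<Gamma> \<longleftrightarrow>
     (\<exists>\<phi>\<in>\<Gamma>. \<exists>u. infinite {(\<phi> ^^ n) u | n :: nat. True} \<and> accessible adj (\<phi> u) u)"


section \<open>Systems of random walks that react on meeting\<close>

text \<open>The systems are given by the Harris graphical construction. Site \<open>v\<close> carries a rate-1 Poisson
  clock. When it rings, the particle at \<open>v\<close>, if any, jumps to the neighbour attached to that
  ring, where it meets the particle already present, if any. As no site ever holds more than one
  particle, the waiting times and steps of the particles are independent, exponential with mean 1
  and uniform over neighbours respectively.

  A mark \<open>m (v, n)\<close> consists of the waiting time between rings number \<open>n - 1\<close> and \<open>n\<close> of
  the clock at \<open>v\<close> and the target of the jump at ring \<open>n\<close>.\<close>

type_synonym 'v marks = "'v \<times> nat \<Rightarrow> real \<times> 'v"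

definition mark_law :: "('v \<Rightarrow> 'v \<Rightarrow> bool) \<Rightarrow> 'v \<Rightarrow> (real \<times> 'v) measure" where
  "mark_law adj v =
     density lborel (\<lambda>s. ennreal (exponential_density 1 s)) \<Otimes>\<^sub>M measure_pmf (srw_step adj v)"

text \<open>The joint law of initial states, i.i.d. with law \<open>\<mu>\<close>, and all marks, everything independent.
  The state of a site is \<^const>\<open>None\<close> if it is empty and otherwise \<^const>\<open>Some\<close> of the type of the
  particle there.\<close>

definition driving_law ::
    "('v \<Rightarrow> 'v \<Rightarrow> bool) \<Rightarrow> 'k option pmf \<Rightarrow> (('v \<Rightarrow> 'k option) \<times> 'v marks) measure" where
  "driving_law adj \<mu> =
     (\<Pi>\<^sub>M v\<in>UNIV. measure_pmf \<mu>) \<Otimes>\<^sub>M (\<Pi>\<^sub>M i\<in>UNIV. mark_law adj (fst i))"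

definition jump :: "'v marks \<Rightarrow> real \<Rightarrow> 'v \<Rightarrow> 'v \<Rightarrow> bool" where
  "jump m s v w \<longleftrightarrow> (\<exists>n. s = (\<Sum>k\<le>n. fst (m (v, k))) \<and> w = snd (m (v, n)))"

text \<open>The state of the target of a jump, from the states of source and target just before it;
  \<open>react\<close> gives the outcome when two particles meet.\<close>

fun join :: "('k \<Rightarrow> 'k \<Rightarrow> 'k option) \<Rightarrow> 'k option \<Rightarrow> 'k option \<Rightarrow> 'k option" where
  "join react None b = b"
| "join react (Some a) None = Some a"
| "join react (Some a) (Some b) = react a b"

text \<open>The second clause says that the state of \<open>x\<close> only changes at jumps out of or into \<open>x\<close>;
  as almost surely these have no finite accumulation point, \<open>\<eta> r\<close> has a left limit at
  \<open>s\<close> at each of the two sites involved in a jump at time \<open>s\<close>, which the first clause refers to.\<close>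

definition evolves_by ::
    "('k \<Rightarrow> 'k \<Rightarrow> 'k option) \<Rightarrow> 'v marks \<Rightarrow> (real \<Rightarrow> 'v \<Rightarrow> 'k option) \<Rightarrow> bool" where
  "evolves_by react m \<eta> \<longleftrightarrow>
     (\<forall>s v w. jump m s v w \<longrightarrow>
        (\<forall>\<^sub>F r in at_left s. \<eta> s v = None \<and> \<eta> s w = join react (\<eta> r v) (\<eta> r w))) \<and>
     (\<forall>s t x. 0 \<le> s \<and> s \<le> t \<and> (\<forall>r v w. s < r \<and> r \<le> t \<and> jump m r v w \<longrightarrow> x \<noteq> v \<and> x \<noteq> w) \<longrightarrow>
        \<eta> t x = \<eta> s x)"

text \<open>On graphs of bounded degree the driving variables almost surely determine \<open>\<eta>\<close>, so the
  following fixes the law of the process.\<close>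

definition reacting_walks ::
    "('v \<Rightarrow> 'v \<Rightarrow> bool) \<Rightarrow> ('k \<Rightarrow> 'k \<Rightarrow> 'k option) \<Rightarrow> 'k option pmf \<Rightarrow>
     'w measure \<Rightarrow> (real \<Rightarrow> 'v \<Rightarrow> 'w \<Rightarrow> 'k option) \<Rightarrow> bool" where
  "reacting_walks adj react \<mu> M \<eta> \<longleftrightarrow>
     prob_space M \<and>
     (\<forall>t\<ge>0. \<forall>x. \<eta> t x \<in> M \<rightarrow>\<^sub>M count_space UNIV) \<and>
     (\<exists>init m.
        (\<lambda>\<omega>. (init \<omega>, m \<omega>)) \<in> M \<rightarrow>\<^sub>M driving_law adj \<mu> \<and>
        distr M (driving_law adj \<mu>) (\<lambda>\<omega>. (init \<omega>, m \<omega>)) = driving_law adj \<mu> \<and>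
        (AE \<omega> in M. (\<forall>x. \<eta> 0 x \<omega> = init \<omega> x) \<and> evolves_by react (m \<omega>) (\<lambda>t x. \<eta> t x \<omega>)))"


section \<open>The two systems\<close>

datatype particle_type = TypeA | TypeB

definition annihilate_coalesce :: "particle_type \<Rightarrow> particle_type \<Rightarrow> particle_type option" where
  "annihilate_coalesce a b = (if a = b then Some a else None)"

primrec charge :: "particle_type option \<Rightarrow> int" where
  "charge None = 0"
| "charge (Some a) = (case a of TypeA \<Rightarrow> 1 | TypeB \<Rightarrow> - 1)"

definition dlacs ::
    "('v \<Rightarrow> 'v \<Rightarrow> bool) \<Rightarrow> 'w measure \<Rightarrow> (real \<Rightarrow> 'v \<Rightarrow> 'w \<Rightarrow> int) \<Rightarrow> bool" where
  "dlacs adj M \<xi> \<longleftrightarrow>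
     (\<exists>\<eta>. reacting_walks adj annihilate_coalesce
            (map_pmf (\<lambda>b. Some (if b then TypeA else TypeB)) (bernoulli_pmf (1 / 2))) M \<eta> \<and>
          (\<forall>t\<ge>0. \<forall>x. \<forall>\<omega>\<in>space M. \<xi> t x \<omega> = charge (\<eta> t x \<omega>)))"

definition coalescing_random_walk ::
    "('v \<Rightarrow> 'v \<Rightarrow> bool) \<Rightarrow> 'w measure \<Rightarrow> (real \<Rightarrow> 'v \<Rightarrow> 'w \<Rightarrow> nat) \<Rightarrow> bool" where
  "coalescing_random_walk adj M \<zeta> \<longleftrightarrow>
     (\<exists>\<eta>. reacting_walks adj (\<lambda>(_ :: unit) _. Some ()) (return_pmf (Some ())) M \<eta> \<and>
          (\<forall>t\<ge>0. \<forall>x. \<forall>\<omega>\<in>space M. \<zeta> t x \<omega> = (if \<eta> t x \<omega> = None then 0 else 1)))"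

end

theory Submission
  imports Defs "HOL-Library.Sublist"
begin

text \<open>
  Colour the coalescing random walk: let each walk carry the outcome \<open>A\<close>, \<open>B\<close> or \<open>\<emptyset>\<close> of the
  reactions among the \<open>n\<close> initial particles merged into it. By induction over the mergers, in any
  order, the outcome is nonempty with probability \<open>2/3 (1 - (-1/2)\<^sup>n)\<close>. So with \<open>N\<^sub>t\<close> the number of
  initial particles merged into the walk at the root at time \<open>t\<close> (0 if there is none), the two
  sides differ by at most \<open>E[2\<^sup>-\<^sup>N; N\<^sub>t > 0]\<close>, and it suffices that
  \<open>P(N\<^sub>t = j) = o(P(N\<^sub>t > 0))\<close> for every \<open>j \<ge> 1\<close>.

  Put \<open>S(t) = P(N\<^sub>t > 0)\<close>. A backward cluster of size \<open>j\<close> loses a site within a fixed time with a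
  probability bounded below, so \<open>P(N\<^sub>t = 1)\<close> is at most a constant times a decrement
  \<open>S(t) - S(t + h)\<close>, and inductively so is \<open>P(N\<^sub>t = j)\<close> for every \<open>j\<close>. Negative correlation of the
  occupation of two sites gives \<open>S(t) - S(t + h) \<le> h S(t)\<^sup>2\<close>. Finally \<open>S(t) \<rightarrow> 0\<close>: the decrements of
  the monotone \<open>S\<close> vanish, so \<open>N\<^sub>t\<close> tends to infinity on survival, whereas its mean is at most 1
  since the kernel is symmetric.

  The estimates are made for the jumps inside a finite set of sites, whose law is a convolution
  semigroup of laws on lists, by splitting time into short steps.
\<close>

section \<open>Finite lists of jumps\<close>

text \<open>On an infinite graph infinitely many clocks ring in every time interval, so there is no
  first jump to condition on and no list of jumps to induct over. The cut to a finite set \<Lambda>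
  restores lists. Jumps with an end outside \<Lambda> are dropped, which keeps the rates along edges
  symmetric and the clusters of sites of \<Lambda> inside \<Lambda>. The cut is harmless because the
  influence of distant sites decays at a rate that does not depend on \<Lambda>
  (\<open>prob_reaches\<close>). Differential inequalities are replaced by steps of length \<delta>
  with an error of order \<delta>^2. Where the limit of small \<delta> is taken inside a fixed
  \<Lambda>, as for correlations and means, the constant may depend on \<Lambda>. Where it is taken
  after \<Lambda> has grown, as in \<open>S_drop\<close>, the constant must be local; hence the
  estimates that only count jumps starting in the neighbourhood of a cluster.\<close>

definition move :: "'v \<times> 'v \<Rightarrow> 'v \<Rightarrow> 'v" where
  "move e z = (if z = fst e then snd e else z)"

text \<open>The preimage of {x} under \<open>flow l\<close> is the backward cluster of x: the sites
  whose walks have merged into the one at x after the jumps of \<open>l\<close>. Preimages take a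
  prepended jump last, so the cluster evolves from the end of the list to its beginning.\<close>

definition flow :: "('v \<times> 'v) list \<Rightarrow> 'v \<Rightarrow> 'v" where
  "flow l = fold move l"

definition update ::
    "('k \<Rightarrow> 'k \<Rightarrow> 'k option) \<Rightarrow> 'v \<times> 'v \<Rightarrow> ('v \<Rightarrow> 'k option) \<Rightarrow> 'v \<Rightarrow> 'k option" where
  "update react e \<sigma> = \<sigma>(fst e := None, snd e := join react (\<sigma> (fst e)) (\<sigma> (snd e)))"

definition merge_mass :: "'v \<times> 'v \<Rightarrow> ('v \<Rightarrow> nat) \<Rightarrow> 'v \<Rightarrow> nat" where
  "merge_mass e c = c(fst e := 0, snd e := c (fst e) + c (snd e))"

lemma flow_Nil [simp]: "flow [] = id"
  by (simp add: flow_def)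

lemma flow_Cons: "flow (e # l) z = flow l (move e z)"
  by (simp add: flow_def)

lemma vimage_flow_Cons [simp]: "flow (e # l) -` B = move e -` (flow l -` B)"
  by (auto simp: flow_Cons)

lemma flow_append: "flow (l @ l') z = flow l' (flow l z)"
  by (simp add: flow_def)

lemma vimage_flow_append: "flow (l @ l') -` B = flow l -` (flow l' -` B)"
  by (auto simp: flow_append)

lemma vimage_move:
  "move e -` B = (if snd e \<in> B then insert (fst e) B else B - {fst e})"
  by (auto simp: move_def split: if_splits)

lemma finite_vimage_move: "finite B \<Longrightarrow> finite (move e -` B)"
  by (simp add: vimage_move)

lemma finite_vimage_flow: "finite B \<Longrightarrow> finite (flow l -` B)"
proof (induction l arbitrary: B)
  case (Cons e l)
  then show ?case by (simp add: finite_vimage_move)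
qed simp

lemma vimage_flow_subset:
  assumes "B \<subseteq> \<Lambda>" "\<And>v w. (v, w) \<in> set l \<Longrightarrow> v \<in> \<Lambda>"
  shows "flow l -` B \<subseteq> \<Lambda>"
  using assms
proof (induction l)
  case (Cons e l)
  then have "flow l -` B \<subseteq> \<Lambda>" "fst e \<in> \<Lambda>"
    by (auto intro: Cons.prems(2)[of _ "snd e"])
  then show ?case
    by (auto simp: vimage_move split: if_splits)
qed simp

lemma flow_fixed:
  assumes "\<And>v w. (v, w) \<in> set l \<Longrightarrow> v \<noteq> z"
  shows "flow l z = z"
  using assms
proof (induction l)
  case (Cons e l)
  have "fst e \<noteq> z" using Cons.prems[of "fst e" "snd e"] by simp
  moreover have "flow l z = z" using Cons by auto
  ultimately show ?case by (auto simp: flow_Cons move_def)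
qed simp

text \<open>Duality: mass found in B afterwards was in the preimage of B before. Source and target
  must differ, as \<open>merge_mass\<close> would otherwise double the mass of the site.\<close>

lemma sum_merge_mass:
  assumes "finite B" "fst e \<noteq> snd e"
  shows "(\<Sum>z\<in>B. merge_mass e c z) = (\<Sum>z\<in>move e -` B. c z)"
proof -
  have B: "(\<Sum>z\<in>B. merge_mass e c z) =
      (\<Sum>z\<in>B \<inter> {fst e, snd e}. merge_mass e c z) + (\<Sum>z\<in>B - {fst e, snd e}. c z)"
    unfolding sum.Int_Diff[OF assms(1), where B = "{fst e, snd e}"]
    by (auto simp: merge_mass_def)
  show ?thesis
  proof (cases "snd e \<in> B")
    case True
    then have "move e -` B = insert (fst e) (insert (snd e) (B - {fst e, snd e}))"
      by (auto simp: vimage_move)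
    moreover have "B \<inter> {fst e, snd e} = (if fst e \<in> B then {fst e, snd e} else {snd e})"
      using True by auto
    ultimately show ?thesis unfolding B using assms by (auto simp: merge_mass_def)
  next
    case False
    then have "move e -` B = B - {fst e, snd e}"
      "B \<inter> {fst e, snd e} = (if fst e \<in> B then {fst e} else {})"
      by (auto simp: vimage_move)
    then show ?thesis unfolding B using assms by (auto simp: merge_mass_def)
  qed
qed

lemma sum_fold_merge_mass:
  assumes "finite B" "\<And>v w. (v, w) \<in> set l \<Longrightarrow> v \<noteq> w"
  shows "(\<Sum>z\<in>B. fold merge_mass l c z) = (\<Sum>z\<in>flow l -` B. c z)"
  using assms
proof (induction l arbitrary: c)
  case (Cons e l)
  have "fst e \<noteq> snd e" using Cons.prems(2)[of "fst e" "snd e"] by simp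
  then have "(\<Sum>z\<in>B. fold merge_mass (e # l) c z) = (\<Sum>z\<in>move e -` (flow l -` B). c z)"
    using Cons by (simp add: sum_merge_mass finite_vimage_flow)
  then show ?case by simp
qed simp

text \<open>With one initial particle per site, the number of particles merged at x is the size of
  the backward cluster.\<close>

lemma fold_merge_mass_1:
  assumes "\<And>v w. (v, w) \<in> set l \<Longrightarrow> v \<noteq> w"
  shows "fold merge_mass l (\<lambda>_. 1) x = card (flow l -` {x})"
  using sum_fold_merge_mass[of "{x}" l "\<lambda>_. 1"] assms by simp


section \<open>The law of a site, given the jumps\<close>

text \<open>\<open>\<nu> n\<close> is the law of a particle resulting from \<open>n\<close> initial ones; that it does not depend on
  the order in which they merged is what makes the computation work.\<close>

definition merging_laws :: "('k \<Rightarrow> 'k \<Rightarrow> 'k option) \<Rightarrow> (nat \<Rightarrow> 'k option pmf) \<Rightarrow> bool" where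
  "merging_laws react \<nu> \<longleftrightarrow> \<nu> 0 = return_pmf None \<and>
     (\<forall>a b. map_pmf (\<lambda>(x, y). join react x y) (pair_pmf (\<nu> a) (\<nu> b)) = \<nu> (a + b))"

text \<open>A jump makes its source deterministically empty and gives its target the law of the
  summed mass, since these two states were independent; no other site is touched. So, given the
  jumps, the states stay independent and the masses determine their laws.\<close>

lemma map_update_Pi_pmf:
  assumes "merging_laws react \<nu>" "finite F" "fst e \<in> F" "snd e \<in> F" "fst e \<noteq> snd e"
  shows "map_pmf (update react e) (Pi_pmf F None (\<lambda>x. \<nu> (c x))) =
         Pi_pmf F None (\<lambda>x. \<nu> (merge_mass e c x))"
proof -
  define v w F' where "v = fst e" and "w = snd e" and "F' = F - {v, w}"
  have F: "F = insert v (insert w F')" "v \<notin> insert w F'" "w \<notin> F'" "finite F'" "v \<noteq> w"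
    using assms by (auto simp: v_def w_def F'_def)
  have nu: "\<nu> 0 = return_pmf None" "\<And>a b. \<nu> (a + b) =
      bind_pmf (\<nu> a) (\<lambda>x. bind_pmf (\<nu> b) (\<lambda>y. return_pmf (join react x y)))"
    using assms(1) by (auto simp: merging_laws_def pair_pmf_def map_pmf_def bind_assoc_pmf
        bind_return_pmf split_def)
  have F'eq: "Pi_pmf F' None (\<lambda>x. \<nu> (merge_mass e c x)) = Pi_pmf F' None (\<lambda>x. \<nu> (c x))"
    using F by (intro Pi_pmf_cong) (auto simp: merge_mass_def v_def w_def)
  have "map_pmf (update react e) (Pi_pmf F None (\<lambda>x. \<nu> (c x))) =
     do {a \<leftarrow> \<nu> (c v); b \<leftarrow> \<nu> (c w); f \<leftarrow> Pi_pmf F' None (\<lambda>x. \<nu> (c x));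
         return_pmf (f(v := None, w := join react a b))}"
    unfolding F(1)
    using F by (simp add: Pi_pmf_insert' map_pmf_def bind_assoc_pmf bind_return_pmf update_def
        v_def[symmetric] w_def[symmetric] fun_upd_twist[of v w])
  also have "\<dots> = do {s \<leftarrow> \<nu> (c v + c w); f \<leftarrow> Pi_pmf F' None (\<lambda>x. \<nu> (c x));
         return_pmf (f(v := None, w := s))}"
    by (simp add: nu(2) bind_assoc_pmf bind_return_pmf)
  also have "\<dots> = Pi_pmf F None (\<lambda>x. \<nu> (merge_mass e c x))"
    unfolding F(1) using F
    by (simp add: Pi_pmf_insert' F'eq)
       (simp add: Pi_pmf_insert' F'eq merge_mass_def v_def[symmetric] w_def[symmetric] nu(1)
        bind_assoc_pmf bind_return_pmf fun_upd_twist[of v w])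
  finally show ?thesis .
qed

lemma map_fold_update_Pi_pmf:
  assumes "merging_laws react \<nu>" "finite F"
    and "\<And>v w. (v, w) \<in> set l \<Longrightarrow> v \<in> F \<and> w \<in> F \<and> v \<noteq> w"
  shows "map_pmf (fold (update react) l) (Pi_pmf F None (\<lambda>x. \<nu> (c x))) =
         Pi_pmf F None (\<lambda>x. \<nu> (fold merge_mass l c x))"
  using assms(3)
proof (induction l arbitrary: c)
  case (Cons e l)
  have e: "fst e \<in> F" "snd e \<in> F" "fst e \<noteq> snd e"
    using Cons.prems[of "fst e" "snd e"] by auto
  have "map_pmf (fold (update react) (e # l)) (Pi_pmf F None (\<lambda>x. \<nu> (c x))) =
    map_pmf (fold (update react) l) (map_pmf (update react e) (Pi_pmf F None (\<lambda>x. \<nu> (c x))))"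
    by (simp add: pmf.map_comp o_def)
  also have "\<dots> = map_pmf (fold (update react) l) (Pi_pmf F None (\<lambda>x. \<nu> (merge_mass e c x)))"
    by (simp only: map_update_Pi_pmf[OF assms(1,2) e])
  also have "\<dots> = Pi_pmf F None (\<lambda>x. \<nu> (fold merge_mass l (merge_mass e c) x))"
    by (rule Cons.IH) (use Cons.prems in auto)
  finally show ?case by (simp add: o_def)
qed simp

text \<open>Locality: only the initial states of the sites that occur in the list matter, which
  reduces the infinite product of initial laws to a finite one.\<close>

lemma fold_update_cong:
  assumes "\<And>y. y \<in> F \<Longrightarrow> \<sigma> y = \<sigma>' y" "\<And>v w. (v, w) \<in> set l \<Longrightarrow> v \<in> F \<and> w \<in> F" "x \<in> F"
  shows "fold (update react) l \<sigma> x = fold (update react) l \<sigma>' x"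
  using assms
proof (induction l arbitrary: \<sigma> \<sigma>')
  case (Cons e l)
  have "fst e \<in> F" "snd e \<in> F" using Cons.prems(2)[of "fst e" "snd e"] by auto
  then have "\<And>y. y \<in> F \<Longrightarrow> update react e \<sigma> y = update react e \<sigma>' y"
    using Cons.prems(1) by (auto simp: update_def)
  then have "fold (update react) l (update react e \<sigma>) x = fold (update react) l (update react e \<sigma>') x"
    using Cons.prems(2,3) by (intro Cons.IH) auto
  then show ?case by simp
qed simp

text \<open>Finitely many particle types make the state of a site countably valued, so
  \<open>join\<close> can be handled by a countable case distinction on each argument.\<close>

lemma measurable_fold_update [measurable]:
  fixes react :: "'k::finite \<Rightarrow> 'k \<Rightarrow> 'k option"
  shows "(\<lambda>\<sigma>. fold (update react) l \<sigma> x) \<in>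
     (\<Pi>\<^sub>M v\<in>UNIV. measure_pmf \<mu>) \<rightarrow>\<^sub>M count_space UNIV"
proof (induction l arbitrary: x rule: rev_induct)
  case Nil
  have "(\<lambda>\<sigma>. \<sigma> x) \<in> (\<Pi>\<^sub>M v\<in>UNIV. measure_pmf \<mu>) \<rightarrow>\<^sub>M measure_pmf \<mu>"
    by (rule measurable_component_singleton) simp
  then show ?case by simp
next
  case (snoc e l)
  have *: "(\<lambda>\<sigma>. join react (fold (update react) l \<sigma> (fst e)) (fold (update react) l \<sigma> (snd e))) \<in>
     (\<Pi>\<^sub>M v\<in>UNIV. measure_pmf \<mu>) \<rightarrow>\<^sub>M count_space UNIV"
    by (rule measurable_compose_countable[OF _ snoc], rule measurable_compose_countable[OF _ snoc]) simp
  have eq: "fold (update react) (l @ [e]) \<sigma> x = (if x = snd e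
      then join react (fold (update react) l \<sigma> (fst e)) (fold (update react) l \<sigma> (snd e))
      else if x = fst e then None else fold (update react) l \<sigma> x)" for \<sigma>
    by (simp add: update_def[of react e])
  show ?case unfolding eq
    by (intro measurable_If * snoc measurable_const) simp_all
qed

text \<open>Only x and the sites touched by \<open>l\<close> matter. The event splits into finitely
  many cylinders, whose probabilities are those of the finite product treated by
  \<open>map_fold_update_Pi_pmf\<close>.\<close>

lemma prob_fold_update:
  fixes react :: "'k::finite \<Rightarrow> 'k \<Rightarrow> 'k option" and l :: "('v \<times> 'v) list"
  assumes "merging_laws react \<nu>" "\<And>v w. (v, w) \<in> set l \<Longrightarrow> v \<noteq> w"
  defines "P \<equiv> (\<Pi>\<^sub>M v\<in>UNIV. measure_pmf (\<nu> 1))"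
  shows "measure P {\<sigma> \<in> space P. fold (update react) l \<sigma> x \<in> S} =
         measure_pmf.prob (\<nu> (card (flow l -` {x}))) S"
proof -
  interpret product_prob_space "\<lambda>v. measure_pmf (\<nu> 1)" UNIV
    by unfold_locales
  define F where "F = insert x (fst ` set l \<union> snd ` set l)"
  have fin: "finite F" and F: "\<And>v w. (v, w) \<in> set l \<Longrightarrow> v \<in> F \<and> w \<in> F" and xF: "x \<in> F"
    by (force simp: F_def)+
  \<comment> \<open>Patterns are \<open>None\<close> off F, the default value of
    \<open>Pi_pmf\<close>; two of them therefore differ inside F, and their cylinders are
    disjoint.\<close>
  define A where "A = {a \<in> PiE_dflt F None (\<lambda>_. UNIV). fold (update react) l a x \<in> S}"
  have finA: "finite A" unfolding A_def
    by (rule finite_subset[OF _ finite_PiE_dflt[OF fin, of "\<lambda>_. UNIV" None]]) auto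
  define E where "E a = {\<sigma> \<in> space P. \<forall>i\<in>F. \<sigma> i \<in> {a i}}" for a :: "'v \<Rightarrow> 'k option"
  have spP: "space P = UNIV" by (auto simp: P_def space_PiM PiE_def)
  have E: "emeasure P (E a) = ennreal (\<Prod>i\<in>F. pmf (\<nu> 1) (a i))" "E a \<in> sets P" for a
  proof -
    show "emeasure P (E a) = ennreal (\<Prod>i\<in>F. pmf (\<nu> 1) (a i))"
      unfolding E_def P_def using fin
      by (subst emeasure_PiM_Collect)
         (auto simp: emeasure_pmf_single prod_ennreal)
    show "E a \<in> sets P" unfolding E_def P_def using fin
      by (intro sets.sets_Collect_finite_All sets_Collect_single') auto
  qed
  have un: "{\<sigma> \<in> space P. fold (update react) l \<sigma> x \<in> S} = (\<Union>a\<in>A. E a)"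
  proof (intro Set.set_eqI iffI)
    fix \<sigma> assume \<sigma>: "\<sigma> \<in> {\<sigma> \<in> space P. fold (update react) l \<sigma> x \<in> S}"
    define a where "a = (\<lambda>i. if i \<in> F then \<sigma> i else None)"
    have "fold (update react) l a x = fold (update react) l \<sigma> x"
      by (rule fold_update_cong[where F = F]) (use F xF in \<open>auto simp: a_def\<close>)
    then have "a \<in> A" using \<sigma> by (auto simp: A_def PiE_dflt_def a_def)
    moreover have "\<sigma> \<in> E a" using \<sigma> by (auto simp: E_def a_def)
    ultimately show "\<sigma> \<in> (\<Union>a\<in>A. E a)" by auto
  next
    fix \<sigma> assume "\<sigma> \<in> (\<Union>a\<in>A. E a)"
    then obtain a where a: "a \<in> A" "\<sigma> \<in> E a" by auto
    have "fold (update react) l a x = fold (update react) l \<sigma> x"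
      by (rule fold_update_cong[where F = F]) (use F xF a in \<open>auto simp: E_def\<close>)
    then show "\<sigma> \<in> {\<sigma> \<in> space P. fold (update react) l \<sigma> x \<in> S}"
      using a by (auto simp: A_def E_def)
  qed
  have disj: "disjoint_family_on E A"
    by (auto simp: disjoint_family_on_def E_def A_def PiE_dflt_def fun_eq_iff) metis
  have "emeasure P {\<sigma> \<in> space P. fold (update react) l \<sigma> x \<in> S} = (\<Sum>a\<in>A. emeasure P (E a))"
    unfolding un using E(2) disj finA by (subst sum_emeasure) auto
  also have "\<dots> = (\<Sum>a\<in>A. ennreal (pmf (Pi_pmf F None (\<lambda>_. \<nu> 1)) a))"
    by (intro sum.cong refl) (auto simp: E pmf_Pi fin A_def PiE_dflt_def)
  also have "\<dots> = ennreal (measure_pmf.prob (Pi_pmf F None (\<lambda>_. \<nu> 1)) A)"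
    using finA by (simp add: measure_measure_pmf_finite)
  also have "measure_pmf.prob (Pi_pmf F None (\<lambda>_. \<nu> 1)) A =
    measure_pmf.prob (Pi_pmf F None (\<lambda>_. \<nu> 1)) {a. fold (update react) l a x \<in> S}"
    using set_Pi_pmf_subset[OF fin, of None "\<lambda>_. \<nu> 1"]
    by (intro measure_prob_cong_0) (auto simp: A_def PiE_dflt_def pmf_eq_0_set_pmf)
  also have "\<dots> = measure_pmf.prob (map_pmf (\<lambda>f. f x) (map_pmf (fold (update react) l) (Pi_pmf F None (\<lambda>_. \<nu> 1)))) S"
    by (simp add: vimage_def)
  also have "map_pmf (\<lambda>f. f x) (map_pmf (fold (update react) l) (Pi_pmf F None (\<lambda>_. \<nu> 1)))
     = map_pmf (\<lambda>f. f x) (Pi_pmf F None (\<lambda>x. \<nu> (fold merge_mass l (\<lambda>_. 1) x)))"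
    by (subst map_fold_update_Pi_pmf[OF assms(1) fin, where c = "\<lambda>_. 1", symmetric])
       (use F assms(2) in auto)
  also have "\<dots> = \<nu> (card (flow l -` {x}))"
    using xF assms(2) by (subst Pi_pmf_component[OF fin]) (simp add: fold_merge_mass_1[simplified])
  finally show ?thesis by (simp add: Sigma_Algebra.measure_def)
qed

text \<open>Give an empty outcome the weight 1 and a particle of either type the weight -1/2. If two
  independent outcomes have laws symmetric in the types, the mean weight of their merger is the
  product of the mean weights: two particles leave nothing or one particle with probability 1/2
  each, which gives 1/2 - 1/4 = (-1/2)^2. So n initial particles have mean weight (-1/2)^n, and with
  the symmetry this fixes the law.\<close>

definition charge_law :: "nat \<Rightarrow> particle_type option pmf" where
  "charge_law n = embed_pmf (\<lambda>s. case s of None \<Rightarrow> (1 + 2 * (- 1 / 2) ^ n) / 3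
     | Some _ \<Rightarrow> (1 - (- 1 / 2) ^ n) / 3)"

lemma UNIV_particle_type: "UNIV = {TypeA, TypeB}"
  using particle_type.exhaust by auto

instance particle_type :: finite
  by standard (simp add: UNIV_particle_type)

text \<open>The lower bound, attained at n = 1, keeps the probability of \<open>None\<close> in
  \<open>charge_law\<close> nonnegative.\<close>

lemma minus_half_power_bounds: "- 1 / 2 \<le> (- 1 / 2 :: real) ^ n" "(- 1 / 2 :: real) ^ n \<le> 1"
proof -
  have "\<bar>(- 1 / 2 :: real) ^ n\<bar> \<le> 1" by (simp add: power_abs power_le_one)
  then show "(- 1 / 2 :: real) ^ n \<le> 1" by linarith
  show "- 1 / 2 \<le> (- 1 / 2 :: real) ^ n"
  proof (cases n)
    case (Suc k)
    have "\<bar>(- 1 / 2 :: real) ^ n\<bar> \<le> 1 / 2"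
      unfolding Suc by (simp add: abs_mult power_abs power_le_one)
    then show ?thesis by linarith
  qed simp
qed

lemma pmf_charge_law:
  "pmf (charge_law n) None = (1 + 2 * (- 1 / 2) ^ n) / 3"
  "pmf (charge_law n) (Some a) = (1 - (- 1 / 2) ^ n) / 3"
proof -
  let ?f = "\<lambda>s :: particle_type option. case s of None \<Rightarrow> (1 + 2 * (- 1 / 2) ^ n) / 3
     | Some _ \<Rightarrow> (1 - (- 1 / 2 :: real) ^ n) / 3"
  have nn: "0 \<le> ?f s" for s
    using minus_half_power_bounds[of n] by (auto split: option.split)
  have "pmf (embed_pmf ?f) s = ?f s" for s
  proof (rule pmf_embed_pmf)
    have "(\<integral>\<^sup>+x. ennreal (?f x) \<partial>count_space UNIV) = (\<Sum>x\<in>UNIV. ennreal (?f x))"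
      by (rule nn_integral_count_space_finite) simp
    also have "\<dots> = ennreal (\<Sum>x\<in>UNIV. ?f x)" by (rule sum_ennreal) (rule nn)
    also have "(\<Sum>x\<in>UNIV. ?f x) = 1"
      by (simp add: UNIV_option_conv UNIV_particle_type field_simps)
    finally show "(\<integral>\<^sup>+x. ennreal (?f x) \<partial>count_space UNIV) = 1" by simp
  qed (rule nn)
  then show "pmf (charge_law n) None = (1 + 2 * (- 1 / 2) ^ n) / 3"
    "pmf (charge_law n) (Some a) = (1 - (- 1 / 2) ^ n) / 3"
    by (simp_all add: charge_law_def)
qed

text \<open>All nine pairs of states are summed; the identity that results in (-1/2)^a and (-1/2)^b
  expresses that mean weights multiply.\<close>

lemma merging_laws_charge: "merging_laws annihilate_coalesce charge_law"
  unfolding merging_laws_def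
proof (intro conjI allI)
  show "charge_law 0 = return_pmf None"
  proof (rule pmf_eqI)
    fix s :: "particle_type option"
    show "pmf (charge_law 0) s = pmf (return_pmf None) s"
      by (cases s) (simp_all add: pmf_charge_law)
  qed
  fix a b
  show "map_pmf (\<lambda>(x, y). join annihilate_coalesce x y) (pair_pmf (charge_law a) (charge_law b)) =
        charge_law (a + b)"
  proof (rule pmf_eqI)
    fix s
    have "pmf (map_pmf (\<lambda>(x, y). join annihilate_coalesce x y) (pair_pmf (charge_law a) (charge_law b))) s
      = (\<Sum>x\<in>UNIV. \<Sum>y\<in>UNIV. pmf (charge_law a) x * (pmf (charge_law b) y *
           (if join annihilate_coalesce x y = s then 1 else 0)))"
      by (simp add: map_pmf_def pair_pmf_def bind_assoc_pmf bind_return_pmf pmf_bind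
          integral_measure_pmf[of UNIV] pmf_return sum_distrib_left indicator_def mult_ac)
        (rule sum.cong[OF refl], simp add: sum.If_cases if_distrib cong: if_cong)
    also have "\<dots> = pmf (charge_law (a + b)) s"
    proof (cases s)
      case None
      show ?thesis unfolding None
        by (simp add: UNIV_option_conv UNIV_particle_type pmf_charge_law annihilate_coalesce_def
            power_add) (simp add: field_simps)
    next
      case (Some p)
      show ?thesis unfolding Some
        by (cases p) (simp_all add: UNIV_option_conv UNIV_particle_type pmf_charge_law
            annihilate_coalesce_def power_add, simp_all add: field_simps)
    qed
    finally show "pmf (map_pmf (\<lambda>(x, y). join annihilate_coalesce x y)
       (pair_pmf (charge_law a) (charge_law b))) s = pmf (charge_law (a + b)) s" .
  qed
qed

lemma charge_law_1:
  "charge_law 1 = map_pmf (\<lambda>b. Some (if b then TypeA else TypeB)) (bernoulli_pmf (1 / 2))"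
proof (rule pmf_eqI)
  fix s :: "particle_type option"
  let ?f = "\<lambda>b. Some (if b then TypeA else TypeB)"
  consider "s = None" | "s = Some TypeA" | "s = Some TypeB"
    by (metis option.exhaust particle_type.exhaust)
  then show "pmf (charge_law 1) s = pmf (map_pmf ?f (bernoulli_pmf (1 / 2))) s"
  proof cases
    case 1
    have "?f -` {None} = {}" by auto
    then show ?thesis unfolding 1 pmf_map by (simp add: pmf_charge_law)
  next
    case 2
    have "?f -` {Some TypeA} = {True}" by (auto split: if_splits)
    then show ?thesis unfolding 2 pmf_map by (simp add: pmf_charge_law measure_pmf_single)
  next
    case 3
    have "?f -` {Some TypeB} = {False}" by (auto split: if_splits)
    then show ?thesis unfolding 3 pmf_map by (simp add: pmf_charge_law measure_pmf_single)
  qed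
qed

lemma prob_charge_law: "measure_pmf.prob (charge_law n) (- {None}) = 2 / 3 * (1 - (- 1 / 2) ^ n)"
proof -
  have "measure_pmf.prob (charge_law n) (- {None}) = 1 - pmf (charge_law n) None"
    using measure_pmf.prob_compl[of "{None}" "charge_law n"]
    by (simp add: measure_pmf_single Compl_eq_Diff_UNIV)
  then show ?thesis by (simp add: pmf_charge_law field_simps)
qed

text \<open>With a single type the state of a site is a function of the jumps, so the laws are point
  masses, and both systems become instances of \<open>merging_laws\<close>.\<close>

definition occupied_law :: "nat \<Rightarrow> unit option pmf" where
  "occupied_law n = return_pmf (if n = 0 then None else Some ())"

lemma merging_laws_occupied: "merging_laws (\<lambda>_ _. Some ()) occupied_law"
  by (auto simp: merging_laws_def occupied_law_def pair_return_pmf1)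

lemma prob_occupied_law: "measure_pmf.prob (occupied_law n) (- {None}) = (if n = 0 then 0 else 1)"
  by (simp add: occupied_law_def)


section \<open>Splicing a Poisson clock\<close>

definition ring_law :: "'v pmf \<Rightarrow> (real \<times> 'v) measure" where
  "ring_law p = density lborel (\<lambda>s. ennreal (exponential_density 1 s)) \<Otimes>\<^sub>M measure_pmf p"

definition clock_law :: "'v pmf \<Rightarrow> (nat \<Rightarrow> real \<times> 'v) measure" where
  "clock_law p = (\<Pi>\<^sub>M n\<in>UNIV. ring_law p)"

abbreviation exp_law :: "real measure" where
  "exp_law \<equiv> density lborel (\<lambda>s. ennreal (exponential_density 1 s))"

lemma mark_law_eq: "mark_law adj v = ring_law (srw_step adj v)"
  by (simp add: mark_law_def ring_law_def)

lemma prob_space_exp_law: "prob_space exp_law"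
  by (rule prob_space_exponential_density) simp

lemma prob_space_ring_law: "prob_space (ring_law p)"
proof -
  interpret a: prob_space exp_law by (rule prob_space_exp_law)
  interpret pair_prob_space exp_law "measure_pmf p" ..
  show ?thesis unfolding ring_law_def by unfold_locales
qed

lemma sets_ring_law [measurable_cong]: "sets (ring_law p) = sets (borel \<Otimes>\<^sub>M count_space UNIV)"
  unfolding ring_law_def by (intro sets_pair_measure_cong) simp_all

lemma space_ring_law [simp]: "space (ring_law p) = UNIV"
  by (simp add: ring_law_def space_pair_measure)

lemma emeasure_exp_law_le: "emeasure exp_law {..s} = ennreal (if 0 \<le> s then 1 - exp (- s) else 0)"
  using emeasure_erlang_density[of 1 0 s] by (simp add: erlang_CDF_0)

lemma emeasure_exp_law_gt: "0 \<le> s \<Longrightarrow> emeasure exp_law {s<..} = ennreal (exp (- s))"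
proof -
  assume s: "0 \<le> s"
  interpret prob_space exp_law by (rule prob_space_exp_law)
  have "prob {..s} = 1 - exp (- s)"
    using s by (simp add: Sigma_Algebra.measure_def emeasure_exp_law_le)
  then have "prob (space exp_law - {..s}) = exp (- s)"
    by (subst prob_compl) auto
  moreover have "space exp_law - {..s} = {s<..}" by auto
  ultimately show ?thesis by (simp add: emeasure_eq_measure)
qed

lemma emeasure_ring_law_Times:
  "A \<in> sets borel \<Longrightarrow> emeasure (ring_law p) (A \<times> B) = emeasure exp_law A * emeasure (measure_pmf p) B"
proof -
  assume A: "A \<in> sets borel"
  interpret a: prob_space exp_law by (rule prob_space_exp_law)
  show ?thesis unfolding ring_law_def
    using A by (intro measure_pmf.emeasure_pair_measure_Times) auto
qed

text \<open>Memorylessness, written as a product with the probability of waiting beyond s instead of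
  a conditional probability.\<close>

lemma exp_law_shift:
  assumes [measurable]: "Y \<in> sets borel" and s: "0 \<le> s"
  shows "emeasure exp_law {s<..} * emeasure exp_law {e. s + e \<in> Y} = emeasure exp_law (Y \<inter> {s<..})"
proof -
  have "emeasure exp_law {e. s + e \<in> Y} =
      (\<integral>\<^sup>+e. ennreal (exponential_density 1 e) * indicator Y (s + e) \<partial>lborel)"
    by (subst emeasure_density) (auto simp: indicator_def intro!: nn_integral_cong)
  also have "\<dots> = (\<integral>\<^sup>+e. (\<lambda>x. ennreal (exponential_density 1 (x - s)) * indicator Y x) (s + 1 * e) \<partial>lborel)"
    by simp
  also have "\<dots> = (\<integral>\<^sup>+x. ennreal (exponential_density 1 (x - s)) * indicator Y x \<partial>lborel)"
    by (subst nn_integral_real_affine[where c = 1 and t = s]) auto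
  finally have "emeasure exp_law {s<..} * emeasure exp_law {e. s + e \<in> Y} =
      (\<integral>\<^sup>+x. ennreal (exp (- s)) * (ennreal (exponential_density 1 (x - s)) * indicator Y x) \<partial>lborel)"
    by (simp add: emeasure_exp_law_gt s nn_integral_cmult)
  also have "\<dots> = (\<integral>\<^sup>+x. ennreal (exponential_density 1 x) * indicator (Y \<inter> {s<..}) x \<partial>lborel)"
  proof (rule nn_integral_cong_AE)
    \<comment> \<open>At x = s the shifted density is positive although s is excluded from {s<..}; a
      single point is null.\<close>
    have "AE x in lborel. x \<noteq> s"
      using AE_lborel_singleton[of s] by simp
    then show "AE x in lborel. ennreal (exp (- s)) * (ennreal (exponential_density 1 (x - s)) * indicator Y x) =
        ennreal (exponential_density 1 x) * indicator (Y \<inter> {s<..}) x"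
    proof eventually_elim
      case (elim x)
      then show ?case using s
        by (auto simp: exponential_density_def indicator_def ennreal_mult[symmetric] exp_add[symmetric])
    qed
  qed
  also have "\<dots> = emeasure exp_law (Y \<inter> {s<..})"
    by (subst emeasure_density) auto
  finally show ?thesis .
qed

lemma emeasure_ring_law:
  assumes "X \<in> sets (ring_law p)"
  shows "emeasure (ring_law p) X = (\<integral>\<^sup>+w. emeasure exp_law ((\<lambda>e. (e, w)) -` X) \<partial>measure_pmf p)"
proof -
  interpret a: prob_space exp_law by (rule prob_space_exp_law)
  interpret pair_prob_space exp_law "measure_pmf p" ..
  show ?thesis
    using assms emeasure_pair_measure_alt2[of X] by (simp add: ring_law_def)
qed

text \<open>The target is independent of the waiting time, so memorylessness is applied to each
  section of A with a fixed target.\<close>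

lemma ring_law_shift:
  assumes A: "A \<in> sets (ring_law p)" and s: "0 \<le> s"
  shows "emeasure (ring_law p) {a. s < fst a} * emeasure (ring_law p) {a. (s + fst a, snd a) \<in> A} =
         emeasure (ring_law p) {a \<in> A. s < fst a}"
proof -
  have [measurable]: "A \<in> sets (borel \<Otimes>\<^sub>M count_space UNIV)" using A by (simp add: sets_ring_law)
  note alt = emeasure_ring_law
  have 1: "{a. (s + fst a, snd a) \<in> A} \<in> sets (ring_law p)" "{a \<in> A. s < fst a} \<in> sets (ring_law p)"
  proof -
    have "{a \<in> space (borel \<Otimes>\<^sub>M count_space UNIV). (s + fst a, snd a) \<in> A} \<in> sets (borel \<Otimes>\<^sub>M count_space UNIV)"
      by measurable
    then show "{a. (s + fst a, snd a) \<in> A} \<in> sets (ring_law p)"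
      by (simp add: sets_ring_law space_pair_measure)
    have "{a \<in> space (borel \<Otimes>\<^sub>M count_space UNIV). a \<in> A \<and> s < fst a} \<in> sets (borel \<Otimes>\<^sub>M count_space UNIV)"
      by measurable
    then show "{a \<in> A. s < fst a} \<in> sets (ring_law p)"
      by (simp add: sets_ring_law space_pair_measure)
  qed
  have "{a. s < fst a} = {s<..} \<times> (UNIV :: 'a set)" by auto
  then have 2: "emeasure (ring_law p) {a. s < fst a} = emeasure exp_law {s<..}"
    by (simp add: emeasure_ring_law_Times)
  have sec: "(\<lambda>e. (e, w)) -` A \<in> sets borel" for w
    by (rule sets_Pair2[of _ borel "count_space UNIV"]) measurable
  have m: "(\<lambda>w. emeasure exp_law ((\<lambda>e. (e, w)) -` X)) \<in> borel_measurable (measure_pmf p)" for X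
    by simp
  have "emeasure exp_law {s<..} * emeasure (ring_law p) {a. (s + fst a, snd a) \<in> A} =
     (\<integral>\<^sup>+w. emeasure exp_law {s<..} * emeasure exp_law {e. s + e \<in> (\<lambda>e. (e, w)) -` A} \<partial>measure_pmf p)"
    by (subst alt[OF 1(1)], subst nn_integral_cmult[symmetric]) (auto simp: vimage_def)
  also have "\<dots> = (\<integral>\<^sup>+w. emeasure exp_law ((\<lambda>e. (e, w)) -` {a \<in> A. s < fst a}) \<partial>measure_pmf p)"
  proof (rule nn_integral_cong)
    fix w
    show "emeasure exp_law {s<..} * emeasure exp_law {e. s + e \<in> (\<lambda>e. (e, w)) -` A} =
        emeasure exp_law ((\<lambda>e. (e, w)) -` {a \<in> A. s < fst a})"
      using exp_law_shift[OF sec[of w] s] by (simp add: vimage_def Int_def)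
  qed
  also have "\<dots> = emeasure (ring_law p) {a \<in> A. s < fst a}"
    by (rule alt[OF 1(2), symmetric])
  finally show ?thesis unfolding 2 .
qed

text \<open>The rings of the first clock up to time \<open>s\<close>, followed by those of the second one, started at
  time \<open>s\<close>.\<close>

primrec splice_clock :: "real \<Rightarrow> (nat \<Rightarrow> real \<times> 'v) \<Rightarrow> (nat \<Rightarrow> real \<times> 'v) \<Rightarrow> nat \<Rightarrow> real \<times> 'v" where
  "splice_clock s \<omega> \<omega>' 0 = (if fst (\<omega> 0) \<le> s then \<omega> 0 else (s + fst (\<omega>' 0), snd (\<omega>' 0)))"
| "splice_clock s \<omega> \<omega>' (Suc n) =
     (if fst (\<omega> 0) \<le> s then splice_clock (s - fst (\<omega> 0)) (\<lambda>k. \<omega> (Suc k)) \<omega>' n else \<omega>' (Suc n))"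

lemma measurable_clock_component:
  assumes "g \<in> N \<rightarrow>\<^sub>M clock_law p"
  shows "(\<lambda>x. g x n) \<in> N \<rightarrow>\<^sub>M ring_law p"
proof -
  have "(\<lambda>\<omega>. \<omega> n) \<in> clock_law p \<rightarrow>\<^sub>M ring_law p"
    unfolding clock_law_def by (rule measurable_component_singleton) simp
  from measurable_compose[OF assms this] show ?thesis .
qed

text \<open>The time is a measurable function rather than a constant, because the recursion
  continues with s reduced by a random first waiting time.\<close>

lemma measurable_splice_clock [measurable]:
  assumes [measurable]: "f \<in> borel_measurable N" "g \<in> N \<rightarrow>\<^sub>M clock_law p" "h \<in> N \<rightarrow>\<^sub>M clock_law p"
  shows "(\<lambda>x. splice_clock (f x) (g x) (h x) n) \<in> N \<rightarrow>\<^sub>M ring_law p"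
  using assms
proof (induction n arbitrary: f g)
  case 0
  note [measurable] = 0
  have [measurable]: "(\<lambda>x. g x n) \<in> N \<rightarrow>\<^sub>M ring_law p" "(\<lambda>x. h x n) \<in> N \<rightarrow>\<^sub>M ring_law p" for n
    by (rule measurable_clock_component, fact)+
  have [measurable]: "(\<lambda>x. h x 0) \<in> N \<rightarrow>\<^sub>M borel \<Otimes>\<^sub>M count_space UNIV"
    "(\<lambda>x. g x 0) \<in> N \<rightarrow>\<^sub>M borel \<Otimes>\<^sub>M count_space UNIV"
    using measurable_clock_component[OF 0(3), of 0] measurable_clock_component[OF 0(2), of 0]
    unfolding measurable_cong_sets[OF refl sets_ring_law] .
  show ?case
    unfolding splice_clock.simps measurable_cong_sets[OF refl sets_ring_law] by measurable
next
  case (Suc n)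
  note [measurable] = Suc.prems
  have [measurable]: "(\<lambda>x. g x n) \<in> N \<rightarrow>\<^sub>M ring_law p" "(\<lambda>x. h x n) \<in> N \<rightarrow>\<^sub>M ring_law p" for n
    by (rule measurable_clock_component, fact)+
  have "(\<lambda>x k. g x (Suc k)) \<in> N \<rightarrow>\<^sub>M clock_law p"
    unfolding clock_law_def by (rule measurable_PiM_single') (auto simp: space_PiM)
  moreover have [measurable]: "(\<lambda>x. g x 0) \<in> N \<rightarrow>\<^sub>M borel \<Otimes>\<^sub>M count_space UNIV"
    using measurable_clock_component[OF Suc.prems(2), of 0]
    unfolding measurable_cong_sets[OF refl sets_ring_law] .
  have "(\<lambda>x. f x - fst (g x 0)) \<in> borel_measurable N" by measurable
  ultimately have "(\<lambda>x. splice_clock (f x - fst (g x 0)) (\<lambda>k. g x (Suc k)) (h x) n) \<in> N \<rightarrow>\<^sub>M ring_law p"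
    by (intro Suc.IH) (auto intro: Suc.prems)
  then show ?case by simp
qed

lemma sequence_space_ring_law: "sequence_space (ring_law p)"
proof -
  interpret prob_space "ring_law p" by (rule prob_space_ring_law)
  show ?thesis by unfold_locales
qed

lemma prob_space_clock_law: "prob_space (clock_law p)"
  unfolding clock_law_def by (intro prob_space_PiM prob_space_ring_law)

lemma space_clock_law [simp]: "space (clock_law p) = UNIV"
  by (auto simp: clock_law_def space_PiM)

lemma emeasure_clock_law_Collect:
  assumes "finite J" "\<And>n. n \<in> J \<Longrightarrow> A n \<in> sets (ring_law p)"
  shows "emeasure (clock_law p) {\<omega>. \<forall>n\<in>J. \<omega> n \<in> A n} = (\<Prod>n\<in>J. emeasure (ring_law p) (A n))"
proof -
  interpret sequence_space "ring_law p" by (rule sequence_space_ring_law)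
  show ?thesis
    using emeasure_PiM_Collect[of J A] assms by (simp add: clock_law_def[symmetric])
qed

text \<open>Separates the first ring from the rest of the clock, matching the recursion of
  \<open>splice_clock\<close>.\<close>

lemma nn_integral_clock_law_iter:
  assumes [measurable]: "g \<in> borel_measurable (clock_law p)"
  shows "(\<integral>\<^sup>+\<omega>. g \<omega> \<partial>clock_law p) = (\<integral>\<^sup>+a. \<integral>\<^sup>+\<omega>. g (case_nat a \<omega>) \<partial>clock_law p \<partial>ring_law p)"
proof -
  interpret sequence_space "ring_law p" by (rule sequence_space_ring_law)
  interpret c: prob_space "clock_law p" by (rule prob_space_clock_law)
  have it: "distr (ring_law p \<Otimes>\<^sub>M clock_law p) (clock_law p) (\<lambda>(s, \<omega>). case_nat s \<omega>) = clock_law p"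
    unfolding clock_law_def by (rule PiM_iter)
  have [measurable]: "(\<lambda>(s, \<omega>). case_nat s \<omega>) \<in> ring_law p \<Otimes>\<^sub>M clock_law p \<rightarrow>\<^sub>M clock_law p"
    unfolding clock_law_def by measurable
  have "(\<integral>\<^sup>+\<omega>. g \<omega> \<partial>clock_law p) = (\<integral>\<^sup>+x. g (case_nat (fst x) (snd x)) \<partial>(ring_law p \<Otimes>\<^sub>M clock_law p))"
    by (subst it[symmetric], subst nn_integral_distr) (auto simp: split_def)
  also have "\<dots> = (\<integral>\<^sup>+a. \<integral>\<^sup>+\<omega>. g (case_nat a \<omega>) \<partial>clock_law p \<partial>ring_law p)"
  proof -
    have "(\<lambda>x. g (case_nat (fst x) (snd x))) \<in> borel_measurable (ring_law p \<Otimes>\<^sub>M clock_law p)"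
      using measurable_compose[OF \<open>(\<lambda>(s, \<omega>). case_nat s \<omega>) \<in> _\<close> assms] by (simp add: split_def)
    from c.nn_integral_fst[OF this] show ?thesis by simp
  qed
  finally show ?thesis .
qed

lemma prod_indicator_eq:
  "finite J \<Longrightarrow> (\<Prod>n\<in>J. indicator (A n) (f n) :: ennreal) = indicator {f. \<forall>n\<in>J. f n \<in> A n} f"
  by (induction J rule: finite_induct) (auto simp: indicator_def)

text \<open>Distinguish by the first ring of the first clock. If it comes by time s it is kept, and
  the induction hypothesis applies with the remaining time. If not, everything comes from the second
  clock, whose first ring, delayed by s, has by memorylessness the law of a first ring conditioned
  to exceed s.\<close>

lemma splice_clock_cylinder:
  assumes "0 \<le> s" and "\<And>n. A n \<in> sets (ring_law p)"
  shows "(\<integral>\<^sup>+\<omega>. \<integral>\<^sup>+\<omega>'. (\<Prod>n<k. indicator (A n) (splice_clock s \<omega> \<omega>' n)) \<partial>clock_law p \<partial>clock_law p) =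
         (\<Prod>n<k. emeasure (ring_law p) (A n))"
  using assms
proof (induction k arbitrary: s A)
  case 0
  interpret prob_space "clock_law p" by (rule prob_space_clock_law)
  show ?case using emeasure_space_1 by simp
next
  case (Suc k)
  interpret c: prob_space "clock_law p" by (rule prob_space_clock_law)
  note [measurable] = Suc.prems(2)
  let ?K = "ring_law p" and ?W = "clock_law p"
  define C where "C = (\<Prod>n<k. emeasure ?K (A (Suc n)))"
  \<comment> \<open>The first rings of the second clock that lie in \<open>A 0\<close> once delayed
    by s.\<close>
  define B where "B = {a. (s + fst a, snd a) \<in> A 0}"
  have Bs [measurable]: "B \<in> sets ?K"
  proof -
    have [measurable]: "A 0 \<in> sets (borel \<Otimes>\<^sub>M count_space UNIV)"
      using Suc.prems(2)[of 0] by (simp add: sets_ring_law)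
    have "{a \<in> space (borel \<Otimes>\<^sub>M count_space UNIV). (s + fst a, snd a) \<in> A 0} \<in> sets (borel \<Otimes>\<^sub>M count_space UNIV)"
      by measurable
    then show ?thesis by (simp add: B_def sets_ring_law space_pair_measure)
  qed
  have meas: "(\<lambda>\<omega>. \<integral>\<^sup>+\<omega>'. (\<Prod>n<Suc k. indicator (A n) (splice_clock s \<omega> \<omega>' n)) \<partial>?W) \<in> borel_measurable ?W"
    by measurable
  have "(\<integral>\<^sup>+\<omega>. \<integral>\<^sup>+\<omega>'. (\<Prod>n<Suc k. indicator (A n) (splice_clock s \<omega> \<omega>' n)) \<partial>?W \<partial>?W) =
    (\<integral>\<^sup>+a. \<integral>\<^sup>+\<omega>. \<integral>\<^sup>+\<omega>'. (\<Prod>n<Suc k. indicator (A n) (splice_clock s (case_nat a \<omega>) \<omega>' n)) \<partial>?W \<partial>?W \<partial>?K)"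
    by (rule nn_integral_clock_law_iter[OF meas])
  also have "\<dots> = (\<integral>\<^sup>+a. C * (indicator {a \<in> A 0. fst a \<le> s} a + indicator {a. s < fst a} a * emeasure ?K B) \<partial>?K)"
  proof (rule nn_integral_cong)
    fix a :: "real \<times> 'a"
    show "(\<integral>\<^sup>+\<omega>. \<integral>\<^sup>+\<omega>'. (\<Prod>n<Suc k. indicator (A n) (splice_clock s (case_nat a \<omega>) \<omega>' n)) \<partial>?W \<partial>?W) =
       C * (indicator {a \<in> A 0. fst a \<le> s} a + indicator {a. s < fst a} a * emeasure ?K B)"
    proof (cases "fst a \<le> s")
      case True
      have "(\<integral>\<^sup>+\<omega>. \<integral>\<^sup>+\<omega>'. (\<Prod>n<Suc k. indicator (A n) (splice_clock s (case_nat a \<omega>) \<omega>' n)) \<partial>?W \<partial>?W) =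
        (\<integral>\<^sup>+\<omega>. \<integral>\<^sup>+\<omega>'. indicator (A 0) a * (\<Prod>n<k. indicator (A (Suc n)) (splice_clock (s - fst a) \<omega> \<omega>' n)) \<partial>?W \<partial>?W)"
        using True by (simp add: prod.lessThan_Suc_shift del: prod.lessThan_Suc)
      also have "\<dots> = indicator (A 0) a * C"
        using True unfolding C_def
        by (subst Suc.IH[symmetric, of "s - fst a"]) (auto simp: nn_integral_cmult)
      finally show ?thesis using True by (auto simp: mult.commute indicator_def)
    next
      case False
      have eq: "(\<Prod>n<Suc k. indicator (A n) (splice_clock s (case_nat a \<omega>) \<omega>' n)) =
        (indicator {\<omega>'. \<forall>n\<in>{..k}. \<omega>' n \<in> (if n = 0 then B else A n)} \<omega>' :: ennreal)" for \<omega> \<omega>'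
      proof -
        have "(\<Prod>n<Suc k. indicator (A n) (splice_clock s (case_nat a \<omega>) \<omega>' n)) =
           (indicator B (\<omega>' 0) * (\<Prod>n<k. indicator (A (Suc n)) (\<omega>' (Suc n))) :: ennreal)"
          using False by (simp add: prod.lessThan_Suc_shift B_def indicator_def del: prod.lessThan_Suc)
        also have "\<dots> = (\<Prod>n<Suc k. indicator (if n = 0 then B else A n) (\<omega>' n))"
          by (simp add: prod.lessThan_Suc_shift del: prod.lessThan_Suc)
        also have "\<dots> = indicator {\<omega>'. \<forall>n\<in>{..k}. \<omega>' n \<in> (if n = 0 then B else A n)} \<omega>'"
          by (simp add: prod_indicator_eq lessThan_Suc_atMost)
        finally show ?thesis .
      qed
      have "(\<integral>\<^sup>+\<omega>. \<integral>\<^sup>+\<omega>'. (\<Prod>n<Suc k. indicator (A n) (splice_clock s (case_nat a \<omega>) \<omega>' n)) \<partial>?W \<partial>?W) =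
         (\<integral>\<^sup>+\<omega>. emeasure ?W {\<omega>'. \<forall>n\<in>{..k}. \<omega>' n \<in> (if n = 0 then B else A n)} \<partial>?W)"
      proof -
        have "{\<omega>'. \<forall>n\<in>{..k}. \<omega>' n \<in> (if n = 0 then B else A n)} \<in> sets ?W"
        proof -
          have "{\<omega>' \<in> space ?W. \<forall>n\<in>{..k}. \<omega>' n \<in> (if n = 0 then B else A n)} \<in> sets ?W"
            unfolding clock_law_def by (intro sets.sets_Collect_finite_All sets_Collect_single') auto
          then show ?thesis by simp
        qed
        then show ?thesis unfolding eq by simp
      qed
      also have "\<dots> = (\<Prod>n\<in>{..k}. emeasure ?K (if n = 0 then B else A n))"
        using c.emeasure_space_1 by (subst emeasure_clock_law_Collect) auto
      also have "\<dots> = emeasure ?K B * C"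
        unfolding C_def by (subst prod.atMost_shift) simp
      finally show ?thesis using False by (simp add: mult.commute)
    qed
  qed
  also have "\<dots> = C * (emeasure ?K {a \<in> A 0. fst a \<le> s} + emeasure ?K {a. s < fst a} * emeasure ?K B)"
  proof -
    have [measurable]: "A 0 \<in> sets (borel \<Otimes>\<^sub>M count_space UNIV)"
      using Suc.prems(2)[of 0] by (simp add: sets_ring_law)
    have "{a \<in> space (borel \<Otimes>\<^sub>M count_space UNIV). a \<in> A 0 \<and> fst a \<le> s} \<in> sets (borel \<Otimes>\<^sub>M count_space UNIV)"
      "{a \<in> space (borel \<Otimes>\<^sub>M count_space (UNIV :: 'a set)). s < fst a} \<in> sets (borel \<Otimes>\<^sub>M count_space UNIV)"
      by measurable
    then have [measurable]: "{a \<in> A 0. fst a \<le> s} \<in> sets ?K" "{a. s < fst a} \<in> sets ?K"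
      by (simp_all add: sets_ring_law space_pair_measure)
    show ?thesis by (simp add: nn_integral_cmult nn_integral_add nn_integral_multc)
  qed
  \<comment> \<open>Memorylessness turns the delayed ring into a ring of the first clock after s, so
    the two cases add up to \<open>A 0\<close>.\<close>
  also have "emeasure ?K {a. s < fst a} * emeasure ?K B = emeasure ?K {a \<in> A 0. s < fst a}"
    unfolding B_def by (rule ring_law_shift) (use Suc.prems in auto)
  also have "emeasure ?K {a \<in> A 0. fst a \<le> s} + emeasure ?K {a \<in> A 0. s < fst a} = emeasure ?K (A 0)"
  proof -
    have [measurable]: "A 0 \<in> sets (borel \<Otimes>\<^sub>M count_space UNIV)"
      using Suc.prems(2)[of 0] by (simp add: sets_ring_law)
    have "{a \<in> space (borel \<Otimes>\<^sub>M count_space UNIV). a \<in> A 0 \<and> fst a \<le> s} \<in> sets (borel \<Otimes>\<^sub>M count_space UNIV)"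
      "{a \<in> space (borel \<Otimes>\<^sub>M count_space (UNIV :: 'a set)). a \<in> A 0 \<and> s < fst a} \<in> sets (borel \<Otimes>\<^sub>M count_space UNIV)"
      by measurable
    then have "{a \<in> A 0. fst a \<le> s} \<in> sets ?K" "{a \<in> A 0. s < fst a} \<in> sets ?K"
      by (simp_all add: sets_ring_law space_pair_measure)
    moreover have "{a \<in> A 0. fst a \<le> s} \<union> {a \<in> A 0. s < fst a} = A 0" by auto
    ultimately show ?thesis by (subst plus_emeasure) auto
  qed
  finally show ?case
    unfolding C_def by (simp add: prod.lessThan_Suc_shift mult.commute del: prod.lessThan_Suc)
qed

section \<open>Rings of a spliced clock as times with targets\<close>

definition ring_time :: "(nat \<Rightarrow> real \<times> 'v) \<Rightarrow> nat \<Rightarrow> real" where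
  "ring_time \<omega> n = (\<Sum>k\<le>n. fst (\<omega> k))"

definition rings :: "(nat \<Rightarrow> real \<times> 'v) \<Rightarrow> (real \<times> 'v) set" where
  "rings \<omega> = range (\<lambda>n. (ring_time \<omega> n, snd (\<omega> n)))"

lemma ring_time_Suc: "ring_time \<omega> (Suc n) = fst (\<omega> 0) + ring_time (\<lambda>k. \<omega> (Suc k)) n"
  unfolding ring_time_def by (subst sum.atMost_Suc_shift) simp

lemma strict_mono_ring_time: "(\<And>n. 0 < fst (\<omega> n)) \<Longrightarrow> strict_mono (ring_time \<omega>)"
  by (intro strict_monoI_Suc) (simp add: ring_time_def)

lemma ring_time_pos: "(\<And>n. 0 < fst (\<omega> n)) \<Longrightarrow> 0 < ring_time \<omega> n"
  unfolding ring_time_def by (intro sum_pos) auto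

text \<open>N is the number of rings of the first clock up to time s. From index N on only ring
  times and targets match the delayed second clock: the waiting time at index N is counted from the
  preceding ring, not from s.\<close>

lemma splice_clock_index:
  assumes "\<And>n. n < N \<Longrightarrow> ring_time \<omega> n \<le> s" "s < ring_time \<omega> N"
  shows "(\<forall>n<N. ring_time (splice_clock s \<omega> \<omega>') n = ring_time \<omega> n \<and> splice_clock s \<omega> \<omega>' n = \<omega> n) \<and>
    (\<forall>k. ring_time (splice_clock s \<omega> \<omega>') (N + k) = s + ring_time \<omega>' k \<and>
         snd (splice_clock s \<omega> \<omega>' (N + k)) = snd (\<omega>' k))"
  using assms
proof (induction N arbitrary: s \<omega>)
  case 0
  have 1: "s < fst (\<omega> 0)" using 0 by (simp add: ring_time_def)
  have "ring_time (splice_clock s \<omega> \<omega>') k = s + ring_time \<omega>' k" for k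
    using 1 by (cases k) (simp_all add: ring_time_def sum.atMost_Suc_shift del: sum.atMost_Suc)
  moreover have "snd (splice_clock s \<omega> \<omega>' k) = snd (\<omega>' k)" for k
    using 1 by (cases k) simp_all
  ultimately show ?case by simp
next
  case (Suc N)
  let ?\<omega> = "\<lambda>k. \<omega> (Suc k)" and ?s = "s - fst (\<omega> 0)"
  have 1: "fst (\<omega> 0) \<le> s" using Suc.prems(1)[of 0] by (simp add: ring_time_def)
  have sh: "splice_clock s \<omega> \<omega>' (Suc n) = splice_clock ?s ?\<omega> \<omega>' n" "splice_clock s \<omega> \<omega>' 0 = \<omega> 0" for n
    using 1 by auto
  have rt: "ring_time (splice_clock s \<omega> \<omega>') (Suc n) = fst (\<omega> 0) + ring_time (splice_clock ?s ?\<omega> \<omega>') n" for n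
    unfolding ring_time_Suc using 1 by simp
  have IH: "(\<forall>n<N. ring_time (splice_clock ?s ?\<omega> \<omega>') n = ring_time ?\<omega> n \<and> splice_clock ?s ?\<omega> \<omega>' n = ?\<omega> n) \<and>
    (\<forall>k. ring_time (splice_clock ?s ?\<omega> \<omega>') (N + k) = ?s + ring_time \<omega>' k \<and>
         snd (splice_clock ?s ?\<omega> \<omega>' (N + k)) = snd (\<omega>' k))"
  proof (rule Suc.IH)
    fix n assume "n < N"
    then show "ring_time ?\<omega> n \<le> ?s" using Suc.prems(1)[of "Suc n"] by (simp add: ring_time_Suc)
  next
    show "?s < ring_time ?\<omega> N" using Suc.prems(2) by (simp add: ring_time_Suc)
  qed
  show ?case
  proof (intro conjI allI impI)
    fix n assume n: "n < Suc N"
    show "ring_time (splice_clock s \<omega> \<omega>') n = ring_time \<omega> n"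
    proof (cases n)
      case 0
      then show ?thesis using 1 by (simp add: ring_time_def)
    next
      case (Suc m)
      then show ?thesis using IH n by (simp add: rt ring_time_Suc[of \<omega>] del: splice_clock.simps)
    qed
    show "splice_clock s \<omega> \<omega>' n = \<omega> n"
    proof (cases n)
      case 0
      then show ?thesis using 1 by simp
    next
      case (Suc m)
      then show ?thesis using IH n by (simp add: sh del: splice_clock.simps)
    qed
  next
    fix k
    show "ring_time (splice_clock s \<omega> \<omega>') (Suc N + k) = s + ring_time \<omega>' k"
      "snd (splice_clock s \<omega> \<omega>' (Suc N + k)) = snd (\<omega>' k)"
      using IH by (simp_all add: rt sh del: splice_clock.simps)
  qed
qed

text \<open>Forgetting the indices removes the number of rings up to s, which varies from clock to
  clock, so that all clocks can be spliced at one common time.\<close>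

lemma rings_splice_clock:
  assumes pos: "\<And>n. 0 < fst (\<omega> n)" "\<And>n. 0 < fst (\<omega>' n)" and N: "s < ring_time \<omega> N'"
  shows "rings (splice_clock s \<omega> \<omega>') = {r \<in> rings \<omega>. fst r \<le> s} \<union> (\<lambda>r. (s + fst r, snd r)) ` rings \<omega>'"
proof -
  define N where "N = (LEAST n. s < ring_time \<omega> n)"
  have N1: "s < ring_time \<omega> N" unfolding N_def using N by (rule LeastI)
  have N2: "ring_time \<omega> n \<le> s" if "n < N" for n
    using that not_less_Least[of n] unfolding N_def by force
  have N3: "n < N" if "ring_time \<omega> n \<le> s" for n
  proof (rule ccontr)
    assume "\<not> n < N"
    then have "ring_time \<omega> N \<le> ring_time \<omega> n"
      using strict_mono_ring_time[OF pos(1)] by (simp add: strict_mono_less_eq)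
    then show False using N1 that by simp
  qed
  note ix = splice_clock_index[OF N2 N1, of \<omega>']
  have "rings (splice_clock s \<omega> \<omega>') =
     (\<lambda>n. (ring_time (splice_clock s \<omega> \<omega>') n, snd (splice_clock s \<omega> \<omega>' n))) ` ({..<N} \<union> range ((+) N))"
  proof -
    have "{..<N} \<union> range ((+) N) = UNIV"
      by (auto simp: image_iff) (metis le_add_diff_inverse not_less)
    then show ?thesis by (simp add: rings_def)
  qed
  also have "\<dots> = (\<lambda>n. (ring_time \<omega> n, snd (\<omega> n))) ` {..<N} \<union> (\<lambda>r. (s + fst r, snd r)) ` rings \<omega>'"
    unfolding image_Un using ix by (simp add: rings_def image_image cong: image_cong_simp)
  also have "(\<lambda>n. (ring_time \<omega> n, snd (\<omega> n))) ` {..<N} = {r \<in> rings \<omega>. fst r \<le> s}"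
    using N2 N3 by (auto simp: rings_def)
  finally show ?thesis .
qed


section \<open>The field of all clocks\<close>

text \<open>Currying: splicing acts on whole clocks, whereas the driving law is a product over pairs
  of a site and an index. A finite cylinder factors site by site in both descriptions.\<close>

lemma clock_field_eq:
  fixes K :: "'v \<Rightarrow> 'b measure"
  assumes K: "\<And>v. prob_space (K v)"
  shows "distr (\<Pi>\<^sub>M v\<in>UNIV. \<Pi>\<^sub>M n\<in>(UNIV :: nat set). K v) (\<Pi>\<^sub>M i\<in>UNIV. K (fst i)) (\<lambda>f i. f (fst i) (snd i)) =
         (\<Pi>\<^sub>M i\<in>UNIV. K (fst i))"
    (is "distr ?P ?Q ?u = ?Q")
proof -
  let ?W = "\<lambda>v. \<Pi>\<^sub>M n\<in>(UNIV :: nat set). K v"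
  interpret K: prob_space "K v" for v by (rule K)
  interpret W: product_prob_space "\<lambda>n :: nat. K v" UNIV for v by unfold_locales
  interpret P: product_prob_space ?W UNIV
    by unfold_locales
  interpret Q: product_prob_space "\<lambda>i :: 'v \<times> nat. K (fst i)" UNIV by unfold_locales
  have u [measurable]: "?u \<in> ?P \<rightarrow>\<^sub>M ?Q"
  proof (rule measurable_PiM_single')
    fix i :: "'v \<times> nat"
    have "(\<lambda>f. f (fst i)) \<in> ?P \<rightarrow>\<^sub>M ?W (fst i)" by measurable
    moreover have "(\<lambda>\<omega>. \<omega> (snd i)) \<in> ?W (fst i) \<rightarrow>\<^sub>M K (fst i)" by measurable
    ultimately show "(\<lambda>f. f (fst i) (snd i)) \<in> ?P \<rightarrow>\<^sub>M K (fst i)"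
      by (rule measurable_compose)
  qed (auto simp: space_PiM PiE_iff)
  show ?thesis
  proof (rule Q.PiM_eq)
    fix J :: "('v \<times> nat) set" and F
    assume J: "finite J" "\<And>j. j \<in> J \<Longrightarrow> F j \<in> sets (K (fst j))"
    define N where "N v = {n. (v, n) \<in> J}" for v
    have N: "finite (N v)" for v
      unfolding N_def using finite_vimageI[OF J(1), of "Pair v"] by (simp add: vimage_def inj_on_def)
    have JN: "J = (SIGMA v:fst ` J. N v)" by (force simp: N_def)
    define X where "X v = {\<omega> \<in> space (?W v). \<forall>n\<in>N v. \<omega> n \<in> F (v, n)}" for v
    have Xs: "X v \<in> sets (?W v)" for v
      unfolding X_def using N J by (intro sets.sets_Collect_finite_All sets_Collect_single') (auto simp: N_def)
    have X: "emeasure (?W v) (X v) = (\<Prod>n\<in>N v. emeasure (K v) (F (v, n)))" for v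
      unfolding X_def by (rule W.emeasure_PiM_Collect) (use N J in \<open>auto simp: N_def\<close>)
    have "?u -` prod_emb UNIV (\<lambda>i. K (fst i)) J (Pi\<^sub>E J F) \<inter> space ?P =
        {f \<in> space ?P. \<forall>v\<in>fst ` J. f v \<in> X v}"
      by (force simp: prod_emb_def space_PiM PiE_iff X_def N_def)
    then have "emeasure (distr ?P ?Q ?u) (prod_emb UNIV (\<lambda>i. K (fst i)) J (Pi\<^sub>E J F)) =
        emeasure ?P {f \<in> space ?P. \<forall>v\<in>fst ` J. f v \<in> X v}"
      using J by (subst emeasure_distr) (auto intro!: sets_PiM_I)
    also have "\<dots> = (\<Prod>v\<in>fst ` J. emeasure (?W v) (X v))"
      by (rule P.emeasure_PiM_Collect) (use J Xs in auto)
    also have "\<dots> = (\<Prod>v\<in>fst ` J. \<Prod>n\<in>N v. emeasure (K v) (F (v, n)))"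
      by (simp add: X)
    also have "\<dots> = (\<Prod>(v, n)\<in>(SIGMA v:fst ` J. N v). emeasure (K v) (F (v, n)))"
      using J N by (subst prod.Sigma) auto
    also have "\<dots> = (\<Prod>j\<in>J. emeasure (K (fst j)) (F j))"
      by (subst JN[symmetric]) (auto intro!: prod.cong)
    finally show "emeasure (distr ?P ?Q ?u) (prod_emb UNIV (\<lambda>i. K (fst i)) J (Pi\<^sub>E J F)) =
      (\<Prod>j\<in>J. emeasure (K (fst j)) (F j))" .
  qed simp
qed

definition marks_law :: "('v \<Rightarrow> 'v \<Rightarrow> bool) \<Rightarrow> 'v marks measure" where
  "marks_law adj = (\<Pi>\<^sub>M i\<in>UNIV. mark_law adj (fst i))"

abbreviation clock_at :: "'v marks \<Rightarrow> 'v \<Rightarrow> nat \<Rightarrow> real \<times> 'v" where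
  "clock_at m v \<equiv> \<lambda>n. m (v, n)"

abbreviation site_law :: "('v \<Rightarrow> 'v \<Rightarrow> bool) \<Rightarrow> 'v \<Rightarrow> (nat \<Rightarrow> real \<times> 'v) measure" where
  "site_law adj v \<equiv> clock_law (srw_step adj v)"

lemma prob_space_marks_law: "prob_space (marks_law adj)"
  unfolding marks_law_def mark_law_eq by (intro prob_space_PiM prob_space_ring_law)

lemma space_marks_law [simp]: "space (marks_law adj) = UNIV"
  by (auto simp: marks_law_def mark_law_eq space_PiM)

lemma product_prob_space_marks: "product_prob_space (\<lambda>i :: 'v \<times> nat. mark_law adj (fst i))"
proof -
  interpret prob_space "mark_law adj v" for v unfolding mark_law_eq by (rule prob_space_ring_law)
  show ?thesis by unfold_locales
qed

lemma measurable_clock_at [measurable]: "(\<lambda>m. clock_at m v) \<in> marks_law adj \<rightarrow>\<^sub>M site_law adj v"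
  unfolding marks_law_def clock_law_def mark_law_eq
  by (rule measurable_PiM_single') (auto simp: space_PiM intro: measurable_component_singleton[of "(v, _)" UNIV "\<lambda>i. ring_law (srw_step adj (fst i))", simplified])

lemma emeasure_marks_law_Collect:
  assumes "finite J" "\<And>i. i \<in> J \<Longrightarrow> A i \<in> sets (mark_law adj (fst i))"
  shows "emeasure (marks_law adj) {m. \<forall>i\<in>J. m i \<in> A i} = (\<Prod>i\<in>J. emeasure (mark_law adj (fst i)) (A i))"
proof -
  interpret product_prob_space "\<lambda>i :: _ \<times> nat. mark_law adj (fst i)" UNIV by (rule product_prob_space_marks)
  show ?thesis
    using emeasure_PiM_Collect[of J A] assms by (simp add: marks_law_def[symmetric])
qed

text \<open>Independence of the clocks at different sites, obtained from the curried product
  restricted to the sites of F.\<close>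

lemma nn_integral_marks_law_prod:
  assumes F: "finite F" and g: "\<And>v. g v \<in> borel_measurable (site_law adj v)"
  shows "(\<integral>\<^sup>+m. (\<Prod>v\<in>F. g v (clock_at m v)) \<partial>marks_law adj) = (\<Prod>v\<in>F. \<integral>\<^sup>+\<omega>. g v \<omega> \<partial>site_law adj v)"
proof -
  let ?P = "\<Pi>\<^sub>M v\<in>UNIV. site_law adj v"
  interpret W: prob_space "site_law adj v" for v by (rule prob_space_clock_law)
  interpret P: product_prob_space "site_law adj" UNIV by unfold_locales
  note g [measurable]
  have eq: "marks_law adj = distr ?P (marks_law adj) (\<lambda>f i. f (fst i) (snd i))"
    unfolding marks_law_def mark_law_eq clock_law_def
    by (rule clock_field_eq[symmetric]) (rule prob_space_ring_law)
  have u: "(\<lambda>f i. f (fst i) (snd i)) \<in> ?P \<rightarrow>\<^sub>M marks_law adj"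
    unfolding marks_law_def mark_law_eq
  proof (rule measurable_PiM_single')
    fix i :: "'a \<times> nat"
    show "(\<lambda>f. f (fst i) (snd i)) \<in> ?P \<rightarrow>\<^sub>M ring_law (srw_step adj (fst i))"
      by (rule measurable_clock_component) measurable
  qed (auto simp: space_PiM)
  have m: "(\<lambda>m. \<Prod>v\<in>F. g v (clock_at m v)) \<in> borel_measurable (marks_law adj)"
    by (intro borel_measurable_prod_ennreal measurable_compose[OF measurable_clock_at g])
  have "(\<integral>\<^sup>+m. (\<Prod>v\<in>F. g v (clock_at m v)) \<partial>marks_law adj) = (\<integral>\<^sup>+f. (\<Prod>v\<in>F. g v (f v)) \<partial>?P)"
    by (subst eq) (simp add: nn_integral_distr[OF u] m)
  also have "\<dots> = (\<integral>\<^sup>+f. (\<Prod>v\<in>F. g v (f v)) \<partial>distr ?P (\<Pi>\<^sub>M v\<in>F. site_law adj v) (\<lambda>x. restrict x F))"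
    by (subst nn_integral_distr) (auto intro!: measurable_restrict_subset borel_measurable_prod_ennreal)
  also have "\<dots> = (\<integral>\<^sup>+f. (\<Prod>v\<in>F. g v (f v)) \<partial>(\<Pi>\<^sub>M v\<in>F. site_law adj v))"
    by (subst P.distr_PiM_restrict_finite) (use F in auto)
  also have "\<dots> = (\<Prod>v\<in>F. \<integral>\<^sup>+\<omega>. g v \<omega> \<partial>site_law adj v)"
    by (rule P.product_nn_integral_prod) (use F in auto)
  finally show ?thesis .
qed

lemma distr_snd:
  assumes "prob_space K" "prob_space Q"
  shows "distr (K \<Otimes>\<^sub>M Q) Q snd = Q"
proof (rule measure_eqI)
  interpret K: prob_space K by fact
  interpret Q: prob_space Q by fact
  fix A assume A: "A \<in> sets (distr (K \<Otimes>\<^sub>M Q) Q snd)"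
  have "snd -` A \<inter> space (K \<Otimes>\<^sub>M Q) = space K \<times> A"
    using A sets.sets_into_space[of A Q] by (auto simp: space_pair_measure)
  then show "emeasure (distr (K \<Otimes>\<^sub>M Q) Q snd) A = emeasure Q A"
    using A Q.emeasure_pair_measure_Times[of "space K" K A] K.emeasure_space_1
    by (simp add: emeasure_distr)
qed simp

section \<open>The Markov property of the marks\<close>

definition splice_marks :: "real \<Rightarrow> 'v marks \<Rightarrow> 'v marks \<Rightarrow> 'v marks" where
  "splice_marks s m m' = (\<lambda>i. splice_clock s (clock_at m (fst i)) (clock_at m' (fst i)) (snd i))"

lemma measurable_splice [measurable]:
  "(\<lambda>x. splice_marks s (fst x) (snd x)) \<in> marks_law adj \<Otimes>\<^sub>M marks_law adj \<rightarrow>\<^sub>M marks_law adj"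
proof -
  have "(\<lambda>x. splice_clock s (clock_at (fst x) v) (clock_at (snd x) v) n)
      \<in> marks_law adj \<Otimes>\<^sub>M marks_law adj \<rightarrow>\<^sub>M mark_law adj v" for v n
    unfolding mark_law_eq
    by (intro measurable_splice_clock measurable_compose[OF measurable_fst measurable_clock_at]
        measurable_compose[OF measurable_snd measurable_clock_at]) simp
  then show ?thesis
    unfolding splice_marks_def by (subst (3) marks_law_def) (rule measurable_PiM_single', auto simp: space_PiM mark_law_eq)
qed

text \<open>The Markov property at time s: fresh independent marks after s leave the law unchanged.
  Finite cylinders determine a product measure, their indicators factor over sites, and each factor
  is an instance of \<open>splice_clock_cylinder\<close>.\<close>

theorem distr_splice:
  fixes adj :: "'v \<Rightarrow> 'v \<Rightarrow> bool"
  assumes s: "0 \<le> s"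
  shows "distr (marks_law adj \<Otimes>\<^sub>M marks_law adj) (marks_law adj) (\<lambda>x. splice_marks s (fst x) (snd x)) = marks_law adj"
    (is "?D = ?Q")
proof -
  interpret product_prob_space "\<lambda>i :: _ \<times> nat. mark_law adj (fst i)" UNIV by (rule product_prob_space_marks)
  interpret Q: prob_space "marks_law adj" by (rule prob_space_marks_law)
  have "?D = (\<Pi>\<^sub>M i\<in>UNIV. mark_law adj (fst i))"
  proof (rule PiM_eq)
    show "sets ?D = sets (\<Pi>\<^sub>M i\<in>UNIV. mark_law adj (fst i))" by (simp add: marks_law_def)
    fix J :: "('v \<times> nat) set" and F
    assume J: "finite J" "\<And>j. j \<in> J \<Longrightarrow> F j \<in> sets (mark_law adj (fst j))"
    obtain k where k: "\<And>v n. (v, n) \<in> J \<Longrightarrow> n < k"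
      using finite_nat_set_iff_bounded[of "snd ` J"] J(1) by force
    \<comment> \<open>Indices outside J get the full set. This pads J to a rectangle of sites and
      first k rings, the shape that \<open>splice_clock_cylinder\<close> handles.\<close>
    define A where "A v n = (if (v, n) \<in> J then F (v, n) else UNIV)" for v n
    have As: "A v n \<in> sets (mark_law adj v)" for v n
      using J(2)[of "(v, n)"] sets.top[of "mark_law adj v"] by (auto simp: A_def mark_law_eq)
    define G :: "_ \<Rightarrow> _ \<Rightarrow> _ \<Rightarrow> ennreal"
      where "G v \<omega> \<omega>' = (\<Prod>n<k. indicator (A v n) (splice_clock s \<omega> \<omega>' n))" for v \<omega> \<omega>'
    let ?E = "{m. \<forall>i\<in>J. m i \<in> F i}"
    have Es: "?E \<in> sets ?Q"
    proof -
      have "{m \<in> space (\<Pi>\<^sub>M i\<in>UNIV. mark_law adj (fst i)). \<forall>i\<in>J. m i \<in> F i} \<in> sets (\<Pi>\<^sub>M i\<in>UNIV. mark_law adj (fst i))"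
        using J by (intro sets.sets_Collect_finite_All sets_Collect_single') auto
      then show ?thesis by (simp add: marks_law_def[symmetric])
    qed
    have ind: "indicator ?E (splice_marks s m m') = (\<Prod>v\<in>fst ` J. G v (clock_at m v) (clock_at m' v))" for m m'
    proof -
      have "(\<Prod>v\<in>fst ` J. G v (clock_at m v) (clock_at m' v)) =
         (\<Prod>v\<in>fst ` J. \<Prod>n<k. indicator (A v n) (splice_marks s m m' (v, n)))"
        by (simp add: G_def splice_marks_def)
      also have "\<dots> = (\<Prod>i\<in>fst ` J \<times> {..<k}. indicator (A (fst i) (snd i)) (splice_marks s m m' i))"
        using J(1) by (subst prod.Sigma) (auto simp: split_def)
      also have "\<dots> = indicator {m. \<forall>i\<in>fst ` J \<times> {..<k}. m i \<in> A (fst i) (snd i)} (splice_marks s m m')"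
        using J(1) by (intro prod_indicator_eq) auto
      also have "{m. \<forall>i\<in>fst ` J \<times> {..<k}. m i \<in> A (fst i) (snd i)} = ?E"
        using k by (fastforce simp: A_def split: if_splits)
      finally show ?thesis by simp
    qed
    have Gm2: "G v \<omega> \<in> borel_measurable (site_law adj v)" if "\<omega> \<in> space (site_law adj v)" for v \<omega>
    proof -
      have [measurable]: "(\<lambda>\<omega>'. splice_clock s \<omega> \<omega>' n) \<in> site_law adj v \<rightarrow>\<^sub>M mark_law adj v" for n
        unfolding mark_law_eq using that by (intro measurable_splice_clock) auto
      note As [measurable]
      show ?thesis unfolding G_def[abs_def]
        by (intro borel_measurable_prod_ennreal) measurable
    qed
    have Gm1: "(\<lambda>\<omega>. \<integral>\<^sup>+\<omega>'. G v \<omega> \<omega>' \<partial>site_law adj v) \<in> borel_measurable (site_law adj v)" for v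
    proof -
      interpret W: prob_space "site_law adj v" by (rule prob_space_clock_law)
      have [measurable]: "(\<lambda>x. splice_clock s (fst x) (snd x) n) \<in> site_law adj v \<Otimes>\<^sub>M site_law adj v \<rightarrow>\<^sub>M mark_law adj v" for n
        unfolding mark_law_eq by (intro measurable_splice_clock) auto
      note As [measurable]
      show ?thesis unfolding G_def by (rule W.borel_measurable_nn_integral) (simp add: split_def)
    qed
    have "emeasure ?D (prod_emb UNIV (\<lambda>i. mark_law adj (fst i)) J (Pi\<^sub>E J F)) = emeasure ?D ?E"
      by (auto intro!: arg_cong[where f = "emeasure _"] simp: prod_emb_def PiE_iff mark_law_eq)
    also have "\<dots> = (\<integral>\<^sup>+x. indicator ?E (splice_marks s (fst x) (snd x)) \<partial>(?Q \<Otimes>\<^sub>M ?Q))"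
      using Es by (simp add: nn_integral_indicator[symmetric] nn_integral_distr del: nn_integral_indicator)
    also have "\<dots> = (\<integral>\<^sup>+m. \<integral>\<^sup>+m'. indicator ?E (splice_marks s m m') \<partial>?Q \<partial>?Q)"
      using Es by (subst Q.nn_integral_fst[symmetric]) auto
    also have "\<dots> = (\<integral>\<^sup>+m. (\<Prod>v\<in>fst ` J. \<integral>\<^sup>+\<omega>'. G v (clock_at m v) \<omega>' \<partial>site_law adj v) \<partial>?Q)"
      unfolding ind using J(1) Gm2 by (intro nn_integral_cong nn_integral_marks_law_prod) auto
    also have "\<dots> = (\<Prod>v\<in>fst ` J. \<integral>\<^sup>+\<omega>. \<integral>\<^sup>+\<omega>'. G v \<omega> \<omega>' \<partial>site_law adj v \<partial>site_law adj v)"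
      using J(1) Gm1 by (intro nn_integral_marks_law_prod) auto
    also have "\<dots> = (\<Prod>v\<in>fst ` J. \<Prod>n<k. emeasure (mark_law adj v) (A v n))"
      unfolding G_def mark_law_eq
      by (intro prod.cong refl splice_clock_cylinder s) (use As in \<open>simp add: mark_law_eq\<close>)
    also have "\<dots> = (\<Prod>i\<in>fst ` J \<times> {..<k}. emeasure (mark_law adj (fst i)) (A (fst i) (snd i)))"
      using J(1) by (subst prod.Sigma) (auto simp: split_def)
    also have "\<dots> = (\<Prod>i\<in>J. emeasure (mark_law adj (fst i)) (F i))"
    proof (rule prod.mono_neutral_cong_right)
      show "J \<subseteq> fst ` J \<times> {..<k}" using k by force
      show "\<forall>i\<in>fst ` J \<times> {..<k} - J. emeasure (mark_law adj (fst i)) (A (fst i) (snd i)) = 1"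
        using prob_space.emeasure_space_1[OF prob_space_ring_law] by (auto simp: A_def mark_law_eq)
    qed (use J(1) in \<open>auto simp: A_def\<close>)
    finally show "emeasure ?D (prod_emb UNIV (\<lambda>i. mark_law adj (fst i)) J (Pi\<^sub>E J F)) =
       (\<Prod>j\<in>J. emeasure (mark_law adj (fst j)) (F j))" .
  qed
  then show ?thesis by (simp only: marks_law_def[symmetric])
qed


section \<open>The jumps within a finite set\<close>

definition ring_at :: "'v marks \<Rightarrow> 'v \<times> nat \<Rightarrow> real" where
  "ring_at m i = ring_time (clock_at m (fst i)) (snd i)"

lemma jump_iff_rings: "jump m s v w \<longleftrightarrow> (s, w) \<in> rings (clock_at m v)"
  by (auto simp: jump_def rings_def ring_time_def)

text \<open>The same jumps are enumerated twice: \<open>ring_trace\<close> lists their indices, of which there are countably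
  many, for measurability; \<open>event_list\<close> lists their times, which splicing merely shifts.\<close>

definition ring_trace :: "'v set \<Rightarrow> real \<Rightarrow> 'v marks \<Rightarrow> ('v \<times> nat) list \<Rightarrow> bool" where
  "ring_trace \<Lambda> t m is \<longleftrightarrow> sorted_wrt (\<lambda>i j. ring_at m i < ring_at m j) is \<and>
     set is = {i. fst i \<in> \<Lambda> \<and> snd (m i) \<in> \<Lambda> \<and> ring_at m i \<le> t}"

text \<open>The default [] is a dummy: for \<open>regular_marks\<close> and finite \<Lambda> a trace
  exists, and strictly increasing times make it unique.\<close>

definition jumps :: "'v set \<Rightarrow> real \<Rightarrow> 'v marks \<Rightarrow> ('v \<times> 'v) list" where
  "jumps \<Lambda> t m = (if \<exists>is. ring_trace \<Lambda> t m is
     then map (\<lambda>i. (fst i, snd (m i))) (THE is. ring_trace \<Lambda> t m is) else [])"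

definition event_list :: "'v set \<Rightarrow> real \<Rightarrow> 'v marks \<Rightarrow> (real \<times> 'v \<times> 'v) list \<Rightarrow> bool" where
  "event_list \<Lambda> t m es \<longleftrightarrow> sorted_wrt (\<lambda>a b. fst a < fst b) es \<and>
     set es = {(\<tau>, v, w). jump m \<tau> v w \<and> v \<in> \<Lambda> \<and> w \<in> \<Lambda> \<and> \<tau> \<le> t}"

lemma trace_unique:
  assumes "ring_trace \<Lambda> t m is" "ring_trace \<Lambda> t m js"
  shows "is = js"
proof -
  have st: "sorted_wrt (<) (map (ring_at m) is)" "sorted_wrt (<) (map (ring_at m) js)"
    using assms by (auto simp: ring_trace_def sorted_wrt_map)
  have eq: "set is = set js" using assms by (simp add: ring_trace_def)
  have "map (ring_at m) is = map (ring_at m) js"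
    by (rule strict_sorted_equal[OF st(2) st(1)]) (simp add: eq)
  moreover have "inj_on (ring_at m) (set is \<union> set js)"
    using st(1) eq by (simp add: strict_sorted_iff distinct_map)
  ultimately show ?thesis by (rule map_inj_on)
qed

lemma jumps_trace:
  assumes "ring_trace \<Lambda> t m is"
  shows "jumps \<Lambda> t m = map (\<lambda>i. (fst i, snd (m i))) is"
proof -
  have "(THE is. ring_trace \<Lambda> t m is) = is"
    using assms by (blast intro: trace_unique)
  then show ?thesis using assms by (auto simp: jumps_def)
qed

lemma events_image:
  "{(\<tau>, v, w). jump m \<tau> v w \<and> v \<in> \<Lambda> \<and> w \<in> \<Lambda> \<and> \<tau> \<le> t} =
   (\<lambda>i. (ring_at m i, fst i, snd (m i))) ` {i. fst i \<in> \<Lambda> \<and> snd (m i) \<in> \<Lambda> \<and> ring_at m i \<le> t}"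
  by (force simp: jump_iff_rings rings_def ring_at_def image_iff)

text \<open>As no two rings coincide, an event determines the index that produced it, and a list of
  events sorted by time yields the trace.\<close>

lemma jumps_event_list:
  assumes inj: "inj (ring_at m)" and es: "event_list \<Lambda> t m es"
  shows "jumps \<Lambda> t m = map snd es"
proof -
  let ?h = "\<lambda>i. (ring_at m i, fst i, snd (m i))"
  let ?R = "{i. fst i \<in> \<Lambda> \<and> snd (m i) \<in> \<Lambda> \<and> ring_at m i \<le> t}"
  have injh: "inj ?h" using inj by (auto simp: inj_def)
  have set: "set es = ?h ` ?R" using es by (simp add: event_list_def events_image)
  define "is" where "is = map (inv_into UNIV ?h) es"
  have es_eq: "es = map ?h is"
    unfolding is_def map_map
  proof (rule map_idI[symmetric])
    fix e assume "e \<in> set es"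
    then have "e \<in> range ?h" using set by blast
    then show "(?h \<circ> inv_into UNIV ?h) e = e" unfolding o_apply by (rule f_inv_into_f)
  qed
  have "set is = ?R"
    unfolding is_def set_map set by (rule inv_into_image_cancel[OF injh]) simp
  moreover have "sorted_wrt (\<lambda>i j. ring_at m i < ring_at m j) is"
    using es unfolding event_list_def es_eq by (simp add: sorted_wrt_map)
  ultimately have "ring_trace \<Lambda> t m is" by (simp add: ring_trace_def)
  then show ?thesis by (simp add: jumps_trace es_eq o_def)
qed

text \<open>The almost sure properties on which all pathwise arguments rest. Injectivity of
  \<open>ring_at\<close> excludes simultaneous rings.\<close>

definition regular_marks :: "('v \<Rightarrow> 'v \<Rightarrow> bool) \<Rightarrow> 'v marks \<Rightarrow> bool" where
  "regular_marks adj m \<longleftrightarrow> (\<forall>i. 0 < fst (m i)) \<and> (\<forall>v t. \<exists>n. t < ring_at m (v, n)) \<and>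
     (\<forall>i. adj (fst i) (snd (m i))) \<and> inj (ring_at m)"

lemma ring_at_less_iff:
  assumes "regular_marks adj m"
  shows "ring_at m (v, n) < ring_at m (v, k) \<longleftrightarrow> n < k"
proof -
  have "strict_mono (ring_time (clock_at m v))"
    by (rule strict_mono_ring_time) (use assms in \<open>simp add: regular_marks_def\<close>)
  then show ?thesis by (simp add: ring_at_def strict_mono_less)
qed

lemma finite_ring_at:
  assumes m: "regular_marks adj m" and "finite \<Lambda>"
  shows "finite {i. fst i \<in> \<Lambda> \<and> snd (m i) \<in> \<Lambda> \<and> ring_at m i \<le> t}"
proof -
  obtain N where N: "\<And>v. t < ring_at m (v, N v)"
  proof -
    have "\<forall>v. \<exists>n. t < ring_at m (v, n)" using m by (simp add: regular_marks_def)
    from choice[OF this] show ?thesis using that by blast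
  qed
  have "{i. fst i \<in> \<Lambda> \<and> snd (m i) \<in> \<Lambda> \<and> ring_at m i \<le> t} \<subseteq> (SIGMA v:\<Lambda>. {..N v})"
  proof clarsimp
    fix v n assume "ring_at m (v, n) \<le> t"
    then have "ring_at m (v, n) < ring_at m (v, N v)" using N[of v] by simp
    then show "n \<le> N v" by (simp add: ring_at_less_iff[OF m])
  qed
  then show ?thesis by (rule finite_subset) (use assms in auto)
qed

lemma ex_trace:
  assumes m: "regular_marks adj m" and "finite \<Lambda>"
  shows "\<exists>is. ring_trace \<Lambda> t m is"
proof -
  let ?R = "{i. fst i \<in> \<Lambda> \<and> snd (m i) \<in> \<Lambda> \<and> ring_at m i \<le> t}"
  let ?f = "inv_into ?R (ring_at m)" and ?ts = "sorted_list_of_set (ring_at m ` ?R)"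
  have fin: "finite ?R" by (rule finite_ring_at[OF assms])
  have inj: "inj_on (ring_at m) ?R" using m by (auto simp: regular_marks_def inj_on_def)
  have ts: "set ?ts = ring_at m ` ?R" "sorted_wrt (<) ?ts" using fin by simp_all
  have eq: "map (ring_at m) (map ?f ?ts) = ?ts"
    unfolding map_map by (rule map_idI) (use ts in \<open>auto simp: f_inv_into_f\<close>)
  have "sorted_wrt (<) (map (ring_at m) (map ?f ?ts))"
    unfolding eq by (rule ts(2))
  then have "sorted_wrt (\<lambda>i j. ring_at m i < ring_at m j) (map ?f ?ts)"
    by (rule sorted_wrt_map[THEN iffD1])
  moreover have "set (map ?f ?ts) = ?R"
    unfolding set_map ts(1) by (rule inv_into_image_cancel[OF inj]) simp
  ultimately show ?thesis unfolding ring_trace_def by blast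
qed

lemma ex_event_list:
  assumes m: "regular_marks adj m" and "finite \<Lambda>"
  shows "\<exists>es. event_list \<Lambda> t m es"
proof -
  obtain "is" where "is": "ring_trace \<Lambda> t m is" using ex_trace[OF assms] by blast
  then have "event_list \<Lambda> t m (map (\<lambda>i. (ring_at m i, fst i, snd (m i))) is)"
    unfolding event_list_def events_image by (simp add: ring_trace_def sorted_wrt_map)
  then show ?thesis by blast
qed

lemma jump_pos:
  assumes "regular_marks adj m" "jump m \<tau> v w"
  shows "0 < \<tau>" "adj v w"
proof -
  from assms(2) have "(\<tau>, w) \<in> rings (clock_at m v)" by (simp only: jump_iff_rings)
  then obtain n where "(\<tau>, w) = (ring_time (clock_at m v) n, snd (m (v, n)))"
    unfolding rings_def by blast
  then have n: "\<tau> = ring_time (clock_at m v) n" "w = snd (m (v, n))" by simp_all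
  show "0 < \<tau>" unfolding n
    by (rule ring_time_pos) (use assms(1) in \<open>simp add: regular_marks_def\<close>)
next
  from assms(2) have "(\<tau>, w) \<in> rings (clock_at m v)" by (simp only: jump_iff_rings)
  then obtain n where n: "w = snd (m (v, n))"
    unfolding rings_def by blast
  have "adj (fst (v, n)) (snd (m (v, n)))" using assms(1) unfolding regular_marks_def by blast
  then show "adj v w" unfolding n by simp
qed

text \<open>The rings of the spliced marks are those of \<open>m\<close> up to s together with those
  of \<open>m'\<close> delayed by s, so the sorted lists of events concatenate.\<close>

lemma jumps_splice:
  assumes m: "regular_marks adj m" "regular_marks adj m'" "regular_marks adj (splice_marks s m m')"
    and "finite \<Lambda>" "0 \<le> s" "0 \<le> t"
  shows "jumps \<Lambda> (s + t) (splice_marks s m m') = jumps \<Lambda> s m @ jumps \<Lambda> t m'"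
proof -
  obtain es where es1: "event_list \<Lambda> s m es"
    using ex_event_list[OF m(1) \<open>finite \<Lambda>\<close>] by blast
  obtain es' where es2: "event_list \<Lambda> t m' es'"
    using ex_event_list[OF m(2) \<open>finite \<Lambda>\<close>] by blast
  note es = es1 es2
  let ?sh = "\<lambda>e :: real \<times> 'a \<times> 'a. (s + fst e, snd e)"
  have rs: "rings (clock_at (splice_marks s m m') v) =
      {r \<in> rings (clock_at m v). fst r \<le> s} \<union> (\<lambda>r. (s + fst r, snd r)) ` rings (clock_at m' v)" for v
  proof -
    obtain N where "s < ring_time (clock_at m v) N"
      using m(1) unfolding regular_marks_def ring_at_def by force
    then show ?thesis
      unfolding splice_marks_def fst_conv snd_conv
      by (intro rings_splice_clock) (use m(1,2) in \<open>auto simp: regular_marks_def\<close>)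
  qed
  have J: "jump (splice_marks s m m') \<tau> v w \<longleftrightarrow>
      jump m \<tau> v w \<and> \<tau> \<le> s \<or> (\<exists>\<tau>'. \<tau> = s + \<tau>' \<and> jump m' \<tau>' v w)" for \<tau> v w
  proof -
    have "(\<tau>, w) \<in> (\<lambda>r. (s + fst r, snd r)) ` X \<longleftrightarrow> (\<exists>\<tau>'. \<tau> = s + \<tau>' \<and> (\<tau>', w) \<in> X)"
      for X :: "(real \<times> 'a) set" by force
    then show ?thesis unfolding jump_iff_rings rs by simp
  qed
  have "event_list \<Lambda> (s + t) (splice_marks s m m') (es @ map ?sh es')"
    unfolding event_list_def
  proof (intro conjI)
    \<comment> \<open>Rings of \<open>m'\<close> have positive times, so after the delay they come
      strictly later than all rings of \<open>m\<close> up to and including s.\<close>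
    have pos: "0 < fst e" if "e \<in> set es'" for e
      using that es(2) jump_pos[OF m(2)] by (auto simp: event_list_def)
    show "sorted_wrt (\<lambda>a b. fst a < fst b) (es @ map ?sh es')"
      using es pos by (fastforce simp: event_list_def sorted_wrt_append sorted_wrt_map)
    have "set (es @ map ?sh es') =
       {(\<tau>, v, w). jump m \<tau> v w \<and> v \<in> \<Lambda> \<and> w \<in> \<Lambda> \<and> \<tau> \<le> s} \<union>
       ?sh ` {(\<tau>, v, w). jump m' \<tau> v w \<and> v \<in> \<Lambda> \<and> w \<in> \<Lambda> \<and> \<tau> \<le> t}"
      using es by (simp add: event_list_def)
    also have "\<dots> = {(\<tau>, v, w). jump (splice_marks s m m') \<tau> v w \<and> v \<in> \<Lambda> \<and> w \<in> \<Lambda> \<and> \<tau> \<le> s + t}"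
      (is "?A \<union> ?sh ` ?B = ?C")
    proof (rule Set.set_eqI)
      fix e :: "real \<times> 'a \<times> 'a"
      obtain \<tau> v w where e: "e = (\<tau>, v, w)" by (cases e) auto
      have "e \<in> ?sh ` ?B \<longleftrightarrow> (\<exists>\<tau>'. \<tau> = s + \<tau>' \<and> (\<tau>', v, w) \<in> ?B)"
        unfolding e by force
      then show "e \<in> ?A \<union> ?sh ` ?B \<longleftrightarrow> e \<in> ?C"
        using assms(6) unfolding e by (auto simp: J)
    qed
    finally show "set (es @ map ?sh es') =
       {(\<tau>, v, w). jump (splice_marks s m m') \<tau> v w \<and> v \<in> \<Lambda> \<and> w \<in> \<Lambda> \<and> \<tau> \<le> s + t}" .
  qed
  then have "jumps \<Lambda> (s + t) (splice_marks s m m') = map snd (es @ map ?sh es')"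
    by (intro jumps_event_list) (use m(3) in \<open>auto simp: regular_marks_def\<close>)
  also have "\<dots> = jumps \<Lambda> s m @ jumps \<Lambda> t m'"
  proof -
    have "jumps \<Lambda> s m = map snd es" "jumps \<Lambda> t m' = map snd es'"
      by (intro jumps_event_list es; use m in \<open>auto simp: regular_marks_def\<close>)+
    then show ?thesis by (simp add: o_def)
  qed
  finally show ?thesis .
qed

lemma jumps_subset:
  assumes "regular_marks adj m" "finite \<Lambda>" "(v, w) \<in> set (jumps \<Lambda> t m)"
  shows "adj v w" "v \<in> \<Lambda>" "w \<in> \<Lambda>"
proof -
  obtain "is" where is1: "ring_trace \<Lambda> t m is" using ex_trace assms by blast
  then show "adj v w" "v \<in> \<Lambda>" "w \<in> \<Lambda>"
    using assms unfolding jumps_trace[OF is1] by (auto simp: ring_trace_def regular_marks_def)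
qed


section \<open>Vertex-transitive graphs\<close>

text \<open>The common ground of the lattice and the group case. The common degree makes the kernel
  symmetric, with 1/D along each edge in both directions.\<close>

locale vertex_transitive_graph =
  fixes adj :: "'v \<Rightarrow> 'v \<Rightarrow> bool" and D :: nat
  assumes adj_sym: "adj u v \<Longrightarrow> adj v u"
    and adj_irrefl: "\<not> adj u u"
    and finite_nbrs: "finite (nbrs adj u)"
    and card_nbrs: "card (nbrs adj u) = D"
    and connected: "adj\<^sup>*\<^sup>* u v"
    and infinite_vertices: "infinite (UNIV :: 'v set)"
    and transitive: "\<exists>\<phi>. bij \<phi> \<and> (\<forall>a b. adj (\<phi> a) (\<phi> b) \<longleftrightarrow> adj a b) \<and> \<phi> u = v"
begin

lemma nbrs_nonempty: "nbrs adj u \<noteq> {}"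
proof -
  obtain v where "v \<noteq> u"
    using infinite_vertices finite.emptyI finite.insertI[of "{}" u] by (metis UNIV_eq_I insertI1)
  with connected[of u v] obtain w where "adj u w" by (auto elim: converse_rtranclpE)
  then show ?thesis by (auto simp: nbrs_def)
qed

lemma D_pos: "0 < D"
  using nbrs_nonempty[of undefined] finite_nbrs card_nbrs by (metis card_gt_0_iff)

primrec graph_ball :: "'v \<Rightarrow> nat \<Rightarrow> 'v set" where
  "graph_ball x 0 = {x}"
| "graph_ball x (Suc n) = graph_ball x n \<union> (\<Union>y\<in>graph_ball x n. nbrs adj y)"

lemma finite_ball: "finite (graph_ball x n)"
  by (induction n) (auto simp: finite_nbrs)

lemma ball_mono: "n \<le> k \<Longrightarrow> graph_ball x n \<subseteq> graph_ball x k"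
  by (induction k) (auto simp: le_Suc_eq)

lemma ball_center [simp]: "x \<in> graph_ball x n"
  by (induction n) auto

lemma ball_step: "y \<in> graph_ball x n \<Longrightarrow> adj y z \<Longrightarrow> z \<in> graph_ball x (Suc n)"
  by (auto simp: nbrs_def)

lemma ball_exhausts: "\<exists>n. y \<in> graph_ball x n"
  using connected[of x y]
proof (induction rule: rtranclp_induct)
  case base
  then show ?case by (intro exI[of _ 0]) simp
next
  case (step y z)
  then show ?case by (meson ball_step)
qed

text \<open>Countability permits almost sure statements about all marks at once and makes the space
  of jump lists countable.\<close>

lemma countable_vertices: "countable (UNIV :: 'v set)"
proof -
  have "(UNIV :: 'v set) = (\<Union>n. graph_ball undefined n)" using ball_exhausts by auto
  also have "countable \<dots>" by (intro countable_UN) (auto simp: finite_ball countable_finite)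
  finally show ?thesis .
qed

lemma countable_lists_vertices: "countable (UNIV :: ('v \<times> 'v) list set)"
  "countable (UNIV :: ('v \<times> nat) list set)" "countable (UNIV :: ('v \<times> nat) set)"
  "countable (UNIV :: ('v \<times> 'v) set)"
proof -
  have 1: "countable (UNIV \<times> UNIV :: ('v \<times> 'v) set)" "countable (UNIV \<times> UNIV :: ('v \<times> nat) set)"
    by (intro countable_SIGMA countable_vertices countableI_type)+
  show "countable (UNIV :: ('v \<times> 'v) list set)"
    using countable_lists[OF 1(1)] by (simp only: UNIV_Times_UNIV lists_UNIV)
  show "countable (UNIV :: ('v \<times> nat) list set)"
    using countable_lists[OF 1(2)] by (simp only: UNIV_Times_UNIV lists_UNIV)
  show "countable (UNIV :: ('v \<times> nat) set)"
    using 1(2) by (simp only: UNIV_Times_UNIV)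
  show "countable (UNIV :: ('v \<times> 'v) set)"
    using 1(1) by (simp only: UNIV_Times_UNIV)
qed

lemma pmf_step: "pmf (srw_step adj v) w = (if adj v w then 1 / real D else 0)"
  by (simp add: pmf_srw_step[OF finite_nbrs nbrs_nonempty] srw_kernel_def card_nbrs)

section \<open>Almost sure regularity of the marks, and measurability of the jump list\<close>

lemma measurable_mark [measurable]: "(\<lambda>m. m i) \<in> marks_law adj \<rightarrow>\<^sub>M borel \<Otimes>\<^sub>M count_space UNIV"
proof -
  have "(\<lambda>m. m i) \<in> marks_law adj \<rightarrow>\<^sub>M mark_law adj (fst i)"
    unfolding marks_law_def by measurable
  then show ?thesis unfolding mark_law_eq measurable_cong_sets[OF refl sets_ring_law] .
qed

lemma measurable_ring_at [measurable]: "(\<lambda>m. ring_at m i) \<in> borel_measurable (marks_law adj)"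
  unfolding ring_at_def ring_time_def by measurable

lemma AE_mark:
  assumes "AE a in ring_law (srw_step adj (fst i)). P a"
  shows "AE m in marks_law adj. P (m i)"
  unfolding marks_law_def mark_law_eq
  by (rule AE_PiM_component) (use assms prob_space_ring_law in auto)

lemma AE_mark_pos: "AE m in marks_law adj. \<forall>i. 0 < fst (m i)"
proof -
  have *: "AE a in ring_law p. 0 < fst a" for p :: "'v pmf"
  proof (rule AE_I)
    show "emeasure (ring_law p) ({..0} \<times> UNIV) = 0"
      by (subst emeasure_ring_law_Times) (auto simp: emeasure_exp_law_le)
    show "{..0::real} \<times> (UNIV :: 'v set) \<in> sets (ring_law p)" by (simp add: sets_ring_law)
  qed auto
  then have "AE m in marks_law adj. \<forall>i\<in>UNIV. 0 < fst (m i)"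
    by (subst AE_ball_countable[OF countable_lists_vertices(3)]) (intro ballI AE_mark *)
  then show ?thesis by simp
qed

lemma AE_mark_adj: "AE m in marks_law adj. \<forall>i. adj (fst i) (snd (m i))"
proof -
  have *: "AE a in ring_law (srw_step adj v). adj v (snd a)" for v
  proof (rule AE_I)
    have "measure_pmf.prob (srw_step adj v) {w. \<not> adj v w} = 0"
      unfolding measure_pmf_zero_iff srw_step_def
      using set_pmf_of_set[OF nbrs_nonempty finite_nbrs, of v] by (auto simp: nbrs_def)
    then show "emeasure (ring_law (srw_step adj v)) (UNIV \<times> {w. \<not> adj v w}) = 0"
      by (subst emeasure_ring_law_Times) (auto simp: measure_pmf.emeasure_eq_measure)
    show "(UNIV :: real set) \<times> {w. \<not> adj v w} \<in> sets (ring_law (srw_step adj v))"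
      by (simp add: sets_ring_law)
  qed auto
  then have "AE m in marks_law adj. \<forall>i\<in>UNIV. adj (fst i) (snd (m i))"
    by (subst AE_ball_countable[OF countable_lists_vertices(3)]) (intro ballI AE_mark *)
  then show ?thesis by simp
qed

lemma emeasure_first_marks_le:
  assumes "finite J" "0 \<le> s"
  shows "emeasure (marks_law adj) {m. \<forall>i\<in>J. fst (m i) \<le> s} = ennreal ((1 - exp (- s)) ^ card J)"
proof -
  have "{m :: 'v marks. \<forall>i\<in>J. fst (m i) \<le> s} = {m. \<forall>i\<in>J. m i \<in> {..s} \<times> UNIV}"
    by (auto simp: mem_Times_iff)
  also have "emeasure (marks_law adj) \<dots> = (\<Prod>i\<in>J. emeasure (mark_law adj (fst i)) ({..s} \<times> UNIV))"
    using assms by (intro emeasure_marks_law_Collect) (auto simp: mark_law_eq sets_ring_law)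
  also have "\<dots> = (\<Prod>i\<in>J. ennreal (1 - exp (- s)))"
    using assms by (simp add: mark_law_eq emeasure_ring_law_Times emeasure_exp_law_le)
  finally show ?thesis using assms by (simp add: ennreal_power)
qed

text \<open>Beyond every index some waiting time exceeds 1, as n given ones are all at most 1 with
  probability (1 - exp (-1))^n. Bounded ring times would make the waiting times summable, hence
  eventually less than 1.\<close>

lemma AE_ring_unbounded: "AE m in marks_law adj. \<forall>v t. \<exists>n. t < ring_at m (v, n)"
proof -
  interpret prob_space "marks_law adj" by (rule prob_space_marks_law)
  have null: "AE m in marks_law adj. \<exists>k\<ge>K. 1 < fst (m (v, k))" for v K
  proof (rule AE_I)
    let ?B = "{m. \<forall>k\<ge>K. fst (m (v, k)) \<le> 1}"
    have "{m \<in> space (marks_law adj). \<forall>k\<ge>K. fst (m (v, k)) \<le> 1} \<in> sets (marks_law adj)" by measurable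
    then show B: "?B \<in> sets (marks_law adj)" by simp
    show "{m \<in> space (marks_law adj). \<not> (\<exists>k\<ge>K. 1 < fst (m (v, k)))} \<subseteq> ?B" by (auto simp: not_less)
    have le: "measure (marks_law adj) ?B \<le> (1 - exp (- 1)) ^ n" for n
    proof -
      let ?J = "Pair v ` {K..<K + n}"
      have J: "card ?J = n" "finite ?J" by (simp_all add: card_image inj_on_def)
      have "{m \<in> space (marks_law adj). \<forall>i\<in>?J. fst (m i) \<le> 1} \<in> sets (marks_law adj)"
      proof (intro sets.sets_Collect_finite_All J(2))
        fix i
        show "{m \<in> space (marks_law adj). fst (m i) \<le> 1} \<in> sets (marks_law adj)" by measurable
      qed
      then have "emeasure (marks_law adj) ?B \<le> emeasure (marks_law adj) {m. \<forall>i\<in>?J. fst (m i) \<le> 1}"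
        by (intro emeasure_mono) auto
      also have "\<dots> = ennreal ((1 - exp (- 1)) ^ n)"
        using emeasure_first_marks_le[of ?J 1] J by simp
      finally show ?thesis by (simp add: emeasure_eq_measure)
    qed
    have "(\<lambda>n. (1 - exp (- 1 :: real)) ^ n) \<longlonglongrightarrow> 0" by (rule LIMSEQ_power_zero) simp
    then have "measure (marks_law adj) ?B \<le> 0"
      using le by (intro LIMSEQ_le_const) auto
    then show "emeasure (marks_law adj) ?B = 0"
      by (simp add: emeasure_eq_measure measure_le_0_iff)
  qed
  have "AE m in marks_law adj. \<forall>v\<in>UNIV. \<forall>K. \<exists>k\<ge>K. 1 < fst (m (v, k))"
    using null by (subst AE_ball_countable[OF countable_vertices]) (auto simp: AE_all_countable)
  with AE_mark_pos show ?thesis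
  proof eventually_elim
    case (elim m)
    show ?case
    proof (intro allI, rule ccontr)
      fix v t assume "\<not> (\<exists>n. t < ring_at m (v, n))"
      then have "(\<Sum>k<n. fst (m (v, k))) \<le> t" for n
      proof -
        have "(\<Sum>k<n. fst (m (v, k))) \<le> (\<Sum>k\<le>n. fst (m (v, k)))"
          using elim(1) by (intro sum_mono2) (auto intro: less_imp_le)
        with \<open>\<not> _\<close> show ?thesis by (auto simp: ring_at_def ring_time_def not_less intro: order_trans)
      qed
      then have "summable (\<lambda>k. fst (m (v, k)))"
        using elim(1) by (intro summableI_nonneg_bounded) (auto intro: less_imp_le)
      then have "(\<lambda>k. fst (m (v, k))) \<longlonglongrightarrow> 0" by (rule summable_LIMSEQ_zero)
      then have "eventually (\<lambda>k. fst (m (v, k)) < 1) sequentially" by (rule order_tendstoD) simp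
      then obtain K where "\<And>k. k \<ge> K \<Longrightarrow> fst (m (v, k)) < 1" by (auto simp: eventually_sequentially)
      moreover obtain k where "k \<ge> K" "1 < fst (m (v, k))" using elim(2) by blast
      ultimately show False by force
    qed
  qed
qed

text \<open>Fix all marks except the one at \<open>i\<close>. The ring at \<open>j\<close>, of
  another clock, is then constant, while the ring at \<open>i\<close> is a constant plus its own
  waiting time, whose law has no atoms.\<close>

lemma AE_ring_at_neq:
  assumes "fst i \<noteq> fst j"
  shows "AE m in marks_law adj. ring_at m i \<noteq> ring_at m j"
proof -
  let ?I = "UNIV - {i}" and ?M = "\<lambda>i :: 'v \<times> nat. mark_law adj (fst i)"
  let ?P = "\<Pi>\<^sub>M i\<in>?I. ?M i"
  have ps: "prob_space (?M k)" for k unfolding mark_law_eq by (rule prob_space_ring_law)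
  interpret a: prob_space "?M i" by (rule ps)
  interpret b: prob_space ?P by (intro prob_space_PiM ps)
  interpret pair_sigma_finite "?M i" ?P ..
  have eq: "marks_law adj = distr (?M i \<Otimes>\<^sub>M ?P) (marks_law adj) (\<lambda>(x, X). X(i := x))"
    using distr_pair_PiM_eq_PiM[of ?I ?M i] ps by (simp add: marks_law_def insert_absorb)
  have ms [measurable]: "(\<lambda>(x, X). X(i := x)) \<in> ?M i \<Otimes>\<^sub>M ?P \<rightarrow>\<^sub>M marks_law adj"
  proof -
    have "(\<lambda>(x, X). X(i := x)) \<in> ?M i \<Otimes>\<^sub>M ?P \<rightarrow>\<^sub>M (\<Pi>\<^sub>M i\<in>insert i ?I. ?M i)" by measurable
    then show ?thesis by (simp add: marks_law_def insert_absorb)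
  qed
  let ?B = "{m. ring_at m i = ring_at m j}"
  have "{m \<in> space (marks_law adj). ring_at m i = ring_at m j} \<in> sets (marks_law adj)" by measurable
  then have B: "?B \<in> sets (marks_law adj)" by simp
  let ?B' = "(\<lambda>(x, X). X(i := x)) -` ?B \<inter> space (?M i \<Otimes>\<^sub>M ?P)"
  have "emeasure (marks_law adj) ?B = emeasure (?M i \<Otimes>\<^sub>M ?P) ?B'"
    by (subst eq, rule emeasure_distr[OF ms B])
  also have "\<dots> = (\<integral>\<^sup>+X. emeasure (?M i) ((\<lambda>x. (x, X)) -` ?B') \<partial>?P)"
    by (rule emeasure_pair_measure_alt2) (use measurable_sets[OF ms B] in simp)
  also have "\<dots> = (\<integral>\<^sup>+X. 0 \<partial>?P)"
  proof (rule nn_integral_cong)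
    fix X
    \<comment> \<open>The only value of the waiting time at \<open>i\<close> for which the two rings
      coincide.\<close>
    define d where "d = ring_at X j - (\<Sum>k<snd i. fst (X (fst i, k)))"
    have sub: "(\<lambda>x. (x, X)) -` ?B' \<subseteq> {d} \<times> UNIV"
    proof clarsimp
      fix a b assume "ring_at (X(i := (a, b))) i = ring_at (X(i := (a, b))) j"
      moreover have "ring_at (X(i := (a, b))) j = ring_at X j"
        using assms by (auto simp: ring_at_def ring_time_def intro!: sum.cong)
      moreover have "ring_at (X(i := (a, b))) i = (\<Sum>k<snd i. fst (X (fst i, k))) + a"
        unfolding ring_at_def ring_time_def lessThan_Suc_atMost[symmetric] sum.lessThan_Suc
        by (intro arg_cong2[where f = "(+)"] sum.cong) (auto simp: prod_eq_iff)
      ultimately show "a = d" by (simp add: d_def)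
    qed
    have zero: "emeasure (?M i) ({d} \<times> UNIV) = 0"
    proof -
      have "emeasure exp_law {d} = 0"
        by (subst emeasure_density) (auto simp: nn_integral_indicator_singleton)
      then show ?thesis by (simp add: mark_law_eq emeasure_ring_law_Times)
    qed
    have "{d} \<times> UNIV \<in> sets (?M i)" by (simp add: mark_law_eq sets_ring_law)
    from emeasure_mono[OF sub this] show "emeasure (?M i) ((\<lambda>x. (x, X)) -` ?B') = 0"
      unfolding zero by simp
  qed
  finally have "emeasure (marks_law adj) ?B = 0" by simp
  then show ?thesis using B by (intro AE_I[where N = ?B]) auto
qed

lemma AE_regular_marks: "AE m in marks_law adj. regular_marks adj m"
proof -
  have "AE m in marks_law adj. \<forall>i\<in>UNIV. \<forall>j\<in>UNIV. fst i \<noteq> fst j \<longrightarrow> ring_at m i \<noteq> ring_at m j"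
    by (subst AE_ball_countable[OF countable_lists_vertices(3)], intro ballI,
        subst AE_ball_countable[OF countable_lists_vertices(3)], intro ballI)
       (auto intro: AE_ring_at_neq)
  with AE_mark_pos AE_mark_adj AE_ring_unbounded show ?thesis
  proof eventually_elim
    case (elim m)
    have "inj (ring_at m)"
    proof (rule injI)
      fix i j assume eq: "ring_at m i = ring_at m j"
      then have "fst i = fst j" using elim(4) by blast
      moreover have "strict_mono (ring_time (clock_at m (fst j)))"
        by (rule strict_mono_ring_time) (use elim(1) in simp)
      ultimately show "i = j"
        using eq by (auto simp: ring_at_def strict_mono_eq prod_eq_iff)
    qed
    then show ?case using elim by (simp add: regular_marks_def)
  qed
qed

text \<open>A countable union over the index lists that may be the trace. For a fixed one, being
  sorted and complete amounts to countably many measurable conditions.\<close>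

lemma measurable_jumps [measurable]: "jumps \<Lambda> t \<in> marks_law adj \<rightarrow>\<^sub>M count_space UNIV"
proof -
  have tr: "{m \<in> space (marks_law adj). ring_trace \<Lambda> t m is} \<in> sets (marks_law adj)" for "is"
  proof -
    have "{m \<in> space (marks_law adj). ring_trace \<Lambda> t m is} =
      {m \<in> space (marks_law adj). (\<forall>b<length is. \<forall>a<b. ring_at m (is ! a) < ring_at m (is ! b)) \<and>
        (\<forall>i\<in>UNIV. i \<in> set is \<longleftrightarrow> fst i \<in> \<Lambda> \<and> snd (m i) \<in> \<Lambda> \<and> ring_at m i \<le> t)}"
      by (auto simp: ring_trace_def sorted_wrt_iff_nth_less)
    also have "\<dots> \<in> sets (marks_law adj)"
    proof (intro sets.sets_Collect_conj sets.sets_Collect_countable_All' countable_lists_vertices(3))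
      show "{m \<in> space (marks_law adj). \<forall>b<length is. \<forall>a<b. ring_at m (is ! a) < ring_at m (is ! b)}
          \<in> sets (marks_law adj)"
        by measurable
      fix i
      have "(\<lambda>m. snd (m i)) \<in> marks_law adj \<rightarrow>\<^sub>M count_space UNIV" by measurable
      from measurable_compose[OF this, of "\<lambda>w. w \<in> \<Lambda>" "count_space UNIV"]
      have [measurable]: "Measurable.pred (marks_law adj) (\<lambda>m. snd (m i) \<in> \<Lambda>)" by simp
      have [measurable]: "Measurable.pred (marks_law adj) (\<lambda>m. ring_at m i \<le> t)" by measurable
      show "{m \<in> space (marks_law adj). i \<in> set is \<longleftrightarrow> fst i \<in> \<Lambda> \<and> snd (m i) \<in> \<Lambda> \<and> ring_at m i \<le> t}
          \<in> sets (marks_law adj)"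
        by measurable
    qed
    finally show ?thesis .
  qed
  have "jumps \<Lambda> t -` {l} \<inter> space (marks_law adj) \<in> sets (marks_law adj)" for l
  proof -
    have "jumps \<Lambda> t -` {l} \<inter> space (marks_law adj) =
      {m \<in> space (marks_law adj). (\<exists>is\<in>UNIV. ring_trace \<Lambda> t m is \<and> map (\<lambda>i. (fst i, snd (m i))) is = l) \<or>
         (\<forall>is\<in>UNIV. \<not> ring_trace \<Lambda> t m is) \<and> l = []}" (is "?A = {m \<in> _. ?P m}")
    proof -
      have "jumps \<Lambda> t m = l \<longleftrightarrow> ?P m" for m
      proof (cases "\<exists>is. ring_trace \<Lambda> t m is")
        case True
        then obtain "is" where is1: "ring_trace \<Lambda> t m is" by blast
        have "ring_trace \<Lambda> t m js \<longleftrightarrow> js = is" for js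
          using is1 trace_unique[OF is1, of js] by metis
        then show ?thesis by (simp add: jumps_trace[OF is1])
      qed (auto simp: jumps_def)
      then show ?thesis by auto
    qed
    also have "\<dots> \<in> sets (marks_law adj)"
    proof -
      have "{m \<in> space (marks_law adj). map (\<lambda>i. (fst i, snd (m i))) is = l} \<in> sets (marks_law adj)" for "is"
      proof -
        have "{m \<in> space (marks_law adj). map (\<lambda>i. (fst i, snd (m i))) is = l} =
          {m \<in> space (marks_law adj). length is = length l \<and> (\<forall>k<length is. snd (m (is ! k)) = snd (l ! k) \<and> fst (is ! k) = fst (l ! k))}"
          by (auto simp: list_eq_iff_nth_eq prod_eq_iff)
        also have "\<dots> \<in> sets (marks_law adj)" by measurable
        finally show ?thesis .
      qed
      then show ?thesis
        by (intro sets.sets_Collect_disj sets.sets_Collect_conj sets.sets_Collect_countable_Ex'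
            sets.sets_Collect_countable_All' sets.sets_Collect_neg tr countable_lists_vertices(2)
            sets.sets_Collect_const)
    qed
    finally show ?thesis .
  qed
  then show ?thesis
    by (subst measurable_count_space_eq_countable[OF countable_lists_vertices(1)]) auto
qed

text \<open>Lists of pairs of vertices are countable, so the law can be a \<open>pmf\<close>, for
  which composition, images and supports are at hand.\<close>

definition jump_law :: "'v set \<Rightarrow> real \<Rightarrow> ('v \<times> 'v) list pmf" where
  "jump_law \<Lambda> t = embed_pmf (\<lambda>l. measure (marks_law adj) {m. jumps \<Lambda> t m = l})"

lemma measure_pmf_jump_law:
  "measure_pmf (jump_law \<Lambda> t) = distr (marks_law adj) (count_space UNIV) (jumps \<Lambda> t)"
proof -
  let ?D = "distr (marks_law adj) (count_space UNIV) (jumps \<Lambda> t)"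
  interpret prob_space "marks_law adj" by (rule prob_space_marks_law)
  interpret D: prob_space ?D by (rule prob_space_distr) simp
  have D: "emeasure ?D {l} = ennreal (measure (marks_law adj) {m. jumps \<Lambda> t m = l})" for l
    by (subst emeasure_distr) (auto simp: emeasure_eq_measure vimage_def)
  have "(\<integral>\<^sup>+l. ennreal (measure (marks_law adj) {m. jumps \<Lambda> t m = l}) \<partial>count_space UNIV) = emeasure ?D UNIV"
    using emeasure_countable_singleton[of UNIV ?D] countable_lists_vertices(1) by (simp add: D)
  also have "\<dots> = 1" using D.emeasure_space_1 by simp
  finally have pmf: "pmf (jump_law \<Lambda> t) l = measure (marks_law adj) {m. jumps \<Lambda> t m = l}" for l
    unfolding jump_law_def by (intro pmf_embed_pmf) simp_all
  show ?thesis
    by (rule measure_eqI_countable[where A = UNIV])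
       (auto simp: D emeasure_pmf_single pmf countable_lists_vertices)
qed

lemma prob_jump_law:
  "measure_pmf.prob (jump_law \<Lambda> t) S = measure (marks_law adj) {m. jumps \<Lambda> t m \<in> S}"
  unfolding measure_pmf_jump_law by (subst measure_distr) (auto simp: vimage_def)

text \<open>The Markov property for lists: the jumps up to s are followed by an independent copy of
  those up to t. It combines \<open>distr_splice\<close> with the pathwise
  \<open>jumps_splice\<close>.\<close>

lemma jump_law_add:
  assumes "finite \<Lambda>" "0 \<le> s" "0 \<le> t"
  shows "jump_law \<Lambda> (s + t) = bind_pmf (jump_law \<Lambda> s) (\<lambda>a. map_pmf ((@) a) (jump_law \<Lambda> t))"
proof (rule pmf_eqI)
  fix l
  interpret Q: prob_space "marks_law adj" by (rule prob_space_marks_law)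
  interpret QQ: pair_prob_space "marks_law adj" "marks_law adj" ..
  let ?Q = "marks_law adj"
  have Qs: "distr (?Q \<Otimes>\<^sub>M ?Q) ?Q (\<lambda>x. splice_marks s (fst x) (snd x)) = ?Q"
    by (rule distr_splice) fact
  have reg: "AE x in ?Q \<Otimes>\<^sub>M ?Q. regular_marks adj (fst x) \<and> regular_marks adj (snd x) \<and>
      regular_marks adj (splice_marks s (fst x) (snd x))"
  \<comment> \<open>The spliced marks are almost surely regular because they have the law of the
    original ones.\<close>
  proof -
    have "AE x in ?Q \<Otimes>\<^sub>M ?Q. regular_marks adj (fst x)"
    proof (rule AE_distrD[of fst _ ?Q])
      have eq: "distr (?Q \<Otimes>\<^sub>M ?Q) ?Q fst = ?Q"
      proof (rule measure_eqI)
        fix A assume A: "A \<in> sets (distr (?Q \<Otimes>\<^sub>M ?Q) ?Q fst)"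
        have "fst -` A \<inter> space (?Q \<Otimes>\<^sub>M ?Q) = A \<times> space ?Q"
          using A by (auto simp: space_pair_measure)
        then show "emeasure (distr (?Q \<Otimes>\<^sub>M ?Q) ?Q fst) A = emeasure ?Q A"
          using A Q.emeasure_pair_measure_Times[of A ?Q UNIV] Q.emeasure_space_1 sets.top[of ?Q]
          by (simp add: emeasure_distr)
      qed simp
      show "AE x in distr (?Q \<Otimes>\<^sub>M ?Q) ?Q fst. regular_marks adj x"
        unfolding eq by (rule AE_regular_marks)
    qed simp
    moreover have "AE x in ?Q \<Otimes>\<^sub>M ?Q. regular_marks adj (snd x)"
    proof (rule AE_distrD[of snd _ ?Q])
      have eq: "distr (?Q \<Otimes>\<^sub>M ?Q) ?Q snd = ?Q"
        by (rule distr_snd) (rule prob_space_marks_law)+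
      show "AE x in distr (?Q \<Otimes>\<^sub>M ?Q) ?Q snd. regular_marks adj x"
        unfolding eq by (rule AE_regular_marks)
    qed simp
    moreover have "AE x in ?Q \<Otimes>\<^sub>M ?Q. regular_marks adj (splice_marks s (fst x) (snd x))"
    proof (rule AE_distrD[of "\<lambda>x. splice_marks s (fst x) (snd x)" _ ?Q])
      show "AE x in distr (?Q \<Otimes>\<^sub>M ?Q) ?Q (\<lambda>x. splice_marks s (fst x) (snd x)). regular_marks adj x"
        unfolding Qs by (rule AE_regular_marks)
    qed simp
    ultimately show ?thesis by eventually_elim simp
  qed
  have "emeasure (jump_law \<Lambda> (s + t)) {l} = emeasure ?Q (jumps \<Lambda> (s + t) -` {l} \<inter> space ?Q)"
    unfolding measure_pmf_jump_law by (rule emeasure_distr) auto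
  also have "\<dots> = (\<integral>\<^sup>+m. indicator {l} (jumps \<Lambda> (s + t) m) \<partial>?Q)"
    by (subst nn_integral_indicator[OF measurable_sets[OF measurable_jumps], symmetric])
       (auto simp: indicator_def intro!: nn_integral_cong)
  also have "\<dots> = (\<integral>\<^sup>+x. indicator {l} (jumps \<Lambda> (s + t) (splice_marks s (fst x) (snd x))) \<partial>(?Q \<Otimes>\<^sub>M ?Q))"
  proof -
    have "(\<lambda>m. indicator {l} (jumps \<Lambda> (s + t) m) :: ennreal) \<in> borel_measurable ?Q"
      by (rule measurable_compose[OF measurable_jumps]) simp
    then show ?thesis
      by (subst Qs[symmetric]) (simp add: nn_integral_distr[OF measurable_splice])
  qed
  also have "\<dots> = (\<integral>\<^sup>+x. indicator {l} (jumps \<Lambda> s (fst x) @ jumps \<Lambda> t (snd x)) \<partial>(?Q \<Otimes>\<^sub>M ?Q))"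
  proof (rule nn_integral_cong_AE)
    show "AE x in ?Q \<Otimes>\<^sub>M ?Q. indicator {l} (jumps \<Lambda> (s + t) (splice_marks s (fst x) (snd x))) =
        (indicator {l} (jumps \<Lambda> s (fst x) @ jumps \<Lambda> t (snd x)) :: ennreal)"
      using reg
    proof eventually_elim
      case (elim x)
      then show ?case using jumps_splice[of adj "fst x" "snd x" s \<Lambda> t] assms by simp
    qed
  qed
  also have "\<dots> = (\<integral>\<^sup>+m. \<integral>\<^sup>+m'. indicator {l} (jumps \<Lambda> s m @ jumps \<Lambda> t m') \<partial>?Q \<partial>?Q)"
  proof -
    have "(\<lambda>x. (jumps \<Lambda> s (fst x), jumps \<Lambda> t (snd x))) \<in> ?Q \<Otimes>\<^sub>M ?Q \<rightarrow>\<^sub>M count_space UNIV \<Otimes>\<^sub>M count_space UNIV"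
      by measurable
    then have "(\<lambda>x. (jumps \<Lambda> s (fst x), jumps \<Lambda> t (snd x))) \<in> ?Q \<Otimes>\<^sub>M ?Q \<rightarrow>\<^sub>M count_space UNIV"
      by (simp add: pair_measure_countable countable_lists_vertices)
    from measurable_compose[OF this, of "\<lambda>(a, b). indicator {l} (a @ b) :: ennreal" borel]
    have "(\<lambda>x. indicator {l} (jumps \<Lambda> s (fst x) @ jumps \<Lambda> t (snd x)) :: ennreal) \<in> borel_measurable (?Q \<Otimes>\<^sub>M ?Q)"
      by simp
    from Q.nn_integral_fst[OF this] show ?thesis by simp
  qed
  also have "\<dots> = (\<integral>\<^sup>+a. \<integral>\<^sup>+b. indicator {l} (a @ b) \<partial>jump_law \<Lambda> t \<partial>jump_law \<Lambda> s)"
    unfolding measure_pmf_jump_law by (simp add: nn_integral_distr[OF measurable_jumps])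
  also have "\<dots> = emeasure (bind_pmf (jump_law \<Lambda> s) (\<lambda>a. map_pmf ((@) a) (jump_law \<Lambda> t))) {l}"
  proof -
    have "(\<integral>\<^sup>+b. indicator {l} (a @ b) \<partial>jump_law \<Lambda> t) = emeasure (map_pmf ((@) a) (jump_law \<Lambda> t)) {l}" for a
      by (simp add: nn_integral_indicator[symmetric] del: nn_integral_indicator)
         (auto simp: indicator_def intro!: nn_integral_cong)
    then show ?thesis by (simp add: emeasure_bind_pmf)
  qed
  finally show "pmf (jump_law \<Lambda> (s + t)) l = pmf (bind_pmf (jump_law \<Lambda> s) (\<lambda>a. map_pmf ((@) a) (jump_law \<Lambda> t))) l"
    by (simp add: emeasure_pmf_single)
qed

lemma jump_law_subset:
  assumes "finite \<Lambda>" "l \<in> set_pmf (jump_law \<Lambda> t)" "(v, w) \<in> set l"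
  shows "adj v w" "v \<in> \<Lambda>" "w \<in> \<Lambda>"
proof -
  have "AE m in marks_law adj. \<forall>(v, w)\<in>set (jumps \<Lambda> t m). adj v w \<and> v \<in> \<Lambda> \<and> w \<in> \<Lambda>"
    using AE_regular_marks
  proof eventually_elim
    case (elim m)
    show ?case using jumps_subset[OF elim assms(1)] by auto
  qed
  then have "AE l in jump_law \<Lambda> t. \<forall>(v, w)\<in>set l. adj v w \<and> v \<in> \<Lambda> \<and> w \<in> \<Lambda>"
    unfolding measure_pmf_jump_law by (subst AE_distr_iff) auto
  then have "\<forall>(v, w)\<in>set l. adj v w \<and> v \<in> \<Lambda> \<and> w \<in> \<Lambda>"
    using assms(2) by (simp add: AE_measure_pmf_iff)
  then show "adj v w" "v \<in> \<Lambda>" "w \<in> \<Lambda>" using assms(3) by auto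
qed

end


section \<open>Short-time estimates for the jump list\<close>

lemma count_list_subseq: "subseq a b \<Longrightarrow> count_list a v \<le> count_list b v"
  by (induction rule: list_emb.induct) auto

text \<open>Clock v occurs in the trace at least \<open>count_list c v\<close> times. So its first
  that many rings, and a fortiori its first that many waiting times, are at most t.\<close>

lemma trace_count:
  assumes m: "regular_marks adj m" and tr: "ring_trace \<Lambda> t m is"
    and sub: "subseq c (map fst is)" and k: "k < count_list c v"
  shows "fst (m (v, k)) \<le> t"
proof -
  have "sorted_wrt (<) (map (ring_at m) is)"
    using tr by (simp add: ring_trace_def sorted_wrt_map)
  then have "distinct (map (ring_at m) is)" by (simp add: strict_sorted_iff)
  then have dist: "distinct is" by (simp add: distinct_map)
  \<comment> \<open>More than k distinct indices of clock v occur, and they cannot all be below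
    k.\<close>
  have "\<exists>n\<ge>k. (v, n) \<in> set is"
  proof (rule ccontr)
    assume "\<not> ?thesis"
    then have "set (filter (\<lambda>i. fst i = v) is) \<subseteq> Pair v ` {..<k}"
      by (auto simp: not_le image_iff)
    from card_mono[OF _ this] have "card (set (filter (\<lambda>i. fst i = v) is)) \<le> k"
      by (simp add: card_image inj_on_def)
    moreover have "card (set (filter (\<lambda>i. fst i = v) is)) = count_list (map fst is) v"
      using dist by (subst distinct_card) (auto simp: count_list_eq_length_filter filter_map o_def eq_commute)
    ultimately show False using k count_list_subseq[OF sub, of v] by simp
  qed
  then obtain n where n: "n \<ge> k" "(v, n) \<in> set is" by blast
  have pos: "0 < fst (m i)" for i using m unfolding regular_marks_def by blast
  have "fst (m (v, k)) \<le> ring_at m (v, n)"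
    unfolding ring_at_def ring_time_def fst_conv snd_conv
    by (rule member_le_sum) (use n pos in \<open>auto intro: less_imp_le\<close>)
  also have "\<dots> \<le> t" using n tr by (simp add: ring_trace_def)
  finally show ?thesis .
qed

lemma one_minus_exp_bounds:
  assumes "0 \<le> (t :: real)"
  shows "1 - exp (- t) \<le> t" "t - t\<^sup>2 \<le> 1 - exp (- t)"
proof -
  show "1 - exp (- t) \<le> t" using exp_ge_add_one_self[of "- t"] by simp
  have "exp (- t) \<le> 1 / (1 + t)"
    using exp_ge_add_one_self[of t] assms by (simp add: exp_minus field_simps)
  also have "1 / (1 + t) \<le> 1 - t + t\<^sup>2"
    using assms by (simp add: field_simps power2_eq_square)
  finally show "t - t\<^sup>2 \<le> 1 - exp (- t)" by simp
qed

context vertex_transitive_graph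
begin

text \<open>Each occurrence of a site in \<open>c\<close> forces a waiting time of its own to be at
  most t. These waiting times are independent, and each is so short with probability at most
  t.\<close>

lemma prob_jump_law_subseq:
  assumes "finite \<Lambda>" "0 \<le> t"
  shows "measure_pmf.prob (jump_law \<Lambda> t) {l. subseq c (map fst l)} \<le> t ^ length c"
proof -
  interpret prob_space "marks_law adj" by (rule prob_space_marks_law)
  \<comment> \<open>As many first marks of a site as it has occurrences in \<open>c\<close>, hence
    \<open>length c\<close> marks in all.\<close>
  let ?J = "SIGMA v:set c. {..<count_list c v}"
  have J: "finite ?J" "card ?J = length c"
    by (simp_all add: sum_count_set)
  have E: "{m \<in> space (marks_law adj). \<forall>i\<in>?J. fst (m i) \<le> t} \<in> sets (marks_law adj)"
  proof (intro sets.sets_Collect_finite_All J(1))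
    fix i
    show "{m \<in> space (marks_law adj). fst (m i) \<le> t} \<in> sets (marks_law adj)" by measurable
  qed
  have "measure_pmf.prob (jump_law \<Lambda> t) {l. subseq c (map fst l)} =
     prob {m. jumps \<Lambda> t m \<in> {l. subseq c (map fst l)}}"
    by (rule prob_jump_law)
  also have "\<dots> \<le> prob {m. \<forall>i\<in>?J. fst (m i) \<le> t}"
  proof (rule finite_measure_mono_AE)
    show "AE m in marks_law adj. m \<in> {m. jumps \<Lambda> t m \<in> {l. subseq c (map fst l)}} \<longrightarrow>
        m \<in> {m. \<forall>i\<in>?J. fst (m i) \<le> t}"
      using AE_regular_marks
    proof eventually_elim
      case (elim m)
      obtain "is" where is1: "ring_trace \<Lambda> t m is" using ex_trace[OF elim assms(1)] by blast
      show ?case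
      proof (intro impI CollectI ballI)
        fix i assume "m \<in> {m. jumps \<Lambda> t m \<in> {l. subseq c (map fst l)}}" "i \<in> ?J"
        then show "fst (m i) \<le> t"
          using trace_count[OF elim is1, of c "snd i" "fst i"] by (auto simp: jumps_trace[OF is1] o_def)
      qed
    qed
    show "{m. \<forall>i\<in>?J. fst (m i) \<le> t} \<in> events" using E by simp
  qed
  also have "\<dots> = (1 - exp (- t)) ^ length c"
    using emeasure_first_marks_le[OF J(1) assms(2)] assms(2) unfolding J(2)
    by (simp add: emeasure_eq_measure)
  also have "\<dots> \<le> t ^ length c"
    using assms(2) one_minus_exp_bounds[of t] by (intro power_mono) auto
  finally show ?thesis .
qed

lemma prob_first_mark:
  assumes "0 \<le> t" "adj v w"
  shows "measure (marks_law adj) {m. fst (m (v, 0)) \<le> t \<and> snd (m (v, 0)) = w} = (1 - exp (- t)) / D"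
proof -
  interpret prob_space "marks_law adj" by (rule prob_space_marks_law)
  have "{m :: 'v marks. fst (m (v, 0)) \<le> t \<and> snd (m (v, 0)) = w} = {m. \<forall>i\<in>{(v, 0)}. m i \<in> {..t} \<times> {w}}"
    by (auto simp: mem_Times_iff)
  also have "emeasure (marks_law adj) \<dots> = (\<Prod>i\<in>{(v, 0 :: nat)}. emeasure (mark_law adj (fst i)) ({..t} \<times> {w}))"
    by (intro emeasure_marks_law_Collect) (auto simp: mark_law_eq sets_ring_law)
  also have "\<dots> = ennreal ((1 - exp (- t)) / D)"
    using assms
    by (simp add: mark_law_eq emeasure_ring_law_Times emeasure_exp_law_le emeasure_pmf_single pmf_step
        ennreal_mult[symmetric])
  finally show ?thesis using assms(1) by (simp add: Sigma_Algebra.measure_def)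
qed

lemma sets_first_mark: "{m. fst (m (v, 0)) \<le> t \<and> snd (m (v, 0)) = w} \<in> sets (marks_law adj)"
proof -
  have "{m \<in> space (marks_law adj). fst (m (v, 0)) \<le> t \<and> snd (m (v, 0)) = w} \<in> sets (marks_law adj)"
    by measurable
  then show ?thesis by simp
qed

text \<open>The first mark of v alone gives the jump with probability (1 - exp (-t)) / D; the error
  is rounded up to \<open>t\<^sup>2\<close> using D \<ge> 1.\<close>

lemma prob_jump_lower:
  assumes "finite \<Lambda>" "0 \<le> t" "adj v w" "v \<in> \<Lambda>" "w \<in> \<Lambda>"
  shows "t / D - t\<^sup>2 \<le> measure_pmf.prob (jump_law \<Lambda> t) {l. (v, w) \<in> set l}"
proof -
  interpret prob_space "marks_law adj" by (rule prob_space_marks_law)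
  have "t\<^sup>2 / D \<le> t\<^sup>2" using D_pos mult_right_mono[of 1 "real D" "t\<^sup>2"] by (simp add: field_simps)
  then have "t / D - t\<^sup>2 \<le> (t - t\<^sup>2) / D" by (simp add: diff_divide_distrib)
  also have "\<dots> \<le> (1 - exp (- t)) / D"
    using one_minus_exp_bounds[OF assms(2)] by (intro divide_right_mono) auto
  also have "\<dots> = prob {m. fst (m (v, 0)) \<le> t \<and> snd (m (v, 0)) = w}"
    using assms by (simp add: prob_first_mark)
  also have "\<dots> \<le> prob {m. jumps \<Lambda> t m \<in> {l. (v, w) \<in> set l}}"
  proof (rule finite_measure_mono_AE)
    show "AE m in marks_law adj. m \<in> {m. fst (m (v, 0)) \<le> t \<and> snd (m (v, 0)) = w} \<longrightarrow>
       m \<in> {m. jumps \<Lambda> t m \<in> {l. (v, w) \<in> set l}}"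
      using AE_regular_marks
    proof eventually_elim
      case (elim m)
      obtain "is" where is1: "ring_trace \<Lambda> t m is" using ex_trace[OF elim assms(1)] by blast
      have "(v, 0) \<in> set is" if "fst (m (v, 0)) \<le> t" "snd (m (v, 0)) = w"
        using is1 that assms(4,5) by (auto simp: ring_trace_def ring_at_def ring_time_def)
      then show ?case by (force simp: jumps_trace[OF is1])
    qed
    have "jumps \<Lambda> t -` {l. (v, w) \<in> set l} \<inter> space (marks_law adj) \<in> events"
      by (rule measurable_sets[OF measurable_jumps]) simp
    then show "{m. jumps \<Lambda> t m \<in> {l. (v, w) \<in> set l}} \<in> events" by (simp add: vimage_def)
  qed
  finally show ?thesis by (simp add: prob_jump_law)
qed

text \<open>If the jump is not made at the first ring of v, then v rings twice by time t and its
  first two waiting times are at most t.\<close>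

lemma prob_jump_upper:
  assumes "finite \<Lambda>" "0 \<le> t" "adj v w"
  shows "measure_pmf.prob (jump_law \<Lambda> t) {l. (v, w) \<in> set l} \<le> t / D + t\<^sup>2"
proof -
  interpret prob_space "marks_law adj" by (rule prob_space_marks_law)
  let ?J = "{(v, 0), (v, 1 :: nat)}"
  let ?A = "{m. fst (m (v, 0)) \<le> t \<and> snd (m (v, 0)) = w}" and ?B = "{m :: 'v marks. \<forall>i\<in>?J. fst (m i) \<le> t}"
  have "{m \<in> space (marks_law adj). \<forall>i\<in>?J. fst (m i) \<le> t} \<in> sets (marks_law adj)"
  proof (intro sets.sets_Collect_finite_All)
    fix i
    show "{m \<in> space (marks_law adj). fst (m i) \<le> t} \<in> sets (marks_law adj)" by measurable
  qed simp
  then have B: "?B \<in> events" by simp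
  have "prob {m. jumps \<Lambda> t m \<in> {l. (v, w) \<in> set l}} \<le> prob (?A \<union> ?B)"
  proof (rule finite_measure_mono_AE)
    show "AE m in marks_law adj. m \<in> {m. jumps \<Lambda> t m \<in> {l. (v, w) \<in> set l}} \<longrightarrow> m \<in> ?A \<union> ?B"
      using AE_regular_marks
    proof eventually_elim
      case (elim m)
      obtain "is" where is1: "ring_trace \<Lambda> t m is" using ex_trace[OF elim assms(1)] by blast
      have pos: "0 < fst (m i)" for i using elim unfolding regular_marks_def by blast
      show ?case
      proof
        assume "m \<in> {m. jumps \<Lambda> t m \<in> {l. (v, w) \<in> set l}}"
        then obtain n where n: "(v, n) \<in> set is" "w = snd (m (v, n))"
          by (auto simp: jumps_trace[OF is1])
        then have le: "ring_at m (v, n) \<le> t" using is1 by (simp add: ring_trace_def)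
        show "m \<in> ?A \<union> ?B"
        proof (cases n)
          case 0
          then show ?thesis using n le by (simp add: ring_at_def ring_time_def)
        next
          case (Suc k)
          have "fst (m (v, j)) \<le> ring_at m (v, n)" if "j \<le> 1" for j
            unfolding ring_at_def ring_time_def fst_conv snd_conv
            by (rule member_le_sum) (use Suc that pos in \<open>auto intro: less_imp_le\<close>)
          then show ?thesis using le by (force intro: order_trans)
        qed
      qed
    qed
    show "?A \<union> ?B \<in> events" using sets_first_mark B by auto
  qed
  also have "\<dots> \<le> prob ?A + prob ?B"
    using sets_first_mark B by (rule measure_Un_le)
  also have "prob ?A = (1 - exp (- t)) / D" using assms by (simp add: prob_first_mark)
  also have "prob ?B = (1 - exp (- t))\<^sup>2"
  proof -
    have "emeasure (marks_law adj) ?B = ennreal ((1 - exp (- t)) ^ card ?J)"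
      by (rule emeasure_first_marks_le) (use assms in auto)
    then show ?thesis using assms(2) by (simp add: emeasure_eq_measure power2_eq_square)
  qed
  also have "(1 - exp (- t)) / D + (1 - exp (- t))\<^sup>2 \<le> t / D + t\<^sup>2"
    using one_minus_exp_bounds[OF assms(2)] assms(2)
    by (intro add_mono divide_right_mono power_mono) auto
  finally show ?thesis by (simp add: prob_jump_law)
qed

section \<open>Invariance of the jump law under automorphisms\<close>

definition relabel :: "('v \<Rightarrow> 'v) \<Rightarrow> ('v \<Rightarrow> 'v) \<Rightarrow> 'v marks \<Rightarrow> 'v marks" where
  "relabel \<phi> \<psi> m = (\<lambda>i. map_prod id \<phi> (m (\<psi> (fst i), snd i)))"

text \<open>An automorphism carries uniform steps to uniform steps, so relabelled marks have the law
  of the original ones, and their traces are the images of the original traces.\<close>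

lemma jump_law_automorphism:
  assumes bij: "bij \<phi>" and aut: "\<And>a b. adj (\<phi> a) (\<phi> b) \<longleftrightarrow> adj a b" and "finite \<Lambda>"
  shows "jump_law (\<phi> ` \<Lambda>) t = map_pmf (map (map_prod \<phi> \<phi>)) (jump_law \<Lambda> t)"
proof -
  define \<psi> where "\<psi> = inv_into UNIV \<phi>"
  have \<psi>: "\<psi> (\<phi> a) = a" "\<phi> (\<psi> a) = a" for a
    using bij unfolding \<psi>_def by (simp_all add: bij_def surj_f_inv_f)
  have inj: "inj \<phi>" using bij by (simp add: bij_def)
  let ?Q = "marks_law adj" and ?T = "relabel \<phi> \<psi>"
  have mp: "map_prod id \<phi> \<in> borel \<Otimes>\<^sub>M count_space UNIV \<rightarrow>\<^sub>M borel \<Otimes>\<^sub>M (count_space UNIV :: 'v measure)"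
    unfolding map_prod_def split_def id_def
    by (intro measurable_Pair measurable_fst measurable_compose[OF measurable_snd]) simp
  have T [measurable]: "?T \<in> ?Q \<rightarrow>\<^sub>M ?Q"
  proof -
    have "(\<lambda>m. map_prod id \<phi> (m (\<psi> (fst i), snd i))) \<in> ?Q \<rightarrow>\<^sub>M mark_law adj (fst i)" for i :: "'v \<times> nat"
    proof -
      from measurable_compose[OF measurable_mark[of "(\<psi> (fst i), snd i)"] mp] show ?thesis
        unfolding mark_law_eq measurable_cong_sets[OF refl sets_ring_law] .
    qed
    then show ?thesis unfolding relabel_def[abs_def]
      by (subst (2) marks_law_def) (rule measurable_PiM_single', auto simp: space_PiM mark_law_eq)
  qed
  have step: "srw_step adj (\<phi> v) = map_pmf \<phi> (srw_step adj v)" for v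
  proof -
    have "nbrs adj (\<phi> v) = \<phi> ` nbrs adj v"
    proof (intro Set.set_eqI iffI)
      fix w assume "w \<in> nbrs adj (\<phi> v)"
      then have "adj v (\<psi> w)" using aut[of v "\<psi> w"] by (simp add: nbrs_def \<psi>)
      then show "w \<in> \<phi> ` nbrs adj v" using \<psi>(2)[of w] by (force simp: nbrs_def)
    qed (auto simp: nbrs_def aut)
    then show ?thesis unfolding srw_step_def
      by (simp add: map_pmf_of_set_inj[OF inj_on_subset[OF inj] nbrs_nonempty finite_nbrs])
  qed
  have law: "emeasure (mark_law adj (\<phi> v)) F = emeasure (mark_law adj v) {a. map_prod id \<phi> a \<in> F}"
    "{a. map_prod id \<phi> a \<in> F} \<in> sets (mark_law adj v)"
    if F: "F \<in> sets (mark_law adj (\<phi> v))" for v F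
  proof -
    have "F \<in> sets (borel \<Otimes>\<^sub>M count_space UNIV)"
      using F by (simp add: mark_law_eq sets_ring_law)
    from measurable_sets[OF mp this] show s: "{a. map_prod id \<phi> a \<in> F} \<in> sets (mark_law adj v)"
      by (simp add: mark_law_eq sets_ring_law space_pair_measure vimage_def)
    show "emeasure (mark_law adj (\<phi> v)) F = emeasure (mark_law adj v) {a. map_prod id \<phi> a \<in> F}"
      using F s unfolding mark_law_eq step by (simp add: emeasure_ring_law vimage_def)
  qed
  have TQ: "distr ?Q ?Q ?T = ?Q"
  proof -
    interpret product_prob_space "\<lambda>i :: 'v \<times> nat. mark_law adj (fst i)" UNIV
      by (rule product_prob_space_marks)
    have "distr ?Q ?Q ?T = (\<Pi>\<^sub>M i\<in>UNIV. mark_law adj (fst i))"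
    proof (rule PiM_eq)
      fix J :: "('v \<times> nat) set" and F
      assume J: "finite J" "\<And>j. j \<in> J \<Longrightarrow> F j \<in> sets (mark_law adj (fst j))"
      let ?E = "{m. \<forall>i\<in>J. m i \<in> F i}"
      have "{m \<in> space (\<Pi>\<^sub>M i\<in>UNIV. mark_law adj (fst i)). \<forall>i\<in>J. m i \<in> F i} \<in> sets (\<Pi>\<^sub>M i\<in>UNIV. mark_law adj (fst i))"
        using J by (intro sets.sets_Collect_finite_All sets_Collect_single') auto
      then have Es: "?E \<in> sets ?Q" by (simp add: marks_law_def[symmetric])
      let ?p = "\<lambda>i :: 'v \<times> nat. (\<psi> (fst i), snd i)"
      have injp: "inj_on ?p J"
        by (rule inj_onI) (metis \<psi>(2) prod.inject prod.collapse)
      let ?A = "\<lambda>i. {a. map_prod id \<phi> a \<in> F (\<phi> (fst i), snd i)}"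
      have As: "?A i \<in> sets (mark_law adj (fst i))" if "i \<in> ?p ` J" for i
        using that J(2) by (intro law(2)) (auto simp: \<psi>)
      have "emeasure (distr ?Q ?Q ?T) (prod_emb UNIV (\<lambda>i. mark_law adj (fst i)) J (Pi\<^sub>E J F)) =
         emeasure (distr ?Q ?Q ?T) ?E"
        by (auto intro!: arg_cong[where f = "emeasure _"] simp: prod_emb_def PiE_iff mark_law_eq)
      also have "\<dots> = emeasure ?Q (?T -` ?E \<inter> space ?Q)"
        by (rule emeasure_distr[OF T Es])
      also have "?T -` ?E \<inter> space ?Q = {m. \<forall>i\<in>?p ` J. m i \<in> ?A i}"
        by (auto simp: relabel_def \<psi>)
      also have "emeasure ?Q \<dots> = (\<Prod>i\<in>?p ` J. emeasure (mark_law adj (fst i)) (?A i))"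
        by (rule emeasure_marks_law_Collect) (use J(1) As in auto)
      also have "\<dots> = (\<Prod>i\<in>J. emeasure (mark_law adj (\<psi> (fst i))) (?A (?p i)))"
        using injp by (simp add: prod.reindex)
      also have "\<dots> = (\<Prod>i\<in>J. emeasure (mark_law adj (fst i)) (F i))"
      proof (rule prod.cong[OF refl])
        fix i assume "i \<in> J"
        then show "emeasure (mark_law adj (\<psi> (fst i))) (?A (?p i)) = emeasure (mark_law adj (fst i)) (F i)"
          using law(1)[of "F i" "\<psi> (fst i)"] J(2)[of i] by (simp add: \<psi>)
      qed
      finally show "emeasure (distr ?Q ?Q ?T) (prod_emb UNIV (\<lambda>i. mark_law adj (fst i)) J (Pi\<^sub>E J F)) =
        (\<Prod>i\<in>J. emeasure (mark_law adj (fst i)) (F i))" .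
    qed (simp add: marks_law_def)
    then show ?thesis by (simp only: marks_law_def[symmetric])
  qed
  have ring: "ring_at (?T m) (\<phi> v, n) = ring_at m (v, n)" for m v n
    by (simp add: ring_at_def ring_time_def relabel_def \<psi>)
  have jumps: "jumps (\<phi> ` \<Lambda>) t (?T m) = map (map_prod \<phi> \<phi>) (jumps \<Lambda> t m)"
    if m: "regular_marks adj m" for m
  proof -
    obtain "is" where is1: "ring_trace \<Lambda> t m is" using ex_trace[OF m \<open>finite \<Lambda>\<close>] by blast
    let ?q = "\<lambda>i :: 'v \<times> nat. (\<phi> (fst i), snd i)"
    have q: "ring_at (?T m) (?q i) = ring_at m i" "snd (?T m (?q i)) = \<phi> (snd (m i))" for i
      using ring[of m "fst i" "snd i"] by (simp_all add: relabel_def \<psi>)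
    have "ring_trace (\<phi> ` \<Lambda>) t (?T m) (map ?q is)"
      unfolding ring_trace_def
    proof
      show "sorted_wrt (\<lambda>i j. ring_at (?T m) i < ring_at (?T m) j) (map ?q is)"
        using is1 by (simp add: sorted_wrt_map q ring_trace_def)
      have "{i. fst i \<in> \<phi> ` \<Lambda> \<and> snd (?T m i) \<in> \<phi> ` \<Lambda> \<and> ring_at (?T m) i \<le> t} =
        ?q ` {i. fst i \<in> \<Lambda> \<and> snd (m i) \<in> \<Lambda> \<and> ring_at m i \<le> t}"
      proof (intro Set.set_eqI iffI)
        fix i assume i: "i \<in> {i. fst i \<in> \<phi> ` \<Lambda> \<and> snd (?T m i) \<in> \<phi> ` \<Lambda> \<and> ring_at (?T m) i \<le> t}"
        define j where "j = (\<psi> (fst i), snd i)"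
        have ij: "i = ?q j" by (simp add: j_def \<psi>)
        have "fst j \<in> \<Lambda> \<and> snd (m j) \<in> \<Lambda> \<and> ring_at m j \<le> t"
          using i inj unfolding ij q mem_Collect_eq by (auto simp: inj_image_mem_iff)
        then show "i \<in> ?q ` {i. fst i \<in> \<Lambda> \<and> snd (m i) \<in> \<Lambda> \<and> ring_at m i \<le> t}"
          unfolding ij by blast
      next
        fix i assume "i \<in> ?q ` {i. fst i \<in> \<Lambda> \<and> snd (m i) \<in> \<Lambda> \<and> ring_at m i \<le> t}"
        then obtain j where j: "i = ?q j" "fst j \<in> \<Lambda>" "snd (m j) \<in> \<Lambda>" "ring_at m j \<le> t" by blast
        then show "i \<in> {i. fst i \<in> \<phi> ` \<Lambda> \<and> snd (?T m i) \<in> \<phi> ` \<Lambda> \<and> ring_at (?T m) i \<le> t}"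
          unfolding j(1) mem_Collect_eq q by simp
      qed
      then show "set (map ?q is) = {i. fst i \<in> \<phi> ` \<Lambda> \<and> snd (?T m i) \<in> \<phi> ` \<Lambda> \<and> ring_at (?T m) i \<le> t}"
        using is1 by (simp add: ring_trace_def)
    qed
    then show ?thesis
      by (simp add: jumps_trace[OF is1] jumps_trace q o_def del: map_eq_conv)
  qed
  show ?thesis
  proof (rule pmf_eqI)
    fix l
    interpret prob_space ?Q by (rule prob_space_marks_law)
    have js: "{m. jumps \<Lambda> t m \<in> S} \<in> events" for S \<Lambda> t
      using measurable_sets[OF measurable_jumps, of S \<Lambda> t] by (simp add: vimage_def)
    have "pmf (jump_law (\<phi> ` \<Lambda>) t) l = measure ?Q {m. jumps (\<phi> ` \<Lambda>) t m \<in> {l}}"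
      by (simp only: measure_pmf_single[symmetric] prob_jump_law)
    also have "\<dots> = measure (distr ?Q ?Q ?T) {m. jumps (\<phi> ` \<Lambda>) t m \<in> {l}}"
      by (simp only: TQ)
    also have "\<dots> = measure ?Q (?T -` {m. jumps (\<phi> ` \<Lambda>) t m \<in> {l}} \<inter> space ?Q)"
      by (rule measure_distr[OF T js])
    also have "\<dots> = measure ?Q {m. jumps \<Lambda> t m \<in> map (map_prod \<phi> \<phi>) -` {l}}"
    proof (rule measure_eq_AE)
      show "AE m in ?Q. (m \<in> ?T -` {m. jumps (\<phi> ` \<Lambda>) t m \<in> {l}} \<inter> space ?Q) =
          (m \<in> {m. jumps \<Lambda> t m \<in> map (map_prod \<phi> \<phi>) -` {l}})"
        using AE_regular_marks by eventually_elim (simp add: jumps)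
      show "?T -` {m. jumps (\<phi> ` \<Lambda>) t m \<in> {l}} \<inter> space ?Q \<in> events"
        by (rule measurable_sets[OF T js])
    qed (rule js)
    also have "\<dots> = pmf (map_pmf (map (map_prod \<phi> \<phi>)) (jump_law \<Lambda> t)) l"
      by (simp only: pmf_map prob_jump_law)
    finally show "pmf (jump_law (\<phi> ` \<Lambda>) t) l = pmf (map_pmf (map (map_prod \<phi> \<phi>)) (jump_law \<Lambda> t)) l" .
  qed
qed

end


section \<open>Survival of backward clusters in a finite set\<close>

lemma integrable_pmf_bounded:
  fixes f :: "'a \<Rightarrow> real"
  assumes "\<And>x. x \<in> set_pmf p \<Longrightarrow> \<bar>f x\<bar> \<le> B"
  shows "integrable (measure_pmf p) f"
  by (rule measure_pmf.integrable_const_bound[where B = B]) (use assms in \<open>auto simp: AE_measure_pmf_iff\<close>)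

lemma expectation_pmf_mono:
  fixes f g :: "'a \<Rightarrow> real"
  assumes "\<And>x. x \<in> set_pmf p \<Longrightarrow> f x \<le> g x"
    and "\<And>x. x \<in> set_pmf p \<Longrightarrow> \<bar>f x\<bar> \<le> B" "\<And>x. x \<in> set_pmf p \<Longrightarrow> \<bar>g x\<bar> \<le> B'"
  shows "measure_pmf.expectation p f \<le> measure_pmf.expectation p g"
  by (rule integral_mono_AE) (use assms in \<open>auto simp: AE_measure_pmf_iff intro!: integrable_pmf_bounded\<close>)

lemma expectation_bind_pmf:
  fixes g :: "'a \<Rightarrow> real"
  assumes g: "\<And>x. 0 \<le> g x" "\<And>x. g x \<le> B"
  shows "measure_pmf.expectation (bind_pmf p q) g =
         measure_pmf.expectation p (\<lambda>a. measure_pmf.expectation (q a) g)"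
proof -
  have gb: "\<bar>g x\<bar> \<le> B" for x using g[of x] by simp
  have int: "integrable (measure_pmf r) g" for r
    by (rule integrable_pmf_bounded) (rule gb)
  have eb: "0 \<le> measure_pmf.expectation r g" "measure_pmf.expectation r g \<le> B" for r
  proof -
    show "0 \<le> measure_pmf.expectation r g" using g by (intro Bochner_Integration.integral_nonneg) auto
    have "measure_pmf.expectation r g \<le> measure_pmf.expectation r (\<lambda>_. B)"
      by (intro Bochner_Integration.integral_mono int g) auto
    then show "measure_pmf.expectation r g \<le> B" by simp
  qed
  have nn: "(\<integral>\<^sup>+x. ennreal (g x) \<partial>measure_pmf r) = ennreal (measure_pmf.expectation r g)" for r
    by (rule nn_integral_eq_integral[OF int]) (use g in auto)
  have "ennreal (measure_pmf.expectation (bind_pmf p q) g) =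
      (\<integral>\<^sup>+a. ennreal (measure_pmf.expectation (q a) g) \<partial>measure_pmf p)"
    by (simp add: nn[symmetric])
  also have "\<dots> = ennreal (measure_pmf.expectation p (\<lambda>a. measure_pmf.expectation (q a) g))"
    by (intro nn_integral_eq_integral integrable_pmf_bounded[where B = B]) (use eb in auto)
  finally show ?thesis
    using eb by (subst (asm) ennreal_inj) (auto intro!: Bochner_Integration.integral_nonneg)
qed

lemma prob_pmf_of_bool: "measure_pmf.prob p {l. P l} = measure_pmf.expectation p (\<lambda>l. of_bool (P l))"
proof -
  have "(\<lambda>l. of_bool (P l) :: real) = indicator {l. P l}" by (auto simp: indicator_def)
  then show ?thesis by simp
qed

lemma prob_mono_pmf:
  assumes "\<And>x. x \<in> set_pmf p \<Longrightarrow> x \<in> A \<Longrightarrow> x \<in> B"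
  shows "measure_pmf.prob p A \<le> measure_pmf.prob p B"
proof -
  have "measure_pmf.prob p A = measure_pmf.prob p (A \<inter> set_pmf p)"
    by (simp add: measure_Int_set_pmf)
  also have "\<dots> \<le> measure_pmf.prob p B"
    by (rule measure_pmf.finite_measure_mono) (use assms in auto)
  finally show ?thesis .
qed

text \<open>In the backward evolution a jump \<open>e\<close> adds the site \<open>fst e\<close> to a set containing \<open>snd e\<close> and
  removes it from a set not containing \<open>snd e\<close>; so it cannot enlarge both of two disjoint sets.\<close>

lemma vimage_move_opposite:
  fixes F G :: "'v set \<Rightarrow> real"
  assumes F: "\<And>A B. A \<subseteq> B \<Longrightarrow> F A \<le> F B" and G: "\<And>A B. A \<subseteq> B \<Longrightarrow> G A \<le> G B" and "B \<inter> C = {}"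
  shows "(F (move e -` B) - F B) * (G (move e -` C) - G C) \<le> 0"
proof -
  have "F B \<le> F (move e -` B) \<and> G (move e -` C) \<le> G C" if "snd e \<in> B"
    using that assms(3) by (auto simp: vimage_move intro!: F G)
  moreover have "F (move e -` B) \<le> F B \<and> G C \<le> G (move e -` C)" if "snd e \<in> C"
    using that assms(3) by (auto simp: vimage_move intro!: F G)
  moreover have "F (move e -` B) = F B \<or> G (move e -` C) = G C" if "snd e \<notin> B" "snd e \<notin> C"
  proof (cases "fst e \<in> B")
    case True
    then have "C - {fst e} = C" using assms(3) by auto
    then show ?thesis using that by (simp add: vimage_move)
  qed (use that in \<open>simp add: vimage_move\<close>)
  ultimately show ?thesis
    unfolding mult_le_0_iff by (cases "snd e \<in> B"; cases "snd e \<in> C") linarith+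
qed

context vertex_transitive_graph
begin

text \<open>Union bound over the \<open>card H ^ n\<close> possible sequences of the first n sources
  in H. It depends on H but not on \<Lambda>.\<close>

lemma prob_jumps_from:
  assumes "finite \<Lambda>" "0 \<le> t" "finite H"
  shows "measure_pmf.prob (jump_law \<Lambda> t) {l. n \<le> length (filter (\<lambda>e. fst e \<in> H) l)} \<le> (real (card H) * t) ^ n"
proof -
  let ?C = "{c. set c \<subseteq> H \<and> length c = n}"
  have C: "finite ?C" "card ?C = card H ^ n"
    using finite_lists_length_eq[OF assms(3)] card_lists_length_eq[OF assms(3)] by auto
  have "measure_pmf.prob (jump_law \<Lambda> t) {l. n \<le> length (filter (\<lambda>e. fst e \<in> H) l)} \<le>
     measure_pmf.prob (jump_law \<Lambda> t) (\<Union>c\<in>?C. {l. subseq c (map fst l)})"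
  proof (rule prob_mono_pmf)
    fix l assume "l \<in> {l. n \<le> length (filter (\<lambda>e. fst e \<in> H) l)}"
    then have n: "n \<le> length (filter (\<lambda>e. fst e \<in> H) l)" by simp
    define c where "c = take n (map fst (filter (\<lambda>e. fst e \<in> H) l))"
    have "subseq c (map fst l)"
      unfolding c_def take_map
      by (intro subseq_map) (meson subseq_filter_left subseq_order.trans prefix_imp_subseq take_is_prefix)
    moreover have "set c \<subseteq> H" unfolding c_def by (auto dest!: in_set_takeD)
    moreover have "length c = n" using n by (simp add: c_def)
    ultimately show "l \<in> (\<Union>c\<in>?C. {l. subseq c (map fst l)})" by blast
  qed
  also have "\<dots> \<le> (\<Sum>c\<in>?C. measure_pmf.prob (jump_law \<Lambda> t) {l. subseq c (map fst l)})"
    by (rule measure_pmf.finite_measure_subadditive_finite) (use C in auto)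
  also have "\<dots> \<le> (\<Sum>c\<in>?C. t ^ n)"
    by (intro sum_mono order_trans[OF prob_jump_law_subseq[OF assms(1,2)]]) auto
  also have "\<dots> = (real (card H) * t) ^ n" by (simp add: C(2) power_mult_distrib)
  finally show ?thesis .
qed

lemma filter_support:
  assumes "finite \<Lambda>" "l \<in> set_pmf (jump_law \<Lambda> t)"
  shows "filter (\<lambda>e. fst e \<in> \<Lambda>) l = l"
  using jump_law_subset(2)[OF assms] by (intro filter_True) auto

lemma prob_jumps_ge:
  assumes "finite \<Lambda>" "0 \<le> t"
  shows "measure_pmf.prob (jump_law \<Lambda> t) {l. n \<le> length l} \<le> (real (card \<Lambda>) * t) ^ n"
proof -
  have "measure_pmf.prob (jump_law \<Lambda> t) {l. n \<le> length l} \<le>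
      measure_pmf.prob (jump_law \<Lambda> t) {l. n \<le> length (filter (\<lambda>e. fst e \<in> \<Lambda>) l)}"
    by (rule prob_mono_pmf) (simp add: filter_support[OF assms(1)])
  also have "\<dots> \<le> (real (card \<Lambda>) * t) ^ n" by (rule prob_jumps_from) (use assms in auto)
  finally show ?thesis .
qed

lemma jump_law_0: "finite \<Lambda> \<Longrightarrow> jump_law \<Lambda> 0 = return_pmf []"
proof -
  assume "finite \<Lambda>"
  then have "measure_pmf.prob (jump_law \<Lambda> 0) {l. 1 \<le> length l} \<le> (real (card \<Lambda>) * 0) ^ 1"
    by (rule prob_jumps_ge) simp
  then have "measure_pmf.prob (jump_law \<Lambda> 0) {l. 1 \<le> length l} = 0"
    by (simp add: measure_le_0_iff)
  then have "set_pmf (jump_law \<Lambda> 0) \<inter> {l. 1 \<le> length l} = {}"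
    by (simp only: measure_pmf_zero_iff)
  then have "set_pmf (jump_law \<Lambda> 0) \<subseteq> {[]}" by (auto simp: Suc_le_eq)
  then show ?thesis by (simp only: set_pmf_subset_singleton)
qed

text \<open>The later block is integrated outermost, since it is the one that a backward cluster
  meets first.\<close>

lemma expectation_jump_law_add:
  fixes g :: "_ \<Rightarrow> real"
  assumes "finite \<Lambda>" "0 \<le> s" "0 \<le> t" "\<And>l. 0 \<le> g l" "\<And>l. g l \<le> B"
  shows "measure_pmf.expectation (jump_law \<Lambda> (s + t)) g =
     measure_pmf.expectation (jump_law \<Lambda> t) (\<lambda>b. measure_pmf.expectation (jump_law \<Lambda> s) (\<lambda>a. g (a @ b)))"
proof -
  have "jump_law \<Lambda> (s + t) = bind_pmf (jump_law \<Lambda> t) (\<lambda>b. map_pmf (\<lambda>a. a @ b) (jump_law \<Lambda> s))"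
    unfolding jump_law_add[OF assms(1-3)] map_pmf_def by (rule bind_commute_pmf)
  then show ?thesis by (simp add: expectation_bind_pmf[OF assms(4,5)])
qed

lemma prob_jump_law_add:
  assumes "finite \<Lambda>" "0 \<le> s" "0 \<le> t"
  shows "measure_pmf.prob (jump_law \<Lambda> (s + t)) {l. P l} =
     measure_pmf.expectation (jump_law \<Lambda> t) (\<lambda>b. measure_pmf.prob (jump_law \<Lambda> s) {a. P (a @ b)})"
proof -
  have "measure_pmf.prob (jump_law \<Lambda> (s + t)) {l. P l} =
      measure_pmf.expectation (jump_law \<Lambda> (s + t)) (\<lambda>l. of_bool (P l))"
    by (simp only: prob_pmf_of_bool)
  also have "\<dots> = measure_pmf.expectation (jump_law \<Lambda> t)
      (\<lambda>b. measure_pmf.expectation (jump_law \<Lambda> s) (\<lambda>a. of_bool (P (a @ b))))"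
    by (rule expectation_jump_law_add[OF assms, of _ 1]) auto
  also have "\<dots> = measure_pmf.expectation (jump_law \<Lambda> t) (\<lambda>b. measure_pmf.prob (jump_law \<Lambda> s) {a. P (a @ b)})"
    by (simp only: prob_pmf_of_bool)
  finally show ?thesis .
qed

text \<open>For a singleton this is the probability that the coalescing walk restricted to \<Lambda>
  occupies the site. General sets B arise from it by steps of the backward evolution.\<close>

definition survival :: "'v set \<Rightarrow> real \<Rightarrow> 'v set \<Rightarrow> real" where
  "survival \<Lambda> t B = measure_pmf.prob (jump_law \<Lambda> t) {l. flow l -` B \<noteq> {}}"

definition joint_survival :: "'v set \<Rightarrow> real \<Rightarrow> 'v set \<Rightarrow> 'v set \<Rightarrow> real" where
  "joint_survival \<Lambda> t B C = measure_pmf.prob (jump_law \<Lambda> t) {l. flow l -` B \<noteq> {} \<and> flow l -` C \<noteq> {}}"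

lemma survival_mono: "B \<subseteq> C \<Longrightarrow> survival \<Lambda> t B \<le> survival \<Lambda> t C"
  unfolding survival_def by (rule measure_pmf.finite_measure_mono) auto

lemma survival_bounds: "0 \<le> survival \<Lambda> t B" "survival \<Lambda> t B \<le> 1" "\<bar>survival \<Lambda> t B\<bar> \<le> 1"
  unfolding survival_def by auto

lemma survival_add:
  assumes "finite \<Lambda>" "0 \<le> s" "0 \<le> t"
  shows "survival \<Lambda> (s + t) B = measure_pmf.expectation (jump_law \<Lambda> t) (\<lambda>b. survival \<Lambda> s (flow b -` B))"
  unfolding survival_def by (simp add: prob_jump_law_add[OF assms] vimage_flow_append)

text \<open>Deviations are measured from the values F B and G C taken without jumps. A single jump
  moves the two in opposite directions by \<open>vimage_move_opposite\<close>, so the product of the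
  deviations is positive only for two or more jumps. The probability of these, and the product of
  the two mean deviations, are both of order \<delta>^2.\<close>

lemma one_step_correlation:
  fixes F G :: "'v set \<Rightarrow> real"
  assumes fin: "finite \<Lambda>" and \<delta>: "0 \<le> \<delta>"
    and F: "\<And>A B. A \<subseteq> B \<Longrightarrow> F A \<le> F B" "\<And>A. 0 \<le> F A" "\<And>A. F A \<le> 1"
    and G: "\<And>A B. A \<subseteq> B \<Longrightarrow> G A \<le> G B" "\<And>A. 0 \<le> G A" "\<And>A. G A \<le> 1"
    and "B \<inter> C = {}"
  shows "measure_pmf.expectation (jump_law \<Lambda> \<delta>) (\<lambda>l. F (flow l -` B) * G (flow l -` C)) \<le>
    measure_pmf.expectation (jump_law \<Lambda> \<delta>) (\<lambda>l. F (flow l -` B)) *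
    measure_pmf.expectation (jump_law \<Lambda> \<delta>) (\<lambda>l. G (flow l -` C)) + 2 * (real (card \<Lambda>) * \<delta>)\<^sup>2"
proof -
  let ?E = "measure_pmf.expectation (jump_law \<Lambda> \<delta>)" and ?P = "measure_pmf.prob (jump_law \<Lambda> \<delta>)"
  let ?X = "\<lambda>l. F (flow l -` B)" and ?Y = "\<lambda>l. G (flow l -` C)"
  let ?x = "F B" and ?y = "G C"
  have ab: "\<bar>F A\<bar> \<le> 1" "\<bar>G A\<bar> \<le> 1" "\<bar>F A - F A'\<bar> \<le> 1" "\<bar>G A - G A'\<bar> \<le> 1" for A A'
    using F(2,3)[of A] F(2,3)[of A'] G(2,3)[of A] G(2,3)[of A'] by auto
  have iX: "integrable (jump_law \<Lambda> \<delta>) ?X" and iY: "integrable (jump_law \<Lambda> \<delta>) ?Y"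
    by (rule integrable_pmf_bounded, rule ab)+
  have iXY: "integrable (jump_law \<Lambda> \<delta>) (\<lambda>l. ?X l * ?Y l)"
    by (rule integrable_pmf_bounded[where B = 1])
       (use F G in \<open>auto simp: abs_mult intro!: mult_le_one\<close>)
  have "?E (\<lambda>l. (?X l - ?x) * (?Y l - ?y)) = ?E (\<lambda>l. ?X l * ?Y l - ?y * ?X l - ?x * ?Y l + ?x * ?y)"
    by (simp add: algebra_simps)
  also have "\<dots> = ?E (\<lambda>l. ?X l * ?Y l) - ?y * ?E ?X - ?x * ?E ?Y + ?x * ?y"
    using iX iY iXY by simp
  \<comment> \<open>Centring at constants leaves the covariance unchanged, up to the product of the
    mean deviations.\<close>
  finally have cov: "?E (\<lambda>l. ?X l * ?Y l) - ?E ?X * ?E ?Y =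
      ?E (\<lambda>l. (?X l - ?x) * (?Y l - ?y)) - (?E ?X - ?x) * (?E ?Y - ?y)"
    by (simp add: algebra_simps)
  have "?E (\<lambda>l. (?X l - ?x) * (?Y l - ?y)) \<le> ?E (indicator {l. 2 \<le> length l})"
  proof (rule expectation_pmf_mono[where B = 1 and B' = 1])
    fix l
    show "\<bar>(?X l - ?x) * (?Y l - ?y)\<bar> \<le> 1"
      unfolding abs_mult by (rule mult_le_one) (use ab in auto)
    then have le1: "(?X l - ?x) * (?Y l - ?y) \<le> 1" by simp
    show "(?X l - ?x) * (?Y l - ?y) \<le> indicator {l. 2 \<le> length l} l"
    proof (cases "2 \<le> length l")
      case False
      then consider "l = []" | e where "l = [e]" by (cases l; cases "tl l") auto
      then show ?thesis
      proof cases
        case 2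
        have "(F (move e -` B) - F B) * (G (move e -` C) - G C) \<le> 0"
          by (rule vimage_move_opposite) (use F(1) G(1) assms(9) in auto)
        then show ?thesis using 2 by simp
      qed simp
    qed (use le1 in simp)
  qed (auto simp: indicator_def)
  also have "\<dots> = ?P {l. 2 \<le> length l}" by simp
  also have "\<dots> \<le> (real (card \<Lambda>) * \<delta>)\<^sup>2" using prob_jumps_ge[OF fin \<delta>, of 2] by simp
  finally have 1: "?E (\<lambda>l. (?X l - ?x) * (?Y l - ?y)) \<le> (real (card \<Lambda>) * \<delta>)\<^sup>2" .
  \<comment> \<open>A deviation is at most 1 and needs at least one jump.\<close>
  have dev: "\<bar>?E Z - z\<bar> \<le> real (card \<Lambda>) * \<delta>"
    if "\<And>l. \<bar>Z l - z\<bar> \<le> 1" "Z [] = z" "integrable (jump_law \<Lambda> \<delta>) Z" for Z :: "_ \<Rightarrow> real" and z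
  proof -
    have "\<bar>?E Z - z\<bar> = \<bar>?E (\<lambda>l. Z l - z)\<bar>" using that(3) by simp
    also have "\<dots> \<le> ?E (\<lambda>l. \<bar>Z l - z\<bar>)" by (rule integral_abs_bound)
    also have "\<dots> \<le> ?E (indicator {l. 1 \<le> length l})"
    proof (rule expectation_pmf_mono[where B = 1 and B' = 1])
      fix l
      show "\<bar>Z l - z\<bar> \<le> indicator {l. 1 \<le> length l} l"
        using that(1)[of l] that(2) by (cases l) auto
    qed (use that in \<open>auto simp: indicator_def\<close>)
    also have "\<dots> = ?P {l. 1 \<le> length l}" by simp
    also have "\<dots> \<le> real (card \<Lambda>) * \<delta>" using prob_jumps_ge[OF fin \<delta>, of 1] by simp
    finally show ?thesis .
  qed
  have "\<bar>(?E ?X - ?x) * (?E ?Y - ?y)\<bar> \<le> (real (card \<Lambda>) * \<delta>) * (real (card \<Lambda>) * \<delta>)"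
    unfolding abs_mult using \<delta>
    by (intro mult_mono dev) (use ab iX iY in auto)
  then have 2: "- (real (card \<Lambda>) * \<delta>)\<^sup>2 \<le> (?E ?X - ?x) * (?E ?Y - ?y)"
    by (simp add: power2_eq_square abs_le_iff)
  show ?thesis using cov 1 2 by linarith
qed

text \<open>The last step of length \<delta> replaces B and C by preimages, which are disjoint
  again. The induction hypothesis factors the joint survival of these,
  \<open>one_step_correlation\<close> factors the mean of the product, and the errors add
  up.\<close>

lemma joint_survival_steps:
  assumes fin: "finite \<Lambda>" and \<delta>: "0 \<le> \<delta>" and "B \<inter> C = {}"
  shows "joint_survival \<Lambda> (real n * \<delta>) B C \<le>
     survival \<Lambda> (real n * \<delta>) B * survival \<Lambda> (real n * \<delta>) C + real n * (2 * (real (card \<Lambda>) * \<delta>)\<^sup>2)"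
  using assms(3)
proof (induction n arbitrary: B C)
  case 0
  then show ?case by (simp add: joint_survival_def survival_def jump_law_0 fin indicator_def)
next
  case (Suc n)
  let ?E = "measure_pmf.expectation (jump_law \<Lambda> \<delta>)" and ?s = "real n * \<delta>" and ?K = "2 * (real (card \<Lambda>) * \<delta>)\<^sup>2"
  have s: "0 \<le> ?s" and eq: "real (Suc n) * \<delta> = ?s + \<delta>" using \<delta> by (auto simp: algebra_simps)
  have sb: "\<bar>survival \<Lambda> ?s A * survival \<Lambda> ?s A'\<bar> \<le> 1" for A A'
    unfolding abs_mult by (intro mult_le_one survival_bounds) (auto simp: survival_bounds)
  have "joint_survival \<Lambda> (real (Suc n) * \<delta>) B C = ?E (\<lambda>l. joint_survival \<Lambda> ?s (flow l -` B) (flow l -` C))"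
    unfolding joint_survival_def eq by (simp add: prob_jump_law_add[OF fin s \<delta>] vimage_flow_append)
  also have "\<dots> \<le> ?E (\<lambda>l. survival \<Lambda> ?s (flow l -` B) * survival \<Lambda> ?s (flow l -` C) + real n * ?K)"
  proof (rule expectation_pmf_mono[where B = 1 and B' = "1 + real n * ?K"])
    fix l
    show "joint_survival \<Lambda> ?s (flow l -` B) (flow l -` C) \<le>
        survival \<Lambda> ?s (flow l -` B) * survival \<Lambda> ?s (flow l -` C) + real n * ?K"
      by (rule Suc.IH) (use Suc.prems in auto)
    show "\<bar>joint_survival \<Lambda> ?s (flow l -` B) (flow l -` C)\<bar> \<le> 1"
      by (simp add: joint_survival_def)
    show "\<bar>survival \<Lambda> ?s (flow l -` B) * survival \<Lambda> ?s (flow l -` C) + real n * ?K\<bar> \<le> 1 + real n * ?K"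
      by (rule order_trans[OF abs_triangle_ineq]) (use sb in auto)
  qed
  also have "\<dots> = ?E (\<lambda>l. survival \<Lambda> ?s (flow l -` B) * survival \<Lambda> ?s (flow l -` C)) + real n * ?K"
    by (subst Bochner_Integration.integral_add) (auto intro!: integrable_pmf_bounded sb)
  also have "\<dots> \<le> ?E (\<lambda>l. survival \<Lambda> ?s (flow l -` B)) * ?E (\<lambda>l. survival \<Lambda> ?s (flow l -` C)) + ?K + real n * ?K"
    by (intro add_right_mono one_step_correlation fin \<delta> survival_mono survival_bounds Suc.prems)
  also have "\<dots> = survival \<Lambda> (real (Suc n) * \<delta>) B * survival \<Lambda> (real (Suc n) * \<delta>) C + real (Suc n) * ?K"
    unfolding eq survival_add[OF fin s \<delta>] by (simp add: algebra_simps)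
  finally show ?case .
qed

text \<open>With n steps of length t/n the total error is of order 1/n; its constant depends on
  \<Lambda>, which is fixed here.\<close>

theorem negative_correlation:
  assumes fin: "finite \<Lambda>" and t: "0 \<le> t" and "B \<inter> C = {}"
  shows "joint_survival \<Lambda> t B C \<le> survival \<Lambda> t B * survival \<Lambda> t C"
proof -
  let ?c = "2 * (real (card \<Lambda>) * t)\<^sup>2"
  have "joint_survival \<Lambda> t B C \<le> survival \<Lambda> t B * survival \<Lambda> t C + ?c / n" if "n > 0" for n :: nat
  proof -
    have "real n * (2 * (real (card \<Lambda>) * (t / n))\<^sup>2) = ?c / n" using that by (simp add: field_simps power2_eq_square)
    moreover have "real n * (t / n) = t" using that by simp
    ultimately show ?thesis
      using joint_survival_steps[OF fin _ assms(3), of "t / n" n] t by simp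
  qed
  then have "\<forall>\<^sub>F n in sequentially. joint_survival \<Lambda> t B C \<le> survival \<Lambda> t B * survival \<Lambda> t C + ?c / real n"
    by (intro eventually_sequentiallyI[of 1]) auto
  moreover have "(\<lambda>n. survival \<Lambda> t B * survival \<Lambda> t C + ?c / real n) \<longlonglongrightarrow> survival \<Lambda> t B * survival \<Lambda> t C + 0"
    by (intro tendsto_intros lim_const_over_n)
  ultimately show ?thesis
    by (intro tendsto_lowerbound[of _ "survival \<Lambda> t B * survival \<Lambda> t C" sequentially]) auto
qed

end


section \<open>Mean size of backward clusters\<close>

context vertex_transitive_graph
begin

lemma flow_vimage_support:
  assumes "finite \<Lambda>" "l \<in> set_pmf (jump_law \<Lambda> t)" "B \<subseteq> \<Lambda>"
  shows "flow l -` B \<subseteq> \<Lambda>"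
  using jump_law_subset(2)[OF assms(1,2)] assms(3) by (intro vimage_flow_subset) auto

text \<open>The jump occurs, minus the event of two jumps starting in H. Jumps that start elsewhere
  are unrestricted, so the error depends on the size of H and not on \<Lambda>; this keeps the local
  estimates meaningful as \<Lambda> grows.\<close>

lemma prob_single_jump_lower:
  assumes "finite \<Lambda>" "0 \<le> \<delta>" "adj v w" "v \<in> \<Lambda>" "w \<in> \<Lambda>" "finite H" "v \<in> H"
  shows "\<delta> / D - (1 + (real (card H))\<^sup>2) * \<delta>\<^sup>2 \<le>
    measure_pmf.prob (jump_law \<Lambda> \<delta>) {l. filter (\<lambda>e. fst e \<in> H) l = [(v, w)]}"
proof -
  let ?P = "measure_pmf.prob (jump_law \<Lambda> \<delta>)"
  let ?F = "\<lambda>l. filter (\<lambda>e. fst e \<in> H) l"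
  have "{l. (v, w) \<in> set l} \<subseteq> {l. ?F l = [(v, w)]} \<union> {l. 2 \<le> length (?F l)}"
  proof
    fix l assume "l \<in> {l. (v, w) \<in> set l}"
    then have "(v, w) \<in> set (?F l)" using assms(7) by simp
    then show "l \<in> {l. ?F l = [(v, w)]} \<union> {l. 2 \<le> length (?F l)}"
      by (cases "?F l"; cases "tl (?F l)") (auto simp del: set_filter)
  qed
  then have "?P {l. (v, w) \<in> set l} \<le> ?P ({l. ?F l = [(v, w)]} \<union> {l. 2 \<le> length (?F l)})"
    by (intro measure_pmf.finite_measure_mono) auto
  also have "\<dots> \<le> ?P {l. ?F l = [(v, w)]} + ?P {l. 2 \<le> length (?F l)}"
    by (rule measure_Un_le) auto
  finally show ?thesis
    using prob_jump_lower[OF assms(1-5)] prob_jumps_from[OF assms(1,2,6), of 2]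
    by (simp add: power_mult_distrib algebra_simps)
qed

text \<open>To first order every directed edge within \<Lambda> is used at rate 1/D, and reversing
  the edges exchanges gains and losses of B, so they cancel. The truncation at
  \<open>card \<Lambda>\<close> bounds the size for lists outside the support and changes nothing on
  the support.\<close>

lemma mean_one_step:
  fixes c :: real
  assumes fin: "finite \<Lambda>" and \<delta>: "0 \<le> \<delta>" and B: "B \<subseteq> \<Lambda>"
  defines "c \<equiv> real (card \<Lambda>)"
  shows "measure_pmf.expectation (jump_law \<Lambda> \<delta>) (\<lambda>l. real (min (card \<Lambda>) (card (flow l -` B)))) \<le>
    card B + (c\<^sup>2 * (1 + c\<^sup>2) + c ^ 3) * \<delta>\<^sup>2"
proof -
  let ?L = "jump_law \<Lambda> \<delta>"
  let ?E = "measure_pmf.expectation ?L" and ?P = "measure_pmf.prob ?L"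
  define ES where "ES = {e \<in> \<Lambda> \<times> \<Lambda>. adj (fst e) (snd e)}"
  have ES: "finite ES" "real (card ES) \<le> c\<^sup>2"
  proof -
    have sub: "ES \<subseteq> \<Lambda> \<times> \<Lambda>" by (auto simp: ES_def)
    show "finite ES" by (rule finite_subset[OF sub]) (use fin in auto)
    have "card ES \<le> card (\<Lambda> \<times> \<Lambda>)" by (rule card_mono[OF _ sub]) (use fin in auto)
    then show "real (card ES) \<le> c\<^sup>2"
      unfolding c_def power2_eq_square card_cartesian_product of_nat_mult[symmetric] of_nat_le_iff .
  qed
  \<comment> \<open>The change in the size of B caused by the jump \<open>e\<close>.\<close>
  define \<sigma> :: "'v \<times> 'v \<Rightarrow> real"
    where "\<sigma> e = of_bool (snd e \<in> B \<and> fst e \<notin> B) - of_bool (fst e \<in> B \<and> snd e \<notin> B)" for e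
  have finB: "finite B" using B fin by (rule finite_subset)
  have cB: "real (card B) \<le> c" unfolding c_def using card_mono[OF fin B] by simp
  have pt: "real (min (card \<Lambda>) (card (flow l -` B))) \<le>
      card B + (\<Sum>e\<in>ES. of_bool (l = [e]) * \<sigma> e) + c * of_bool (2 \<le> length l)"
    if l: "l \<in> set_pmf ?L" for l
  proof -
    consider "l = []" | e where "l = [e]" | "2 \<le> length l" by (cases l; cases "tl l") auto
    then show ?thesis
    proof cases
      case 1
      then show ?thesis by simp
    next
      case 2
      have e: "e \<in> ES"
        using jump_law_subset[OF fin l, of "fst e" "snd e"] 2 by (auto simp: ES_def mem_Times_iff)
      have "(\<Sum>e'\<in>ES. of_bool (l = [e']) * \<sigma> e') = (\<Sum>e'\<in>ES. if e' = e then \<sigma> e' else 0)"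
        using 2 by (intro sum.cong) auto
      then have s: "(\<Sum>e'\<in>ES. of_bool (l = [e']) * \<sigma> e') = \<sigma> e"
        using e ES(1) by simp
      have "real (card (move e -` B)) = card B + \<sigma> e"
      proof -
        have "0 < card B" if "fst e \<in> B" using that finB by (auto simp: card_gt_0_iff)
        then show ?thesis
          using finB by (auto simp: vimage_move \<sigma>_def insert_absorb of_nat_diff Suc_le_eq)
      qed
      then show ?thesis using 2 s by (simp add: min_def)
    next
      case 3
      then have "(\<Sum>e\<in>ES. of_bool (l = [e]) * \<sigma> e) = 0" by (intro sum.neutral) auto
      then show ?thesis using 3 by (simp add: c_def min_def)
    qed
  qed
  have \<sigma>b: "\<bar>\<sigma> e\<bar> \<le> 1" for e by (auto simp: \<sigma>_def)
  have "?E (\<lambda>l. real (min (card \<Lambda>) (card (flow l -` B)))) \<le>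
      ?E (\<lambda>l. card B + (\<Sum>e\<in>ES. of_bool (l = [e]) * \<sigma> e) + c * of_bool (2 \<le> length l))"
  proof (rule expectation_pmf_mono[OF pt, where B = c and B' = "c + card ES + c"])
    fix l
    show "\<bar>real (min (card \<Lambda>) (card (flow l -` B)))\<bar> \<le> c" by (simp add: c_def)
    have "\<bar>\<Sum>e\<in>ES. of_bool (l = [e]) * \<sigma> e\<bar> \<le> real (card ES)"
    proof -
      have "(\<Sum>e\<in>ES. \<bar>of_bool (l = [e]) * \<sigma> e\<bar>) \<le> (\<Sum>e\<in>ES. 1)"
        by (intro sum_mono) (use \<sigma>b in auto)
      also have "\<dots> = real (card ES)" by simp
      finally show ?thesis by (rule order_trans[OF sum_abs])
    qed
    moreover have "\<bar>c * of_bool (2 \<le> length l)\<bar> \<le> c" by (simp add: c_def)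
    ultimately show "\<bar>card B + (\<Sum>e\<in>ES. of_bool (l = [e]) * \<sigma> e) + c * of_bool (2 \<le> length l)\<bar>
        \<le> c + card ES + c"
      using cB by linarith
  qed auto
  also have "\<dots> = card B + (\<Sum>e\<in>ES. ?P {l. l = [e]} * \<sigma> e) + c * ?P {l. 2 \<le> length l}"
  proof -
    have i: "integrable ?L (\<lambda>l. of_bool (Q l) * x :: real)" "integrable ?L (\<lambda>l. x * of_bool (Q l) :: real)"
      for Q and x :: real
      by (rule integrable_pmf_bounded[where B = "\<bar>x\<bar>"], simp)+
    show ?thesis
      using i(1)[of _ 1] by (simp add: i prob_pmf_of_bool[symmetric])
  qed
  also have "(\<Sum>e\<in>ES. ?P {l. l = [e]} * \<sigma> e) \<le> (\<Sum>e\<in>ES. \<delta> / D * \<sigma> e + (1 + c\<^sup>2) * \<delta>\<^sup>2)"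
  proof (rule sum_mono)
    fix e assume e: "e \<in> ES"
    then have e': "adj (fst e) (snd e)" "fst e \<in> \<Lambda>" "snd e \<in> \<Lambda>" by (auto simp: ES_def)
    have "?P {l. l = [e]} \<le> ?P {l. (fst e, snd e) \<in> set l}" by (rule prob_mono_pmf) auto
    also have "\<dots> \<le> \<delta> / D + \<delta>\<^sup>2" by (rule prob_jump_upper[OF fin \<delta> e'(1)])
    finally have up: "?P {l. l = [e]} \<le> \<delta> / D + \<delta>\<^sup>2" .
    have "\<delta> / D - (1 + c\<^sup>2) * \<delta>\<^sup>2 \<le> ?P {l. filter (\<lambda>e. fst e \<in> \<Lambda>) l = [(fst e, snd e)]}"
      unfolding c_def by (rule prob_single_jump_lower) (use fin \<delta> e' in auto)
    also have "\<dots> \<le> ?P {l. l = [e]}"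
      by (rule prob_mono_pmf) (simp add: filter_support[OF fin])
    finally have lo: "\<delta> / D - (1 + c\<^sup>2) * \<delta>\<^sup>2 \<le> ?P {l. l = [e]}" .
    have "\<delta>\<^sup>2 \<le> (1 + c\<^sup>2) * \<delta>\<^sup>2" by (simp add: algebra_simps)
    moreover have "\<sigma> e = 1 \<or> \<sigma> e = 0 \<or> \<sigma> e = - 1" by (auto simp: \<sigma>_def)
    moreover have "0 \<le> (1 + c\<^sup>2) * \<delta>\<^sup>2" by simp
    \<comment> \<open>Replacing the probability p by a = \<delta> / D costs at most K, whatever the
      sign of s.\<close>
    moreover have "p * s \<le> a * s + K"
      if "p \<le> a + d" "a - K \<le> p" "d \<le> K" "s = 1 \<or> s = 0 \<or> s = - 1" "0 \<le> K" for p s a d K :: real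
      using that by auto
    ultimately show "?P {l. l = [e]} * \<sigma> e \<le> \<delta> / D * \<sigma> e + (1 + c\<^sup>2) * \<delta>\<^sup>2"
      using up lo by blast
  qed
  also have "\<dots> = \<delta> / D * (\<Sum>e\<in>ES. \<sigma> e) + card ES * ((1 + c\<^sup>2) * \<delta>\<^sup>2)"
    by (simp add: sum.distrib sum_distrib_left)
  also have "(\<Sum>e\<in>ES. \<sigma> e) = 0"
  proof -
    \<comment> \<open>Each edge is matched with its reverse, for which the change has the opposite
      sign.\<close>
    have bij: "bij_betw prod.swap ES ES"
      by (rule bij_betwI[of _ _ _ prod.swap]) (auto simp: ES_def adj_sym)
    have "(\<Sum>e\<in>ES. of_bool (fst e \<in> B \<and> snd e \<notin> B) :: real) =
        (\<Sum>e\<in>ES. of_bool (fst (prod.swap e) \<in> B \<and> snd (prod.swap e) \<notin> B))"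
      by (rule sum.reindex_bij_betw[OF bij, symmetric])
    then show ?thesis by (simp add: \<sigma>_def sum_subtractf)
  qed
  also have "\<delta> / D * 0 + card ES * ((1 + c\<^sup>2) * \<delta>\<^sup>2) \<le> c\<^sup>2 * ((1 + c\<^sup>2) * \<delta>\<^sup>2)"
    using ES(2) by (simp add: mult_right_mono)
  also have "?P {l. 2 \<le> length l} \<le> (c * \<delta>)\<^sup>2"
    unfolding c_def using prob_jumps_ge[OF fin \<delta>, of 2] by simp
  finally have "?E (\<lambda>l. real (min (card \<Lambda>) (card (flow l -` B)))) \<le>
      card B + c\<^sup>2 * ((1 + c\<^sup>2) * \<delta>\<^sup>2) + c * (c * \<delta>)\<^sup>2"
    by (simp add: c_def mult_left_mono)
  also have "\<dots> = card B + (c\<^sup>2 * (1 + c\<^sup>2) + c ^ 3) * \<delta>\<^sup>2"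
    by (simp add: algebra_simps power2_eq_square power3_eq_cube)
  finally show ?thesis .
qed

lemma mean_steps:
  fixes c :: real
  assumes fin: "finite \<Lambda>" and \<delta>: "0 \<le> \<delta>" and B: "B \<subseteq> \<Lambda>"
  defines "c \<equiv> real (card \<Lambda>)"
  shows "measure_pmf.expectation (jump_law \<Lambda> (real n * \<delta>)) (\<lambda>l. real (min (card \<Lambda>) (card (flow l -` B)))) \<le>
    card B + real n * ((c\<^sup>2 * (1 + c\<^sup>2) + c ^ 3) * \<delta>\<^sup>2)"
  using B
proof (induction n arbitrary: B)
  case 0
  then show ?case by (simp add: jump_law_0 fin)
next
  case (Suc n)
  let ?K = "(c\<^sup>2 * (1 + c\<^sup>2) + c ^ 3) * \<delta>\<^sup>2" and ?s = "real n * \<delta>"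
  let ?T = "\<lambda>B l. real (min (card \<Lambda>) (card (flow l -` B)))"
  have s: "0 \<le> ?s" and eq: "real (Suc n) * \<delta> = ?s + \<delta>" using \<delta> by (auto simp: algebra_simps)
  have K: "0 \<le> ?K" by (simp add: c_def)
  have "measure_pmf.expectation (jump_law \<Lambda> (real (Suc n) * \<delta>)) (?T B) =
     measure_pmf.expectation (jump_law \<Lambda> \<delta>) (\<lambda>b. measure_pmf.expectation (jump_law \<Lambda> ?s) (?T (flow b -` B)))"
    unfolding eq by (subst expectation_jump_law_add[OF fin s \<delta>, of _ "card \<Lambda>"]) (auto simp: vimage_flow_append)
  also have "\<dots> \<le> measure_pmf.expectation (jump_law \<Lambda> \<delta>) (\<lambda>b. ?T B b + real n * ?K)"
  proof (rule expectation_pmf_mono[where B = "c" and B' = "c + real n * ?K"])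
    fix b assume b: "b \<in> set_pmf (jump_law \<Lambda> \<delta>)"
    have sub: "flow b -` B \<subseteq> \<Lambda>" by (rule flow_vimage_support[OF fin b Suc.prems])
    have "?T B b = card (flow b -` B)" using card_mono[OF fin sub] by (simp add: min_def)
    then show "measure_pmf.expectation (jump_law \<Lambda> ?s) (?T (flow b -` B)) \<le> ?T B b + real n * ?K"
      using Suc.IH[OF sub] by simp
    have "measure_pmf.expectation (jump_law \<Lambda> ?s) (?T (flow b -` B)) \<le>
        measure_pmf.expectation (jump_law \<Lambda> ?s) (\<lambda>_. c)"
      by (rule expectation_pmf_mono[where B = c and B' = c]) (auto simp: c_def)
    moreover have "0 \<le> measure_pmf.expectation (jump_law \<Lambda> ?s) (?T (flow b -` B))"
      by (rule Bochner_Integration.integral_nonneg) simp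
    ultimately show "\<bar>measure_pmf.expectation (jump_law \<Lambda> ?s) (?T (flow b -` B))\<bar> \<le> c" by simp
    have "\<bar>?T B b\<bar> \<le> c" by (simp add: c_def)
    then show "\<bar>?T B b + real n * ?K\<bar> \<le> c + real n * ?K"
      using K by (simp add: abs_of_nonneg)
  qed
  also have "\<dots> = measure_pmf.expectation (jump_law \<Lambda> \<delta>) (?T B) + real n * ?K"
    by (subst Bochner_Integration.integral_add) (auto intro!: integrable_pmf_bounded[where B = c] simp: c_def)
  also have "\<dots> \<le> card B + ?K + real n * ?K"
    using mean_one_step[OF fin \<delta> Suc.prems] by (simp add: c_def)
  also have "\<dots> = card B + real (Suc n) * ?K" by (simp add: algebra_simps)
  finally show ?case .
qed

lemma mean_cluster:
  assumes fin: "finite \<Lambda>" and t: "0 \<le> t" and B: "B \<subseteq> \<Lambda>"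
  shows "measure_pmf.expectation (jump_law \<Lambda> t) (\<lambda>l. real (min (card \<Lambda>) (card (flow l -` B)))) \<le> card B"
    (is "?m \<le> _")
proof -
  define c where "c = real (card \<Lambda>)"
  let ?c = "(c\<^sup>2 * (1 + c\<^sup>2) + c ^ 3) * t\<^sup>2"
  have "?m \<le> card B + ?c / n" if "n > 0" for n :: nat
  proof -
    have "real n * ((c\<^sup>2 * (1 + c\<^sup>2) + c ^ 3) * (t / n)\<^sup>2) = ?c / n"
      using that by (simp add: power_divide power2_eq_square[of "real n"])
    moreover have "real n * (t / n) = t" using that by simp
    ultimately show ?thesis
      using mean_steps[OF fin _ B, of "t / n" n] t by (simp add: c_def)
  qed
  then have "\<forall>\<^sub>F n in sequentially. ?m \<le> card B + ?c / real n"
    by (intro eventually_sequentiallyI[of 1]) auto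
  moreover have "(\<lambda>n. real (card B) + ?c / real n) \<longlonglongrightarrow> real (card B) + 0"
    by (intro tendsto_intros lim_const_over_n)
  ultimately show ?thesis
    by (intro tendsto_lowerbound[of _ "real (card B)" sequentially]) auto
qed

text \<open>Markov's inequality for the cluster of one site, whose mean size is at most 1; uniform
  in t and \<Lambda>.\<close>

lemma prob_large_cluster:
  assumes fin: "finite \<Lambda>" and t: "0 \<le> t" and x: "x \<in> \<Lambda>"
  shows "real J * measure_pmf.prob (jump_law \<Lambda> t) {l. J \<le> card (flow l -` {x})} \<le> 1"
proof -
  have "real J * measure_pmf.prob (jump_law \<Lambda> t) {l. J \<le> card (flow l -` {x})} =
     measure_pmf.expectation (jump_law \<Lambda> t) (\<lambda>l. real J * of_bool (J \<le> card (flow l -` {x})))"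
    by (simp add: prob_pmf_of_bool)
  also have "\<dots> \<le> measure_pmf.expectation (jump_law \<Lambda> t) (\<lambda>l. real (min (card \<Lambda>) (card (flow l -` {x}))))"
  proof (rule expectation_pmf_mono[where B = J and B' = "card \<Lambda>"])
    fix l assume l: "l \<in> set_pmf (jump_law \<Lambda> t)"
    have "card (flow l -` {x}) \<le> card \<Lambda>"
      by (rule card_mono[OF fin flow_vimage_support[OF fin l]]) (use x in auto)
    then show "real J * of_bool (J \<le> card (flow l -` {x})) \<le> real (min (card \<Lambda>) (card (flow l -` {x})))"
      by (auto simp: min_def)
  qed auto
  also have "\<dots> \<le> card {x}" by (rule mean_cluster) (use assms in auto)
  finally show ?thesis by simp
qed


section \<open>Local estimates\<close>

text \<open>Inclusion and exclusion, with \<open>negative_correlation\<close> bounding the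
  probability that both sites survive.\<close>

lemma survival_pair:
  assumes "finite \<Lambda>" "0 \<le> t" "x \<noteq> v"
  shows "survival \<Lambda> t {x} + survival \<Lambda> t {v} - survival \<Lambda> t {x} * survival \<Lambda> t {v} \<le> survival \<Lambda> t {x, v}"
proof -
  let ?L = "measure_pmf (jump_law \<Lambda> t)"
  let ?A = "{l. flow l -` {x} \<noteq> {}}" and ?B = "{l. flow l -` {v} \<noteq> {}}"
  have "measure ?L (?A \<union> ?B) = measure ?L ?A + measure ?L ?B - measure ?L (?A \<inter> ?B)"
    by (rule measure_Un3) (auto simp: fmeasurable_def measure_pmf.emeasure_eq_measure)
  moreover have "?A \<union> ?B = {l. flow l -` {x, v} \<noteq> {}}" by auto
  moreover have "?A \<inter> ?B = {l. flow l -` {x} \<noteq> {} \<and> flow l -` {v} \<noteq> {}}" by auto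
  ultimately have "survival \<Lambda> t {x, v} = survival \<Lambda> t {x} + survival \<Lambda> t {v} - joint_survival \<Lambda> t {x} {v}"
    by (simp add: survival_def joint_survival_def)
  moreover have "joint_survival \<Lambda> t {x} {v} \<le> survival \<Lambda> t {x} * survival \<Lambda> t {v}"
    by (rule negative_correlation) (use assms in auto)
  ultimately show ?thesis by linarith
qed

text \<open>The first D collects the errors for jumps of the D neighbours to x in the event that x
  is left alone; the other term has D single-jump errors, each for a set H of at most D + 1
  sites.\<close>

definition local_const :: real where
  "local_const = D + D * (1 + (real D + 1)\<^sup>2)"

text \<open>Condition on the last stretch of length \<delta>. If x is left alone, {x} still has to
  survive for time t; if only a neighbour v jumps to x, {x, v} has to; other lists contribute at
  least 0. Survival of the pair is bounded below by \<open>survival_pair\<close>.\<close>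

lemma survival_increment:
  assumes fin: "finite \<Lambda>" and t: "0 \<le> t" and \<delta>: "0 \<le> \<delta>" and sub: "graph_ball x 1 \<subseteq> \<Lambda>"
  shows "(1 - \<delta>) * survival \<Lambda> t {x} +
      \<delta> / D * (1 - survival \<Lambda> t {x}) * (\<Sum>v\<in>nbrs adj x. survival \<Lambda> t {v}) - local_const * \<delta>\<^sup>2
      \<le> survival \<Lambda> (t + \<delta>) {x}"
proof -
  let ?L = "jump_law \<Lambda> \<delta>"
  let ?E = "measure_pmf.expectation ?L" and ?P = "measure_pmf.prob ?L"
  let ?S = "survival \<Lambda> t" and ?N = "nbrs adj x"
  define H where "H = insert x ?N"
  have H: "finite H" "card H \<le> D + 1" "H \<subseteq> \<Lambda>"
    using finite_nbrs[of x] card_nbrs[of x] sub by (auto simp: H_def card_insert_if)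
  let ?F = "\<lambda>l. filter (\<lambda>e. fst e \<in> H) l"
  define G0 where "G0 l \<longleftrightarrow> x \<notin> fst ` set l \<and> (\<forall>v\<in>?N. (v, x) \<notin> set l)" for l :: "('v \<times> 'v) list"
  \<comment> \<open>The only jump starting at x or at a neighbour goes from v to x. Jumps that start
    farther away move neither x nor v, so both end at x.\<close>
  define G where "G v l \<longleftrightarrow> ?F l = [(v, x)]" for v l
  have xN: "x \<notin> ?N" using adj_irrefl by (simp add: nbrs_def)
  have pt: "of_bool (G0 l) * ?S {x} + (\<Sum>v\<in>?N. of_bool (G v l) * ?S {x, v}) \<le> ?S (flow l -` {x})" for l
  proof (cases "\<exists>v\<in>?N. G v l")
    case True
    then obtain v where v: "v \<in> ?N" "G v l" by blast
    have "(v, x) \<in> set (?F l)" using v by (simp add: G_def del: set_filter)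
    then have "(v, x) \<in> set l" by simp
    then have "\<not> G0 l" using v by (auto simp: G0_def)
    moreover have "(\<Sum>u\<in>?N. of_bool (G u l) * ?S {x, u}) = (\<Sum>u\<in>?N. if u = v then ?S {x, u} else 0)"
      using v by (intro sum.cong) (auto simp: G_def)
    moreover have "\<dots> = ?S {x, v}" using v finite_nbrs by simp
    moreover have "?S {x, v} \<le> ?S (flow l -` {x})"
    proof (rule survival_mono)
      from split_list[OF \<open>(v, x) \<in> set l\<close>] obtain a b where l: "l = a @ (v, x) # b" by blast
      have "(v, x) # (?F a @ ?F b) = [(v, x)] \<or> ?F a @ (v, x) # ?F b = [(v, x)]"
        using v unfolding G_def l by (simp add: H_def)
      then have ab: "?F a = []" "?F b = []" by (auto simp: append_eq_Cons_conv)
      have a: "u \<notin> H" if "(u, w) \<in> set a" for u w using ab(1) that by (force simp: filter_empty_conv)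
      have b: "u \<notin> H" if "(u, w) \<in> set b" for u w using ab(2) that by (force simp: filter_empty_conv)
      have fa: "flow a z = z" if "z \<in> H" for z by (rule flow_fixed) (use a that in blast)
      have fb: "flow b z = z" if "z \<in> H" for z by (rule flow_fixed) (use b that in blast)
      have "x \<in> H" "v \<in> H" "x \<noteq> v" using v xN by (auto simp: H_def)
      then show "{x, v} \<subseteq> flow l -` {x}"
        unfolding l by (auto simp: flow_append flow_Cons fa fb move_def)
    qed
    ultimately show ?thesis by simp
  next
    case False
    then have s: "(\<Sum>v\<in>?N. of_bool (G v l) * ?S {x, v}) = 0" by (intro sum.neutral) auto
    show ?thesis
    proof (cases "G0 l")
      case True
      have "flow l x = x" by (rule flow_fixed) (use True in \<open>force simp: G0_def\<close>)
      then have "?S {x} \<le> ?S (flow l -` {x})" by (intro survival_mono) auto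
      then show ?thesis using s True by simp
    next
      case False
      then show ?thesis using s survival_bounds by simp
    qed
  qed
  \<comment> \<open>One \<delta> for a ring at x, and D times \<delta> / D for the jumps of
    neighbours to x.\<close>
  have P0: "1 - 2 * \<delta> - D * \<delta>\<^sup>2 \<le> ?P {l. G0 l}"
  proof -
    have "?P (- {l. G0 l}) \<le> ?P ({l. subseq [x] (map fst l)} \<union> (\<Union>v\<in>?N. {l. (v, x) \<in> set l}))"
      by (intro measure_pmf.finite_measure_mono) (auto simp: G0_def subseq_singleton_left)
    also have "\<dots> \<le> ?P {l. subseq [x] (map fst l)} + ?P (\<Union>v\<in>?N. {l. (v, x) \<in> set l})"
      by (rule measure_Un_le) auto
    also have "\<dots> \<le> \<delta> + (\<Sum>v\<in>?N. \<delta> / D + \<delta>\<^sup>2)"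
    proof (rule add_mono)
      show "?P {l. subseq [x] (map fst l)} \<le> \<delta>"
        using prob_jump_law_subseq[OF fin \<delta>, of "[x]"] by simp
      have "?P (\<Union>v\<in>?N. {l. (v, x) \<in> set l}) \<le> (\<Sum>v\<in>?N. ?P {l. (v, x) \<in> set l})"
        by (rule measure_pmf.finite_measure_subadditive_finite) (auto simp: finite_nbrs)
      also have "\<dots> \<le> (\<Sum>v\<in>?N. \<delta> / D + \<delta>\<^sup>2)"
        by (intro sum_mono prob_jump_upper[OF fin \<delta>]) (auto simp: nbrs_def adj_sym)
      finally show "?P (\<Union>v\<in>?N. {l. (v, x) \<in> set l}) \<le> (\<Sum>v\<in>?N. \<delta> / D + \<delta>\<^sup>2)" .
    qed
    also have "\<dots> = 2 * \<delta> + D * \<delta>\<^sup>2"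
      using D_pos by (simp add: card_nbrs field_simps)
    finally show ?thesis
      using measure_pmf.prob_compl[of "{l. G0 l}" ?L] by (simp add: Compl_eq_Diff_UNIV)
  qed
  have PG: "\<delta> / D - (1 + (real D + 1)\<^sup>2) * \<delta>\<^sup>2 \<le> ?P {l. G v l}" if "v \<in> ?N" for v
  proof -
    have "\<delta> / D - (1 + (real (card H))\<^sup>2) * \<delta>\<^sup>2 \<le> ?P {l. G v l}"
      unfolding G_def using that H sub
      by (intro prob_single_jump_lower fin \<delta>) (auto simp: H_def nbrs_def adj_sym)
    moreover have "(1 + (real (card H))\<^sup>2) * \<delta>\<^sup>2 \<le> (1 + (real D + 1)\<^sup>2) * \<delta>\<^sup>2"
      using H(2) by (intro mult_right_mono add_left_mono power_mono) auto
    ultimately show ?thesis by linarith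
  qed
  have drop: "a * s - K \<le> p * s" if "a - K \<le> p" "0 \<le> s" "s \<le> 1" "0 \<le> K" for a K p s :: real
  proof -
    have "(a - K) * s \<le> p * s" using that by (intro mult_right_mono)
    moreover have "K * s \<le> K" using that by (simp add: mult_left_le)
    ultimately show ?thesis by (simp add: algebra_simps)
  qed
  have "(1 - 2 * \<delta>) * ?S {x} - D * \<delta>\<^sup>2 +
      (\<Sum>v\<in>?N. \<delta> / D * (?S {x} + ?S {v} - ?S {x} * ?S {v}) - (1 + (real D + 1)\<^sup>2) * \<delta>\<^sup>2)
      \<le> ?P {l. G0 l} * ?S {x} + (\<Sum>v\<in>?N. ?P {l. G v l} * ?S {x, v})"
  proof (intro add_mono sum_mono)
    show "(1 - 2 * \<delta>) * ?S {x} - D * \<delta>\<^sup>2 \<le> ?P {l. G0 l} * ?S {x}"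
      by (rule drop) (use P0 survival_bounds in auto)
    fix v assume v: "v \<in> ?N"
    have "\<delta> / D * (?S {x} + ?S {v} - ?S {x} * ?S {v}) \<le> \<delta> / D * ?S {x, v}"
      using survival_pair[OF fin t, of x v] v xN \<delta> by (intro mult_left_mono) auto
    also have "\<delta> / D * ?S {x, v} - (1 + (real D + 1)\<^sup>2) * \<delta>\<^sup>2 \<le> ?P {l. G v l} * ?S {x, v}"
      by (rule drop[OF PG[OF v]]) (use survival_bounds in auto)
    finally show "\<delta> / D * (?S {x} + ?S {v} - ?S {x} * ?S {v}) - (1 + (real D + 1)\<^sup>2) * \<delta>\<^sup>2
        \<le> ?P {l. G v l} * ?S {x, v}" by simp
  qed
  also have "\<dots> = ?E (\<lambda>l. of_bool (G0 l) * ?S {x} + (\<Sum>v\<in>?N. of_bool (G v l) * ?S {x, v}))"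
  proof -
    have i: "integrable ?L (\<lambda>l. of_bool (Q l) * s :: real)" for Q and s :: real
      by (rule integrable_pmf_bounded[where B = "\<bar>s\<bar>"]) simp
    show ?thesis using i[of _ 1] by (simp add: i prob_pmf_of_bool)
  qed
  also have "\<dots> \<le> ?E (\<lambda>l. ?S (flow l -` {x}))"
  proof (rule expectation_pmf_mono[OF pt, where B = "1 + D" and B' = 1])
    fix l
    have "(\<Sum>v\<in>?N. of_bool (G v l) * ?S {x, v}) \<le> (\<Sum>v\<in>?N. 1)"
      by (intro sum_mono) (auto simp: survival_bounds)
    moreover have "0 \<le> (\<Sum>v\<in>?N. of_bool (G v l) * ?S {x, v})"
      by (intro sum_nonneg) (auto simp: survival_bounds)
    moreover have "0 \<le> of_bool (G0 l) * ?S {x}" "of_bool (G0 l) * ?S {x} \<le> 1"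
      by (auto simp: survival_bounds)
    ultimately show "\<bar>of_bool (G0 l) * ?S {x} + (\<Sum>v\<in>?N. of_bool (G v l) * ?S {x, v})\<bar> \<le> 1 + D"
      by (simp add: card_nbrs)
  qed (rule survival_bounds)
  also have "\<dots> = survival \<Lambda> (t + \<delta>) {x}" by (rule survival_add[OF fin t \<delta>, symmetric])
  also have "(1 - 2 * \<delta>) * ?S {x} - D * \<delta>\<^sup>2 +
      (\<Sum>v\<in>?N. \<delta> / D * (?S {x} + ?S {v} - ?S {x} * ?S {v}) - (1 + (real D + 1)\<^sup>2) * \<delta>\<^sup>2) =
      (1 - \<delta>) * ?S {x} + \<delta> / D * (1 - ?S {x}) * (\<Sum>v\<in>?N. ?S {v}) - local_const * \<delta>\<^sup>2"
  proof -
    \<comment> \<open>The D terms with \<delta> / D times the survival of {x} give back one \<delta>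
      of the loss 2 \<delta>.\<close>
    have main: "(\<Sum>v\<in>?N. \<delta> / D * (?S {x} + ?S {v} - ?S {x} * ?S {v})) =
       \<delta> * ?S {x} + \<delta> / D * (1 - ?S {x}) * (\<Sum>v\<in>?N. ?S {v})"
    proof -
      have eq: "(\<Sum>v\<in>?N. ?S {x} + ?S {v} - ?S {x} * ?S {v}) = D * ?S {x} + (1 - ?S {x}) * (\<Sum>v\<in>?N. ?S {v})"
        unfolding sum.distrib sum_subtractf sum_distrib_left[symmetric]
        by (simp add: card_nbrs left_diff_distrib)
      show ?thesis
        unfolding sum_distrib_left[symmetric] eq using D_pos by (simp add: field_simps)
    qed
    show ?thesis
      by (subst sum_subtractf, subst main) (simp add: card_nbrs local_const_def algebra_simps)
  qed
  finally show ?thesis .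
qed

section \<open>Loss of a site by a backward cluster\<close>

lemma vimage_flow_isolated:
  assumes "\<And>a b. (a, b) \<in> set l \<Longrightarrow> adj a b"
    and "filter (\<lambda>e. fst e \<in> A \<union> (\<Union>y\<in>A. nbrs adj y)) l = []"
  shows "flow l -` A = A"
  using assms
proof (induction l)
  case (Cons e l)
  have e: "adj (fst e) (snd e)" "fst e \<notin> A \<union> (\<Union>y\<in>A. nbrs adj y)"
    using Cons.prems(1)[of "fst e" "snd e"] Cons.prems(2) by (auto split: if_splits)
  then have "snd e \<notin> A" using adj_sym by (auto simp: nbrs_def)
  then have "move e -` A = A" using e by (auto simp: vimage_move)
  moreover have "flow l -` A = A" using Cons by (auto split: if_splits)
  ultimately show ?case by simp
qed simp

text \<open>Only jumps that start in A or next to it can affect A or a subset of it. The single such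
  jump leads out of A and removes its source; all others leave the cluster as it is.\<close>

lemma vimage_flow_loss:
  assumes "\<And>a b. (a, b) \<in> set l \<Longrightarrow> adj a b"
    and "filter (\<lambda>e. fst e \<in> A \<union> (\<Union>y\<in>A. nbrs adj y)) l = [(v, w)]" "v \<in> A" "w \<notin> A"
  shows "flow l -` A = A - {v}"
  using assms(1,2)
proof (induction l)
  case (Cons e l)
  let ?H = "A \<union> (\<Union>y\<in>A. nbrs adj y)"
  have ae: "adj (fst e) (snd e)" using Cons.prems(1)[of "fst e" "snd e"] by simp
  show ?case
  proof (cases "fst e \<in> ?H")
    case True
    then have "e = (v, w)" "filter (\<lambda>e. fst e \<in> ?H) l = []" using Cons.prems(2) by auto
    then show ?thesis
      using vimage_flow_isolated[of l A] Cons.prems(1) assms(4) by (auto simp: vimage_move)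
  next
    case False
    then have "filter (\<lambda>e. fst e \<in> ?H) l = [(v, w)]" using Cons.prems(2) by auto
    then have "flow l -` A = A - {v}" using Cons by auto
    moreover have "snd e \<notin> A" using False ae adj_sym by (auto simp: nbrs_def)
    ultimately show ?thesis using False by (auto simp: vimage_move)
  qed
qed simp

lemma ball_path: "y \<in> graph_ball x k \<Longrightarrow> (\<lambda>a b. adj a b \<and> a \<in> graph_ball x k \<and> b \<in> graph_ball x k)\<^sup>*\<^sup>* x y"
proof (induction k arbitrary: y)
  case (Suc k)
  have mono: "(\<lambda>a b. adj a b \<and> a \<in> graph_ball x (Suc k) \<and> b \<in> graph_ball x (Suc k))\<^sup>*\<^sup>* x z" if "z \<in> graph_ball x k" for z
    by (rule rtranclp_mono[THEN predicate2D, OF _ Suc.IH[OF that]]) auto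
  from Suc.prems consider "y \<in> graph_ball x k" | z where "z \<in> graph_ball x k" "adj z y" by (auto simp: nbrs_def)
  then show ?case
  proof cases
    case 2
    have "adj z y \<and> z \<in> graph_ball x (Suc k) \<and> y \<in> graph_ball x (Suc k)"
      using 2 Suc.prems by simp
    with mono[OF 2(1)] show ?thesis by (rule rtranclp.rtrancl_into_rtrancl)
  qed (rule mono)
qed simp

lemma rtranclp_crossing: "r\<^sup>*\<^sup>* a b \<Longrightarrow> P a \<Longrightarrow> \<not> P b \<Longrightarrow> \<exists>c d. r c d \<and> P c \<and> \<not> P d"
  by (induction rule: rtranclp_induct) blast+

text \<open>The ball is connected by paths inside it. The neighbour outside A has to lie in the ball
  as well, since only jumps within the finite set are recorded.\<close>

lemma ball_boundary:
  assumes "A \<subseteq> graph_ball x k" "A \<noteq> {}" "A \<noteq> graph_ball x k"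
  obtains v w where "v \<in> A" "w \<in> graph_ball x k - A" "adj v w"
proof (cases "x \<in> A")
  case True
  obtain y where y: "y \<in> graph_ball x k" "y \<notin> A" using assms by blast
  from rtranclp_crossing[OF ball_path[OF y(1)], of "\<lambda>z. z \<in> A"] True y(2)
  show ?thesis using that by blast
next
  case False
  obtain y where y: "y \<in> A" using assms by blast
  then have "y \<in> graph_ball x k" using assms by blast
  from rtranclp_crossing[OF ball_path[OF this], of "\<lambda>z. z \<notin> A"] False y
  show ?thesis using that adj_sym by blast
qed

text \<open>The time \<open>\<delta>\<close> at which the bound \<open>\<delta> / D - (1 + h\<^sup>2) \<delta>\<^sup>2\<close> on the probability of a single jump is
  \<open>\<delta> / (2 D)\<close>, where \<open>h = j (D + 1)\<close> bounds the number of sites in or next to a cluster of size \<open>j\<close>.\<close>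

definition loss_time :: "nat \<Rightarrow> real" where
  "loss_time j = 1 / (2 * D * (1 + (real j * (D + 1))\<^sup>2))"

definition loss_rate :: "nat \<Rightarrow> real" where
  "loss_rate j = loss_time j / (2 * D)"

lemma loss_pos: "0 < loss_time j" "0 < loss_rate j"
proof -
  show "0 < loss_time j"
    unfolding loss_time_def using D_pos by (intro divide_pos_pos mult_pos_pos add_pos_nonneg) auto
  then show "0 < loss_rate j" using D_pos by (simp add: loss_rate_def)
qed

text \<open>A cluster that does not fill the ball has a boundary edge, and a single jump along it
  removes a site. The bound depends on A only through its size, because A and its neighbours are at
  most \<open>card A * (D + 1)\<close> sites.\<close>

lemma prob_loss:
  assumes "A \<subseteq> graph_ball x k" "A \<noteq> {}" "card A < card (graph_ball x k)"
  shows "loss_rate (card A) \<le> measure_pmf.prob (jump_law (graph_ball x k) (loss_time (card A)))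
     {l. card (flow l -` A) = card A - 1}"
proof -
  let ?\<delta> = "loss_time (card A)" and ?\<Lambda> = "graph_ball x k"
  have "A \<noteq> ?\<Lambda>" using assms(3) by auto
  from ball_boundary[OF assms(1,2) this] obtain v w where vw: "v \<in> A" "w \<in> ?\<Lambda> - A" "adj v w" by blast
  have finA: "finite A" by (rule finite_subset[OF assms(1) finite_ball])
  let ?H = "A \<union> (\<Union>y\<in>A. nbrs adj y)"
  have finH: "finite ?H" using finA finite_nbrs by auto
  have "card ?H \<le> card A + card (\<Union>y\<in>A. nbrs adj y)" by (rule card_Un_le)
  also have "card (\<Union>y\<in>A. nbrs adj y) \<le> (\<Sum>y\<in>A. card (nbrs adj y))" by (rule card_UN_le[OF finA])
  also have "\<dots> = card A * D" by (simp add: card_nbrs)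
  finally have "card ?H \<le> card A * (D + 1)" by simp
  then have cH: "real (card ?H) \<le> real (card A) * (D + 1)"
    by (metis of_nat_le_iff of_nat_mult)
  let ?q = "1 + (real (card A) * (D + 1))\<^sup>2"
  have q: "0 < ?q" by (intro add_pos_nonneg) auto
  have "q * (1 / (2 * D * q)) = 1 / (2 * D)" if "0 < q" for q :: real using that by simp
  from this[OF q] have eq: "?q * ?\<delta> = 1 / (2 * D)" by (simp only: loss_time_def)
  \<comment> \<open>At this \<delta> the quadratic error is exactly half of \<delta> / D.\<close>
  have e2: "?q * ?\<delta>\<^sup>2 = 1 / (2 * D) * ?\<delta>"
    unfolding power2_eq_square[of ?\<delta>] mult.assoc[symmetric] eq ..
  have e3: "d / (2 * D) = d / D - 1 / (2 * D) * d" for d :: real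
    by (simp add: field_simps)
  have "loss_rate (card A) = ?\<delta> / D - ?q * ?\<delta>\<^sup>2"
    unfolding loss_rate_def e2 by (rule e3)
  also have "\<dots> \<le> ?\<delta> / D - (1 + (real (card ?H))\<^sup>2) * ?\<delta>\<^sup>2"
    using cH by (intro diff_left_mono mult_right_mono add_left_mono power_mono) auto
  also have "\<dots> \<le> measure_pmf.prob (jump_law ?\<Lambda> ?\<delta>) {l. filter (\<lambda>e. fst e \<in> ?H) l = [(v, w)]}"
    by (rule prob_single_jump_lower)
       (use vw assms(1) finH finite_ball loss_pos(1)[of "card A"] in \<open>auto intro: less_imp_le\<close>)
  also have "\<dots> \<le> measure_pmf.prob (jump_law ?\<Lambda> ?\<delta>) {l. card (flow l -` A) = card A - 1}"
  proof (rule prob_mono_pmf)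
    fix l assume l: "l \<in> set_pmf (jump_law ?\<Lambda> ?\<delta>)" "l \<in> {l. filter (\<lambda>e. fst e \<in> ?H) l = [(v, w)]}"
    have "flow l -` A = A - {v}"
      by (rule vimage_flow_loss) (use l jump_law_subset(1)[OF finite_ball l(1)] vw in auto)
    then show "l \<in> {l. card (flow l -` A) = card A - 1}" using vw finA by simp
  qed
  finally show ?thesis .
qed

definition size_prob :: "'v set \<Rightarrow> real \<Rightarrow> 'v \<Rightarrow> nat \<Rightarrow> real" where
  "size_prob \<Lambda> t x j = measure_pmf.prob (jump_law \<Lambda> t) {l. card (flow l -` {x}) = j}"

text \<open>The extra time is placed before the other jumps, where the backward cluster of size j is
  continued; there it loses a site with probability at least \<open>loss_rate j\<close>.\<close>

lemma size_prob_loss: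
  assumes "0 \<le> t" "0 < j" "j < card (graph_ball x k)"
  shows "loss_rate j * size_prob (graph_ball x k) t x j \<le> size_prob (graph_ball x k) (loss_time j + t) x (j - 1)"
proof -
  let ?\<Lambda> = "graph_ball x k" and ?\<delta> = "loss_time j"
  let ?E = "measure_pmf.expectation (jump_law ?\<Lambda> t)" and ?P = "measure_pmf.prob (jump_law ?\<Lambda> ?\<delta>)"
  have \<delta>: "0 \<le> ?\<delta>" using loss_pos(1)[of j] by simp
  have "loss_rate j * size_prob ?\<Lambda> t x j = ?E (\<lambda>b. loss_rate j * of_bool (card (flow b -` {x}) = j))"
    unfolding size_prob_def by (simp add: prob_pmf_of_bool)
  also have "\<dots> \<le> ?E (\<lambda>b. ?P {a. card (flow (a @ b) -` {x}) = j - 1})"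
  proof (rule expectation_pmf_mono[where B = "loss_rate j" and B' = 1])
    fix b assume b: "b \<in> set_pmf (jump_law ?\<Lambda> t)"
    show "loss_rate j * of_bool (card (flow b -` {x}) = j) \<le> ?P {a. card (flow (a @ b) -` {x}) = j - 1}"
    proof (cases "card (flow b -` {x}) = j")
      case True
      have "flow b -` {x} \<subseteq> ?\<Lambda>" by (rule flow_vimage_support[OF finite_ball b]) simp
      moreover have "flow b -` {x} \<noteq> {}" using True assms(2) by force
      ultimately show ?thesis
        using prob_loss[of "flow b -` {x}" x k] True assms(3) by (simp add: vimage_flow_append)
    qed simp
  qed (use loss_pos(2)[of j] in auto)
  also have "\<dots> = size_prob ?\<Lambda> (?\<delta> + t) x (j - 1)"
    unfolding size_prob_def by (rule prob_jump_law_add[OF finite_ball \<delta> assms(1), symmetric])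
  finally show ?thesis .
qed

lemma size_prob_0: "size_prob \<Lambda> t x 0 = 1 - survival \<Lambda> t {x}"
proof -
  have "size_prob \<Lambda> t x 0 = measure_pmf.prob (jump_law \<Lambda> t) (UNIV - {l. flow l -` {x} \<noteq> {}})"
    unfolding size_prob_def
    by (rule arg_cong[where f = "measure _"])
       (auto simp: card_eq_0_iff finite_vimage_flow)
  then show ?thesis
    unfolding survival_def using measure_pmf.prob_compl[of "{l. flow l -` {x} \<noteq> {}}" "jump_law \<Lambda> t"] by simp
qed

text \<open>A cluster of size 1 that loses its site is extinct, so here the loss appears as a
  decrease of survival. This starts the induction on the size.\<close>

lemma survival_loss:
  assumes "0 \<le> t" "1 < card (graph_ball x k)"
  shows "loss_rate 1 * size_prob (graph_ball x k) t x 1 \<le>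
     survival (graph_ball x k) t {x} - survival (graph_ball x k) (loss_time 1 + t) {x}"
proof -
  let ?\<Lambda> = "graph_ball x k" and ?\<delta> = "loss_time 1"
  let ?E = "measure_pmf.expectation (jump_law ?\<Lambda> t)" and ?P = "measure_pmf.prob (jump_law ?\<Lambda> ?\<delta>)"
  have \<delta>: "0 \<le> ?\<delta>" using loss_pos(1)[of 1] by simp
  have "survival ?\<Lambda> (?\<delta> + t) {x} = ?E (\<lambda>b. survival ?\<Lambda> ?\<delta> (flow b -` {x}))"
    by (rule survival_add[OF finite_ball \<delta> assms(1)])
  also have "\<dots> \<le> ?E (\<lambda>b. of_bool (flow b -` {x} \<noteq> {}) - loss_rate 1 * of_bool (card (flow b -` {x}) = 1))"
  proof (rule expectation_pmf_mono[where B = 1 and B' = "1 + loss_rate 1"])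
    fix b assume b: "b \<in> set_pmf (jump_law ?\<Lambda> t)"
    consider "flow b -` {x} = {}" | "card (flow b -` {x}) = 1" | "flow b -` {x} \<noteq> {}" "card (flow b -` {x}) \<noteq> 1"
      by blast
    then show "survival ?\<Lambda> ?\<delta> (flow b -` {x}) \<le>
        of_bool (flow b -` {x} \<noteq> {}) - loss_rate 1 * of_bool (card (flow b -` {x}) = 1)"
    proof cases
      case 1
      then show ?thesis by (simp add: survival_def)
    next
      case 2
      let ?A = "flow b -` {x}"
      have ne: "?A \<noteq> {}" and sub: "?A \<subseteq> ?\<Lambda>"
        using 2 flow_vimage_support[OF finite_ball b, of "{x}"] by (auto simp: card_eq_0_iff)
      have "loss_rate 1 \<le> ?P {l. card (flow l -` ?A) = 0}"
        using prob_loss[OF sub ne] 2 assms(2) by simp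
      also have "\<dots> = ?P (UNIV - {l. flow l -` ?A \<noteq> {}})"
        by (rule arg_cong[where f = "measure _"]) (auto simp: card_eq_0_iff finite_vimage_flow)
      also have "\<dots> = 1 - survival ?\<Lambda> ?\<delta> ?A"
        unfolding survival_def using measure_pmf.prob_compl[of "{l. flow l -` ?A \<noteq> {}}" "jump_law ?\<Lambda> ?\<delta>"] by simp
      finally show ?thesis using ne 2 by simp
    next
      case 3
      then show ?thesis by (simp add: survival_bounds)
    qed
  next
    fix b
    show "\<bar>of_bool (flow b -` {x} \<noteq> {}) - loss_rate 1 * of_bool (card (flow b -` {x}) = 1)\<bar> \<le> 1 + loss_rate 1"
      using loss_pos(2)[of 1] by auto
  qed (rule survival_bounds)
  also have "\<dots> = survival ?\<Lambda> t {x} - loss_rate 1 * size_prob ?\<Lambda> t x 1"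
    unfolding survival_def size_prob_def prob_pmf_of_bool
  proof (subst Bochner_Integration.integral_diff)
    show "integrable (jump_law ?\<Lambda> t) (\<lambda>b. of_bool (flow b -` {x} \<noteq> {}) :: real)"
      by (rule integrable_pmf_bounded[where B = 1]) simp
    show "integrable (jump_law ?\<Lambda> t) (\<lambda>b. loss_rate 1 * of_bool (card (flow b -` {x}) = 1))"
      by (rule integrable_pmf_bounded[where B = "loss_rate 1"]) (use loss_pos(2)[of 1] in auto)
  qed simp
  finally show ?thesis by linarith
qed

text \<open>Preimages of the empty set are empty, so extinction is final.\<close>

lemma survival_antimono:
  assumes "finite \<Lambda>" "0 \<le> s" "0 \<le> t"
  shows "survival \<Lambda> (s + t) B \<le> survival \<Lambda> t B"
proof -
  have "survival \<Lambda> (s + t) B = measure_pmf.expectation (jump_law \<Lambda> t) (\<lambda>b. survival \<Lambda> s (flow b -` B))"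
    by (rule survival_add[OF assms])
  also have "\<dots> \<le> measure_pmf.expectation (jump_law \<Lambda> t) (\<lambda>b. of_bool (flow b -` B \<noteq> {}))"
    by (rule expectation_pmf_mono[where B = 1 and B' = 1]) (auto simp: survival_bounds, simp add: survival_def)
  also have "\<dots> = survival \<Lambda> t B" by (simp add: survival_def prob_pmf_of_bool)
  finally show ?thesis .
qed

end


section \<open>Backward influence\<close>

text \<open>\<open>reaches l x n z\<close>: there is a chain of \<open>n\<close> jumps in \<open>l\<close>, backwards in time, each sharing a site
  with its predecessor, through which \<open>x\<close> after \<open>l\<close> may depend on \<open>z\<close> before \<open>l\<close>.\<close>

fun reaches :: "('v \<times> 'v) list \<Rightarrow> 'v \<Rightarrow> nat \<Rightarrow> 'v \<Rightarrow> bool" where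
  "reaches [] x n z \<longleftrightarrow> n = 0 \<and> z = x"
| "reaches (e # l) x n z \<longleftrightarrow> reaches l x n z \<or>
     (\<exists>k y. n = Suc k \<and> reaches l x k y \<and> (e = (y, z) \<or> e = (z, y)))"

lemma reaches_append: "reaches l x n z \<Longrightarrow> reaches (l' @ l) x n z"
  by (induction l') auto

lemma reaches_Suc: "reaches l x (Suc n) z \<Longrightarrow> \<exists>y. reaches l x n y"
proof (induction l arbitrary: z)
  case (Cons e l)
  then have "\<exists>y. reaches l x n y" by auto
  then obtain y where "reaches l x n y" by blast
  then have "reaches (e # l) x n y" by simp
  then show ?case by blast
qed simp

lemma reaches_le: "reaches l x m z \<Longrightarrow> n \<le> m \<Longrightarrow> \<exists>y. reaches l x n y"
proof (induction m arbitrary: z)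
  case (Suc m)
  show ?case
  proof (cases "n = Suc m")
    case False
    then have "n \<le> m" using Suc.prems by simp
    obtain y where "reaches l x m y" using reaches_Suc[OF Suc.prems(1)] by blast
    then show ?thesis using Suc.IH \<open>n \<le> m\<close> by blast
  qed (use Suc.prems in auto)
qed auto

context vertex_transitive_graph
begin

lemma reaches_ball:
  "reaches l x n z \<Longrightarrow> (\<And>a b. (a, b) \<in> set l \<Longrightarrow> adj a b) \<Longrightarrow> z \<in> graph_ball x n"
proof (induction l arbitrary: n z)
  case (Cons e l)
  consider "reaches l x n z" | k y where "n = Suc k" "reaches l x k y" "e = (y, z) \<or> e = (z, y)"
    using Cons.prems(1) by auto
  then show ?case
  proof cases
    case 1
    then show ?thesis using Cons by auto
  next
    case 2
    have "y \<in> graph_ball x k" using Cons.IH[OF 2(2)] Cons.prems(2) by auto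
    moreover have "adj y z" using 2(3) Cons.prems(2) adj_sym by auto
    ultimately show ?thesis unfolding 2(1) by (rule ball_step)
  qed
qed simp

text \<open>The sources and the endpoint of every conceivable chain of n jumps. A link between y and
  z may be a jump from either end, which gives the factor 2 D per link.\<close>

primrec chain_clocks :: "'v \<Rightarrow> nat \<Rightarrow> ('v list \<times> 'v) set" where
  "chain_clocks x 0 = {([], x)}"
| "chain_clocks x (Suc n) =
     (\<Union>p\<in>chain_clocks x n. \<Union>z\<in>nbrs adj (snd p). {(snd p # fst p, z), (z # fst p, z)})"

lemma finite_chain_clocks: "finite (chain_clocks x n)"
  by (induction n) (auto simp: finite_nbrs)

lemma card_chain_clocks: "card (chain_clocks x n) \<le> (2 * D) ^ n"
proof (induction n)
  case (Suc n)
  have "card (chain_clocks x (Suc n)) \<le>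
      (\<Sum>p\<in>chain_clocks x n. card (\<Union>z\<in>nbrs adj (snd p). {(snd p # fst p, z), (z # fst p, z)}))"
    unfolding chain_clocks.simps by (rule card_UN_le[OF finite_chain_clocks])
  also have "\<dots> \<le> (\<Sum>p\<in>chain_clocks x n. \<Sum>z\<in>nbrs adj (snd p). card {(snd p # fst p, z), (z # fst p, z)})"
    by (intro sum_mono card_UN_le finite_nbrs)
  also have "\<dots> \<le> (\<Sum>p\<in>chain_clocks x n. \<Sum>z\<in>nbrs adj (snd p). 2)"
    by (intro sum_mono) (auto simp: card_insert_if)
  also have "\<dots> = card (chain_clocks x n) * (2 * D)" by (simp add: card_nbrs)
  also have "\<dots> \<le> (2 * D) ^ n * (2 * D)" by (intro mult_right_mono Suc.IH) simp
  finally show ?case by (simp add: mult.commute)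
qed simp

lemma length_chain_clocks: "(c, z) \<in> chain_clocks x n \<Longrightarrow> length c = n"
  by (induction n arbitrary: c z) auto

text \<open>The sources along a chain occur in \<open>l\<close> in this order, so a chain of n links
  forces one of at most (2 D)^n subsequences.\<close>

lemma reaches_chain_clocks:
  "reaches l x n z \<Longrightarrow> (\<And>a b. (a, b) \<in> set l \<Longrightarrow> adj a b) \<Longrightarrow>
     \<exists>c. (c, z) \<in> chain_clocks x n \<and> subseq c (map fst l)"
proof (induction l arbitrary: n z)
  case Nil
  then show ?case by auto
next
  case (Cons e l)
  have adj: "\<And>a b. (a, b) \<in> set l \<Longrightarrow> adj a b" using Cons.prems(2) by auto
  consider "reaches l x n z" | k y where "n = Suc k" "reaches l x k y" "e = (y, z) \<or> e = (z, y)"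
    using Cons.prems(1) by auto
  then show ?case
  proof cases
    case 1
    then obtain c where "(c, z) \<in> chain_clocks x n" "subseq c (map fst l)"
      using Cons.IH adj by blast
    then show ?thesis by auto
  next
    case 2
    obtain c where c: "(c, y) \<in> chain_clocks x k" "subseq c (map fst l)"
      using Cons.IH[OF 2(2)] adj by blast
    have "adj y z" using 2(3) Cons.prems(2) adj_sym by auto
    then have "(fst e # c, z) \<in> chain_clocks x n"
      unfolding 2(1) chain_clocks.simps using 2(3) c(1)
      by (intro UN_I[of "(c, y)"] UN_I[of z]) (auto simp: nbrs_def)
    moreover have "subseq (fst e # c) (map fst (e # l))" using c(2) by simp
    ultimately show ?thesis by blast
  qed
qed

text \<open>The bound t^n of \<open>prob_jump_law_subseq\<close> does not beat the number of chains
  unless t is small. Cutting time into r short steps, and \<open>c\<close> into the pieces that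
  occur in them, keeps a small base at the cost of a factor for the ways of cutting.\<close>

lemma prob_subseq_steps:
  assumes fin: "finite \<Lambda>" and \<delta>: "0 \<le> \<delta>"
  shows "measure_pmf.prob (jump_law \<Lambda> (real r * \<delta>)) {l. subseq c (map fst l)} \<le> 2 ^ r * (2 * \<delta>) ^ length c"
proof (induction r arbitrary: c)
  case 0
  show ?case by (cases c) (use \<delta> in \<open>auto simp: jump_law_0 fin\<close>)
next
  case (Suc r)
  let ?s = "real r * \<delta>" and ?n = "length c"
  have s: "0 \<le> ?s" and eq: "real (Suc r) * \<delta> = ?s + \<delta>" using \<delta> by (auto simp: algebra_simps)
  let ?Pa = "\<lambda>S. measure_pmf.prob (jump_law \<Lambda> ?s) S" and ?Pb = "\<lambda>S. measure_pmf.prob (jump_law \<Lambda> \<delta>) S"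
  have "measure_pmf.prob (jump_law \<Lambda> (real (Suc r) * \<delta>)) {l. subseq c (map fst l)} =
     measure_pmf.expectation (jump_law \<Lambda> \<delta>) (\<lambda>b. ?Pa {a. subseq c (map fst (a @ b))})"
    unfolding eq by (rule prob_jump_law_add[OF fin s \<delta>])
  also have "\<dots> \<le> measure_pmf.expectation (jump_law \<Lambda> \<delta>)
      (\<lambda>b. \<Sum>j\<le>?n. ?Pa {a. subseq (take j c) (map fst a)} * of_bool (subseq (drop j c) (map fst b)))"
  proof (rule expectation_pmf_mono[where B = 1 and B' = "real (Suc ?n)"])
    fix b :: "('v \<times> 'v) list"
    \<comment> \<open>The lengths of the prefixes left to the earlier time when the last step
      supplies the rest of \<open>c\<close>.\<close>
    let ?J = "{j \<in> {..?n}. subseq (drop j c) (map fst b)}"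
    have "?Pa {a. subseq c (map fst (a @ b))} \<le> ?Pa (\<Union>j\<in>?J. {a. subseq (take j c) (map fst a)})"
    proof (rule measure_pmf.finite_measure_mono)
      show "{a. subseq c (map fst (a @ b))} \<subseteq> (\<Union>j\<in>?J. {a. subseq (take j c) (map fst a)})"
      proof
        fix a assume "a \<in> {a. subseq c (map fst (a @ b))}"
        then have "subseq c (map fst a @ map fst b)" by simp
        then obtain c1 c2 where "c = c1 @ c2" "subseq c1 (map fst a)" "subseq c2 (map fst b)"
          by (auto simp only: subseq_append_iff)
        then show "a \<in> (\<Union>j\<in>?J. {a. subseq (take j c) (map fst a)})"
          by (intro UN_I[of "length c1"]) auto
      qed
    qed simp
    also have "\<dots> \<le> (\<Sum>j\<in>?J. ?Pa {a. subseq (take j c) (map fst a)})"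
      by (rule measure_pmf.finite_measure_subadditive_finite) auto
    also have "\<dots> = (\<Sum>j\<le>?n. ?Pa {a. subseq (take j c) (map fst a)} * of_bool (subseq (drop j c) (map fst b)))"
      by (rule sum.mono_neutral_cong_left) auto
    finally show "?Pa {a. subseq c (map fst (a @ b))} \<le>
        (\<Sum>j\<le>?n. ?Pa {a. subseq (take j c) (map fst a)} * of_bool (subseq (drop j c) (map fst b)))" .
    have "(\<Sum>j\<le>?n. ?Pa {a. subseq (take j c) (map fst a)} * of_bool (subseq (drop j c) (map fst b)))
        \<le> (\<Sum>j\<le>?n. 1)"
      by (intro sum_mono) auto
    moreover have "0 \<le> (\<Sum>j\<le>?n. ?Pa {a. subseq (take j c) (map fst a)} * of_bool (subseq (drop j c) (map fst b)))"
      by (intro sum_nonneg) auto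
    ultimately show "\<bar>\<Sum>j\<le>?n. ?Pa {a. subseq (take j c) (map fst a)} * of_bool (subseq (drop j c) (map fst b))\<bar>
        \<le> real (Suc ?n)" by simp
  qed auto
  also have "\<dots> = (\<Sum>j\<le>?n. ?Pa {a. subseq (take j c) (map fst a)} * ?Pb {b. subseq (drop j c) (map fst b)})"
  proof -
    have i: "integrable (jump_law \<Lambda> \<delta>) (\<lambda>b. u * of_bool (Q b) :: real)" for Q and u :: real
      by (rule integrable_pmf_bounded[where B = "\<bar>u\<bar>"]) simp
    show ?thesis
      by (subst Bochner_Integration.integral_sum) (simp_all only: i integral_mult_right_zero prob_pmf_of_bool)
  qed
  also have "\<dots> \<le> (\<Sum>j\<le>?n. 2 ^ r * (2 * \<delta>) ^ j * \<delta> ^ (?n - j))"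
  proof (intro sum_mono mult_mono)
    fix j assume "j \<in> {..?n}"
    then show "?Pa {a. subseq (take j c) (map fst a)} \<le> 2 ^ r * (2 * \<delta>) ^ j"
      using Suc.IH[of "take j c"] by simp
    show "?Pb {b. subseq (drop j c) (map fst b)} \<le> \<delta> ^ (?n - j)"
      using prob_jump_law_subseq[OF fin \<delta>, of "drop j c"] by simp
  qed (use \<delta> in auto)
  also have "\<dots> = (\<Sum>j\<le>?n. 2 ^ r * \<delta> ^ ?n * 2 ^ j)"
  proof (rule sum.cong[OF refl])
    fix j assume "j \<in> {..?n}"
    then have "\<delta> ^ j * \<delta> ^ (?n - j) = \<delta> ^ ?n" by (simp add: power_add[symmetric])
    then show "2 ^ r * (2 * \<delta>) ^ j * \<delta> ^ (?n - j) = 2 ^ r * \<delta> ^ ?n * 2 ^ j"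
      by (simp add: power_mult_distrib mult_ac)
  qed
  also have "\<dots> = 2 ^ r * \<delta> ^ ?n * (\<Sum>j\<le>?n. 2 ^ j)" by (simp add: sum_distrib_left)
  also have "\<dots> \<le> 2 ^ r * \<delta> ^ ?n * (2 * 2 ^ ?n)"
  proof (rule mult_left_mono)
    have "(\<Sum>j\<le>k. 2 ^ j :: real) \<le> 2 * 2 ^ k" for k by (induction k) auto
    then show "(\<Sum>j\<le>?n. 2 ^ j :: real) \<le> 2 * 2 ^ ?n" .
  qed (use \<delta> in auto)
  also have "\<dots> = 2 ^ Suc r * (2 * \<delta>) ^ ?n" by (simp add: power_mult_distrib)
  finally show ?case .
qed

text \<open>The bound is uniform in \<Lambda> and x; this is what makes the approximation by finite
  sets converge.\<close>

lemma prob_reaches: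
  assumes t: "0 \<le> t"
  obtains b where "b \<longlonglongrightarrow> 0"
    "\<And>\<Lambda> n x. finite \<Lambda> \<Longrightarrow> measure_pmf.prob (jump_law \<Lambda> t) {l. \<exists>z. reaches l x n z} \<le> b n"
proof -
  \<comment> \<open>With steps of length \<delta> = t / r, the (2 D)^n chains times (2 \<delta>)^n
    are at most (1/2)^n.\<close>
  obtain r :: nat where r: "8 * D * t < r" using reals_Archimedean2 by blast
  then have "0 < real r" using t by (metis mult_nonneg_nonneg of_nat_0_le_iff le_less_trans)
  define \<delta> where "\<delta> = t / r"
  have \<delta>: "0 \<le> \<delta>" "real r * \<delta> = t" using t \<open>0 < real r\<close> by (auto simp: \<delta>_def)
  have "8 * D * \<delta> \<le> 1" using r \<open>0 < real r\<close> by (simp add: \<delta>_def field_simps)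
  then have q: "2 * real D * (2 * \<delta>) \<le> 1 / 2" by simp
  have bound: "measure_pmf.prob (jump_law \<Lambda> t) {l. \<exists>z. reaches l x n z} \<le> 2 ^ r * (1 / 2) ^ n"
    if fin: "finite \<Lambda>" for \<Lambda> n x
  proof -
    have "measure_pmf.prob (jump_law \<Lambda> t) {l. \<exists>z. reaches l x n z} \<le>
      measure_pmf.prob (jump_law \<Lambda> t) (\<Union>p\<in>chain_clocks x n. {l. subseq (fst p) (map fst l)})"
    proof (rule prob_mono_pmf)
      fix l assume "l \<in> set_pmf (jump_law \<Lambda> t)" "l \<in> {l. \<exists>z. reaches l x n z}"
      then obtain z c where "(c, z) \<in> chain_clocks x n" "subseq c (map fst l)"
        using reaches_chain_clocks jump_law_subset(1)[OF fin] by blast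
      then show "l \<in> (\<Union>p\<in>chain_clocks x n. {l. subseq (fst p) (map fst l)})"
        by (intro UN_I[of "(c, z)"]) auto
    qed
    also have "\<dots> \<le> (\<Sum>p\<in>chain_clocks x n. measure_pmf.prob (jump_law \<Lambda> t) {l. subseq (fst p) (map fst l)})"
      by (rule measure_pmf.finite_measure_subadditive_finite) (auto simp: finite_chain_clocks)
    also have "\<dots> \<le> (\<Sum>p\<in>chain_clocks x n. 2 ^ r * (2 * \<delta>) ^ n)"
    proof (rule sum_mono)
      fix p assume "p \<in> chain_clocks x n"
      then have "length (fst p) = n" using length_chain_clocks[of "fst p" "snd p"] by simp
      then show "measure_pmf.prob (jump_law \<Lambda> t) {l. subseq (fst p) (map fst l)} \<le> 2 ^ r * (2 * \<delta>) ^ n"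
        using prob_subseq_steps[OF fin \<delta>(1), of r "fst p"] by (simp add: \<delta>(2))
    qed
    also have "\<dots> = real (card (chain_clocks x n)) * (2 ^ r * (2 * \<delta>) ^ n)" by simp
    also have "\<dots> \<le> (2 * real D) ^ n * (2 ^ r * (2 * \<delta>) ^ n)"
    proof (rule mult_right_mono)
      show "real (card (chain_clocks x n)) \<le> (2 * real D) ^ n"
        using card_chain_clocks[of x n] by (metis of_nat_le_iff of_nat_mult of_nat_numeral of_nat_power)
    qed (use \<delta> in auto)
    also have "\<dots> = 2 ^ r * (2 * real D * (2 * \<delta>)) ^ n"
    proof -
      have "a ^ n * (c * b ^ n) = c * (a * b) ^ n" for a b c :: real by (simp add: power_mult_distrib)
      then show ?thesis .
    qed
    also have "\<dots> \<le> 2 ^ r * (1 / 2) ^ n"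
      by (intro mult_left_mono power_mono q) (use \<delta> in auto)
    finally show ?thesis .
  qed
  have "(\<lambda>n. 2 ^ r * (1 / 2 :: real) ^ n) \<longlonglongrightarrow> 2 ^ r * 0"
    by (intro tendsto_intros LIMSEQ_power_zero) simp
  then show ?thesis using bound by (intro that[of "\<lambda>n. 2 ^ r * (1 / 2) ^ n"]) auto
qed

text \<open>Induction along the list of jumps: the state just after the jumps \<open>es1\<close> is the computed one at
  every site which may still influence \<open>x\<close> through the remaining jumps.\<close>

lemma evolution_determined:
  assumes m: "regular_marks adj m" and fin: "finite \<Lambda>" and sub: "graph_ball x n \<subseteq> \<Lambda>" and t: "0 \<le> t"
    and ev: "evolves_by react m \<eta>" and no: "\<not> (\<exists>z. reaches (jumps \<Lambda> t m) x n z)"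
  shows "\<eta> t x = fold (update react) (jumps \<Lambda> t m) (\<eta> 0) x"
proof -
  obtain es where es: "event_list \<Lambda> t m es" using ex_event_list[OF m fin] by blast
  have jm: "jumps \<Lambda> t m = map snd es"
    by (rule jumps_event_list[OF _ es]) (use m in \<open>simp add: regular_marks_def\<close>)
  have st: "sorted_wrt (\<lambda>a b. fst a < fst b) es"
    and set_es: "set es = {(\<tau>, v, w). jump m \<tau> v w \<and> v \<in> \<Lambda> \<and> w \<in> \<Lambda> \<and> \<tau> \<le> t}"
    using es by (auto simp: event_list_def)
  have adj_es: "adj a b" if "(a, b) \<in> set (map snd es)" for a b
    using that set_es jump_pos(2)[OF m] by auto
  have ev1: "\<forall>\<^sub>F r in at_left s. \<eta> s v = None \<and> \<eta> s w = join react (\<eta> r v) (\<eta> r w)" if "jump m s v w" for s v w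
    using ev that unfolding evolves_by_def by blast
  have ev2: "\<eta> s' y = \<eta> s y"
    if "0 \<le> s" "s \<le> s'" "\<And>r a b. s < r \<Longrightarrow> r \<le> s' \<Longrightarrow> jump m r a b \<Longrightarrow> y \<noteq> a \<and> y \<noteq> b" for s s' y
    using ev that unfolding evolves_by_def by blast
  \<comment> \<open>The time of the last jump processed so far, 0 before the first one.\<close>
  define T where "T es1 = (if es1 = [] then 0 else fst (last es1))" for es1 :: "(real \<times> 'v \<times> 'v) list"
  define act where "act es2 y \<longleftrightarrow> (\<exists>j. reaches (map snd es2) x j y)" for es2 :: "(real \<times> 'v \<times> 'v) list" and y
  \<comment> \<open>A chain from x has fewer than n links. So an active site is within distance n -
    1 of x, both ends of a jump touching it are in the ball of radius n and hence in \<Lambda>, and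
    the list misses no such jump.\<close>
  have touch: "(r, a, b) \<in> set es"
    if "es = es1 @ es2" "act es2 y" "jump m r a b" "y = a \<or> y = b" "r \<le> t" for es1 es2 y r a b
  proof -
    from that(2) obtain j where j: "reaches (map snd es2) x j y" by (auto simp: act_def)
    have "\<not> n \<le> j"
      using reaches_le[OF reaches_append[OF j, of "map snd es1"], of n] no that(1) by (auto simp: jm)
    moreover have "y \<in> graph_ball x j"
      by (rule reaches_ball[OF j]) (use adj_es that(1) in auto)
    ultimately have "j \<le> n - 1" "n = Suc (n - 1)" "y \<in> graph_ball x j" by auto
    then have "y \<in> graph_ball x (n - 1)" "n = Suc (n - 1)" using ball_mono[of j "n - 1" x] by blast+
    moreover have "adj a b" by (rule jump_pos(2)[OF m that(3)])
    ultimately have "a \<in> graph_ball x n" "b \<in> graph_ball x n"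
      using that(4) adj_sym ball_step[of y x "n - 1"] ball_mono[of "n - 1" n x] by (metis diff_le_self subsetD)+
    then show ?thesis using that(3,5) sub by (auto simp: set_es)
  qed
  have T_le: "0 \<le> T es1" "T es1 \<le> t" "\<And>e. e \<in> set es1 \<Longrightarrow> fst e \<le> T es1" if "es = es1 @ es2" for es1 es2
  proof -
    have el: "0 < fst e \<and> fst e \<le> t" if "e \<in> set es" for e
      using that jump_pos(1)[OF m] by (auto simp: set_es)
    show "0 \<le> T es1" "T es1 \<le> t"
      using el[of "last es1"] that t by (auto simp: T_def)
    fix e assume e: "e \<in> set es1"
    then obtain es0 where es0: "es1 = es0 @ [last es1]" by (metis append_butlast_last_id empty_iff list.set(1))
    have "sorted_wrt (\<lambda>a b. fst a < fst b) (es0 @ [last es1])"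
      using st unfolding that sorted_wrt_append es0[symmetric] by simp
    then have "e = last es1 \<or> fst e < fst (last es1)"
      using e es0 by (metis UnE list.set_intros(1) set_ConsD set_append sorted_wrt_append empty_iff list.set(1))
    then show "fst e \<le> T es1" using e by (auto simp: T_def)
  qed
  have main: "\<eta> (T es1) y = fold (update react) (map snd es1) (\<eta> 0) y"
    if "es = es1 @ es2" "act es2 y" for es1 es2 y
    using that
  proof (induction es1 arbitrary: es2 y rule: rev_induct)
    case Nil
    then show ?case by (simp add: T_def)
  next
    case (snoc e es1)
    obtain \<tau> v w where e: "e = (\<tau>, v, w)" by (cases e) auto
    have es': "es = es1 @ (\<tau>, v, w) # es2" using snoc.prems(1) by (simp add: e)
    have "(\<tau>, v, w) \<in> set es" unfolding es' by simp
    then have jmp: "jump m \<tau> v w" "\<tau> \<le> t" unfolding set_es by simp_all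
    let ?\<sigma> = "T es1"
    note Tl = T_le[OF es']
    have ord: "\<And>a. a \<in> set es1 \<Longrightarrow> fst a < \<tau>" "\<And>a. a \<in> set es2 \<Longrightarrow> \<tau> < fst a"
      using st unfolding es' by (auto simp: sorted_wrt_append)
    have lt: "?\<sigma> < \<tau>"
      using ord(1)[of "last es1"] jump_pos(1)[OF m jmp(1)] by (auto simp: T_def)
    have T': "T (es1 @ [e]) = \<tau>" by (simp add: T_def e)
    have act': "act ((\<tau>, v, w) # es2) z" if "act es2 z" for z
      using that by (auto simp: act_def)
    have quiet: "z \<noteq> a \<and> z \<noteq> b" if "act ((\<tau>, v, w) # es2) z" "?\<sigma> < r" "r < \<tau>" "jump m r a b" for z r a b
    proof (rule ccontr)
      assume "\<not> ?thesis"
      then have "(r, a, b) \<in> set es"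
        using touch[OF es' that(1,4)] that(3) jmp(2) by auto
      then show False
        using Tl(3)[of "(r, a, b)"] ord(2)[of "(r, a, b)"] that(2,3) unfolding es' by auto
    qed
    have IH: "\<eta> ?\<sigma> z = fold (update react) (map snd es1) (\<eta> 0) z" if "act ((\<tau>, v, w) # es2) z" for z
      by (rule snoc.IH[OF es' that])
    show ?case
    proof (cases "y = v \<or> y = w")
      case False
      have "\<eta> \<tau> y = \<eta> ?\<sigma> y"
      proof (rule ev2[OF Tl(1)])
        fix r a b assume r: "?\<sigma> < r" "r \<le> \<tau>" "jump m r a b"
        show "y \<noteq> a \<and> y \<noteq> b"
        proof (cases "r = \<tau>")
          case True
          show ?thesis
          proof (rule ccontr)
            assume "\<not> ?thesis"
            then have "(r, a, b) \<in> set es"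
              using touch[OF es' act'[OF snoc.prems(2)] r(3)] r(2) jmp(2) by auto
            then have "(a, b) = (v, w)"
              using ord(1)[of "(r, a, b)"] ord(2)[of "(r, a, b)"] True unfolding es' by auto
            then show False using False \<open>\<not> (y \<noteq> a \<and> y \<noteq> b)\<close> by auto
          qed
        next
          case False
          then show ?thesis using quiet[OF act'[OF snoc.prems(2)] r(1) _ r(3)] r(2) by auto
        qed
      qed (use lt in simp)
      then show ?thesis
        unfolding T' using IH[OF act'[OF snoc.prems(2)]] False by (simp add: e update_def[of react "(v, w)"])
    next
      case True
      \<comment> \<open>A chain that reaches one end of the jump extends by one link to the other,
        so both ends were active before the jump.\<close>
      obtain j where j: "reaches (map snd es2) x j y" using snoc.prems(2) by (auto simp: act_def)
      have avw: "act ((\<tau>, v, w) # es2) v" "act ((\<tau>, v, w) # es2) w"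
      proof -
        have "reaches ((v, w) # map snd es2) x (Suc j) z" if "(v, w) = (y, z) \<or> (v, w) = (z, y)" for z
          using j that by auto
        then show "act ((\<tau>, v, w) # es2) v" "act ((\<tau>, v, w) # es2) w"
          using True act'[OF snoc.prems(2)] by (auto simp: act_def)
      qed
      from ev1[OF jmp(1)] obtain b where b: "b < \<tau>"
        "\<And>r. b < r \<Longrightarrow> r < \<tau> \<Longrightarrow> \<eta> \<tau> v = None \<and> \<eta> \<tau> w = join react (\<eta> r v) (\<eta> r w)"
        unfolding eventually_at_left_field by blast
      \<comment> \<open>A time after the previous listed jump and close to \<tau>: there the left
        limit at \<tau> and the state after the previous jump coincide at active sites.\<close>
      obtain r where r: "max b ?\<sigma> < r" "r < \<tau>" using dense[of "max b ?\<sigma>" \<tau>] b(1) lt by auto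
      have same: "\<eta> r z = \<eta> ?\<sigma> z" if "act ((\<tau>, v, w) # es2) z" for z
        by (rule ev2[OF Tl(1)]) (use r quiet[OF that] in auto)
      have "\<eta> \<tau> v = None" "\<eta> \<tau> w = join react (\<eta> r v) (\<eta> r w)"
        using b(2)[of r] r by auto
      moreover have "v \<noteq> w" using jump_pos(2)[OF m jmp(1)] adj_irrefl by auto
      ultimately show ?thesis
        unfolding T' using True IH[OF avw(1)] IH[OF avw(2)] same[OF avw(1)] same[OF avw(2)]
        by (auto simp: e update_def[of react "(v, w)"])
    qed
  qed
  have act0: "act [] x" by (auto simp: act_def)
  have "\<eta> t x = \<eta> (T es) x"
  proof (rule ev2)
    fix r a b assume r: "T es < r" "r \<le> t" "jump m r a b"
    show "x \<noteq> a \<and> x \<noteq> b"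
    proof (rule ccontr)
      assume "\<not> ?thesis"
      then have "(r, a, b) \<in> set es" using touch[of es "[]" x r a b] act0 r by auto
      then show False using T_le(3)[of es "[]" "(r, a, b)"] r(1) by simp
    qed
  qed (use T_le[of es "[]"] in auto)
  then show ?thesis using main[of es "[]" x] act0 by (simp add: jm)
qed

end


section \<open>Finite approximation of the systems\<close>

lemma (in prob_space) prob_diff_le:
  assumes "A \<in> events" "B \<in> events" "C \<in> events"
    and "AE \<omega> in M. \<omega> \<notin> C \<longrightarrow> (\<omega> \<in> A \<longleftrightarrow> \<omega> \<in> B)"
  shows "\<bar>prob A - prob B\<bar> \<le> prob C"
proof -
  have "prob A \<le> prob (B \<union> C)" "prob B \<le> prob (A \<union> C)"
    by (rule finite_measure_mono_AE; use assms in \<open>auto elim: eventually_mono\<close>)+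
  moreover have "prob (B \<union> C) \<le> prob B + prob C" "prob (A \<union> C) \<le> prob A + prob C"
    by (rule measure_Un_le; fact)+
  ultimately show ?thesis by linarith
qed

context vertex_transitive_graph
begin

definition exhausting :: "(nat \<Rightarrow> 'v set) \<Rightarrow> bool" where
  "exhausting \<Lambda> \<longleftrightarrow> (\<forall>k. finite (\<Lambda> k)) \<and> (\<forall>x n. \<forall>\<^sub>F k in sequentially. graph_ball x n \<subseteq> \<Lambda> k)"

lemma ball_trans: "x \<in> graph_ball y d \<Longrightarrow> graph_ball x n \<subseteq> graph_ball y (d + n)"
proof (induction n)
  case (Suc n)
  then show ?case by (auto simp: nbrs_def)
qed simp

lemma exhausting_ball: "exhausting (graph_ball y)"
  unfolding exhausting_def
proof (intro conjI allI)
  fix x n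
  obtain d where "x \<in> graph_ball y d" using ball_exhausts by blast
  then have "graph_ball x n \<subseteq> graph_ball y k" if "d + n \<le> k" for k
    using ball_trans ball_mono[OF that] by blast
  then show "\<forall>\<^sub>F k in sequentially. graph_ball x n \<subseteq> graph_ball y k"
    by (rule eventually_sequentiallyI)
qed (rule finite_ball)

text \<open>Without a chain of n links, the state at x is computed from the initial states and the
  jumps in \<open>\<Lambda> k\<close>, and given these jumps its law is that of
  \<open>prob_fold_update\<close>. The exceptional probability is at most \<open>b n\<close> for
  every k whose set contains the ball of radius n, so n can be fixed before k grows.\<close>

theorem occupation_limit:
  fixes react :: "'k::finite \<Rightarrow> 'k \<Rightarrow> 'k option"
  assumes rw: "reacting_walks adj react (\<nu> 1) M \<eta>" and \<nu>: "merging_laws react \<nu>"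
    and \<Lambda>: "exhausting \<Lambda>" and t: "0 \<le> t"
  shows "(\<lambda>k. measure_pmf.expectation (jump_law (\<Lambda> k) t)
             (\<lambda>l. measure_pmf.prob (\<nu> (card (flow l -` {x}))) S))
         \<longlonglongrightarrow> measure M {\<omega> \<in> space M. \<eta> t x \<omega> \<in> S}"
proof -
  define \<mu> where "\<mu> = \<nu> 1"
  note rw = rw[folded \<mu>_def]
  let ?Q = "marks_law adj" and ?K = "\<Pi>\<^sub>M v\<in>(UNIV :: 'v set). measure_pmf \<mu>"
  let ?g = "\<lambda>l. measure_pmf.prob (\<nu> (card (flow l -` {x}))) S"
  let ?E = "\<lambda>k. measure_pmf.expectation (jump_law (\<Lambda> k) t) ?g"
  interpret M: prob_space M using rw by (simp add: reacting_walks_def)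
  interpret Q: prob_space ?Q by (rule prob_space_marks_law)
  interpret K: prob_space ?K by (intro prob_space_PiM measure_pmf.prob_space_axioms)
  interpret KQ: pair_prob_space ?K ?Q ..
  have Dl: "driving_law adj \<mu> = ?K \<Otimes>\<^sub>M ?Q" by (simp add: driving_law_def marks_law_def)
  obtain init m where im: "(\<lambda>\<omega>. (init \<omega>, m \<omega>)) \<in> M \<rightarrow>\<^sub>M ?K \<Otimes>\<^sub>M ?Q"
    and law: "distr M (?K \<Otimes>\<^sub>M ?Q) (\<lambda>\<omega>. (init \<omega>, m \<omega>)) = ?K \<Otimes>\<^sub>M ?Q"
    and ev: "AE \<omega> in M. (\<forall>x. \<eta> 0 x \<omega> = init \<omega> x) \<and> evolves_by react (m \<omega>) (\<lambda>t x. \<eta> t x \<omega>)"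
    using rw unfolding reacting_walks_def Dl by blast
  have mm: "m \<in> M \<rightarrow>\<^sub>M ?Q" using measurable_compose[OF im measurable_snd] by simp
  have mlaw: "distr M ?Q m = ?Q"
  proof -
    have "distr M ?Q (snd \<circ> (\<lambda>\<omega>. (init \<omega>, m \<omega>))) = distr (?K \<Otimes>\<^sub>M ?Q) ?Q snd"
      by (subst distr_distr[OF measurable_snd im, symmetric]) (simp only: law)
    then show ?thesis
      using distr_snd[OF K.prob_space_axioms Q.prob_space_axioms] by (simp add: o_def)
  qed
  have reg: "AE \<omega> in M. regular_marks adj (m \<omega>)"
  proof (rule AE_distrD[OF mm])
    show "AE m in distr M ?Q m. regular_marks adj m" unfolding mlaw by (rule AE_regular_marks)
  qed
  have sets_eta: "{\<omega> \<in> space M. \<eta> t x \<omega> \<in> S} \<in> sets M"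
  proof -
    have "\<eta> t x \<in> M \<rightarrow>\<^sub>M count_space UNIV" using rw t unfolding reacting_walks_def by blast
    from measurable_sets[OF this, of S] show ?thesis by (simp add: vimage_def Int_def conj_commute)
  qed
  define W where "W k = {p. fold (update react) (jumps (\<Lambda> k) t (snd p)) (fst p) x \<in> S}" for k
  define Z where "Z k n = {\<omega> \<in> space M. \<exists>z. reaches (jumps (\<Lambda> k) t (m \<omega>)) x n z}" for k n
  have spK: "space ?K = UNIV" by (auto simp: space_PiM)
  have W: "W k \<in> sets (?K \<Otimes>\<^sub>M ?Q)" for k
  proof -
    \<comment> \<open>There are countably many jump lists, so the event is a countable union of
      rectangles.\<close>
    have "W k = (\<Union>l\<in>UNIV. {\<sigma>. fold (update react) l \<sigma> x \<in> S} \<times> {m. jumps (\<Lambda> k) t m = l})"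
      by (auto simp: W_def)
    also have "\<dots> \<in> sets (?K \<Otimes>\<^sub>M ?Q)"
    proof (rule sets.countable_UN''[OF countable_lists_vertices(1)], rule pair_measureI)
      fix l
      show "{\<sigma>. fold (update react) l \<sigma> x \<in> S} \<in> sets ?K"
        using measurable_sets[OF measurable_fold_update[of react l x \<mu>], of S]
        by (simp only: vimage_def spK Int_UNIV_right) simp
      show "{m. jumps (\<Lambda> k) t m = l} \<in> sets ?Q"
        using measurable_sets[OF measurable_jumps[of "\<Lambda> k" t], of "{l}"] by (simp add: vimage_def)
    qed
    finally show ?thesis .
  qed
  have Wm: "{\<omega> \<in> space M. (init \<omega>, m \<omega>) \<in> W k} \<in> sets M" for k
    using measurable_sets[OF im W[of k]] by (simp add: vimage_def Int_def conj_commute)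
  have PW: "measure M {\<omega> \<in> space M. (init \<omega>, m \<omega>) \<in> W k} = ?E k" for k
  proof -
    have gi: "integrable (jump_law (\<Lambda> k) t) ?g" by (rule integrable_pmf_bounded[where B = 1]) simp
    have "measure M {\<omega> \<in> space M. (init \<omega>, m \<omega>) \<in> W k} =
        measure (distr M (?K \<Otimes>\<^sub>M ?Q) (\<lambda>\<omega>. (init \<omega>, m \<omega>))) (W k)"
      by (subst measure_distr[OF im W]) (simp add: vimage_def Int_def conj_commute)
    also have "\<dots> = measure (?K \<Otimes>\<^sub>M ?Q) (W k)" by (simp only: law)
    finally have "ennreal (measure M {\<omega> \<in> space M. (init \<omega>, m \<omega>) \<in> W k}) = emeasure (?K \<Otimes>\<^sub>M ?Q) (W k)"
      by (simp add: KQ.emeasure_eq_measure)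
    \<comment> \<open>Initial states and marks are independent: for fixed marks, the initial states
      are integrated out.\<close>
    also have "\<dots> = (\<integral>\<^sup>+m. emeasure ?K ((\<lambda>\<sigma>. (\<sigma>, m)) -` W k) \<partial>?Q)"
      by (rule KQ.emeasure_pair_measure_alt2[OF W])
    also have "\<dots> = (\<integral>\<^sup>+m. ennreal (?g (jumps (\<Lambda> k) t m)) \<partial>?Q)"
    proof (rule nn_integral_cong_AE)
      show "AE m in ?Q. emeasure ?K ((\<lambda>\<sigma>. (\<sigma>, m)) -` W k) = ennreal (?g (jumps (\<Lambda> k) t m))"
        using AE_regular_marks
      proof eventually_elim
        case (elim m)
        have ne: "v \<noteq> w" if "(v, w) \<in> set (jumps (\<Lambda> k) t m)" for v w
          using jumps_subset(1)[OF elim _ that] \<Lambda> adj_irrefl by (auto simp: exhausting_def)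
        have "(\<lambda>\<sigma>. (\<sigma>, m)) -` W k = {\<sigma> \<in> space ?K. fold (update react) (jumps (\<Lambda> k) t m) \<sigma> x \<in> S}"
          by (auto simp: W_def spK)
        then show ?case using prob_fold_update[OF \<nu> ne, of _ x S, folded \<mu>_def] by (simp add: K.emeasure_eq_measure)
      qed
    qed
    also have "\<dots> = (\<integral>\<^sup>+l. ennreal (?g l) \<partial>jump_law (\<Lambda> k) t)"
      unfolding measure_pmf_jump_law by (simp add: nn_integral_distr[OF measurable_jumps])
    also have "\<dots> = ennreal (?E k)"
      by (rule nn_integral_eq_integral[OF gi]) simp
    finally show ?thesis
      by (subst (asm) ennreal_inj) (auto intro!: Bochner_Integration.integral_nonneg)
  qed
  have Zm: "Z k n \<in> sets M" "measure M (Z k n) = measure_pmf.prob (jump_law (\<Lambda> k) t) {l. \<exists>z. reaches l x n z}" for k n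
  proof -
    let ?R = "{l. \<exists>z. reaches l x n z}"
    have R: "{m. jumps (\<Lambda> k) t m \<in> ?R} \<in> sets ?Q"
      using measurable_sets[OF measurable_jumps[of "\<Lambda> k" t], of ?R] by (simp add: vimage_def)
    have eq: "Z k n = m -` {m. jumps (\<Lambda> k) t m \<in> ?R} \<inter> space M" by (auto simp: Z_def)
    show "Z k n \<in> sets M" unfolding eq by (rule measurable_sets[OF mm R])
    have "measure M (Z k n) = measure (distr M ?Q m) {m. jumps (\<Lambda> k) t m \<in> ?R}"
      unfolding eq by (rule measure_distr[OF mm R, symmetric])
    then show "measure M (Z k n) = measure_pmf.prob (jump_law (\<Lambda> k) t) ?R"
      unfolding mlaw by (simp only: prob_jump_law)
  qed
  obtain b where b: "b \<longlonglongrightarrow> 0"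
    "\<And>\<Lambda> n x. finite \<Lambda> \<Longrightarrow> measure_pmf.prob (jump_law \<Lambda> t) {l. \<exists>z. reaches l x n z} \<le> b n"
    using prob_reaches[OF t] by blast
  have close: "\<bar>?E k - measure M {\<omega> \<in> space M. \<eta> t x \<omega> \<in> S}\<bar> \<le> b n" if sub: "graph_ball x n \<subseteq> \<Lambda> k" for k n
  proof -
    have fin: "finite (\<Lambda> k)" using \<Lambda> by (simp add: exhausting_def)
    have "\<bar>M.prob {\<omega> \<in> space M. (init \<omega>, m \<omega>) \<in> W k} - M.prob {\<omega> \<in> space M. \<eta> t x \<omega> \<in> S}\<bar> \<le> M.prob (Z k n)"
    proof (rule M.prob_diff_le[OF Wm sets_eta Zm(1)])
      show "AE \<omega> in M. \<omega> \<notin> Z k n \<longrightarrow>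
         (\<omega> \<in> {\<omega> \<in> space M. (init \<omega>, m \<omega>) \<in> W k} \<longleftrightarrow> \<omega> \<in> {\<omega> \<in> space M. \<eta> t x \<omega> \<in> S})"
        using ev reg
      proof eventually_elim
        case (elim \<omega>)
        have init: "(\<lambda>x. \<eta> 0 x \<omega>) = init \<omega>" using elim(1) by auto
        have evo: "evolves_by react (m \<omega>) (\<lambda>t x. \<eta> t x \<omega>)" using elim(1) by simp
        show ?case
        proof (intro impI)
          assume nz: "\<omega> \<notin> Z k n"
          show "\<omega> \<in> {\<omega> \<in> space M. (init \<omega>, m \<omega>) \<in> W k} \<longleftrightarrow> \<omega> \<in> {\<omega> \<in> space M. \<eta> t x \<omega> \<in> S}"
          proof (cases "\<omega> \<in> space M")
            case True
            then have "\<not> (\<exists>z. reaches (jumps (\<Lambda> k) t (m \<omega>)) x n z)" using nz by (simp add: Z_def)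
            from evolution_determined[OF elim(2) fin sub t evo this]
            show ?thesis by (simp add: W_def init True)
          qed simp
        qed
      qed
    qed
    also have "\<dots> \<le> b n" unfolding Zm(2) by (rule b(2)[OF fin])
    finally show ?thesis by (simp add: PW)
  qed
  show ?thesis
  proof (rule LIMSEQ_I)
    fix r :: real assume "0 < r"
    with b(1) obtain n where n: "b n < r"
      by (metis LIMSEQ_D abs_ge_self diff_zero le_less_trans order_refl real_norm_def)
    have "\<forall>\<^sub>F k in sequentially. graph_ball x n \<subseteq> \<Lambda> k" using \<Lambda> by (simp add: exhausting_def)
    then obtain k0 where k0: "\<And>k. k \<ge> k0 \<Longrightarrow> graph_ball x n \<subseteq> \<Lambda> k" by (auto simp: eventually_sequentially)
    show "\<exists>no. \<forall>k\<ge>no. norm (?E k - measure M {\<omega> \<in> space M. \<eta> t x \<omega> \<in> S}) < r"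
    proof (intro exI[of _ k0] allI impI)
      fix k assume "k0 \<le> k"
      from close[OF k0[OF this]] n show "norm (?E k - measure M {\<omega> \<in> space M. \<eta> t x \<omega> \<in> S}) < r"
        unfolding real_norm_def by linarith
    qed
  qed
qed

section \<open>Invariance of survival and of balls under automorphisms\<close>

lemma flow_map_automorphism:
  assumes "bij \<phi>"
  shows "flow (map (map_prod \<phi> \<phi>) l) (\<phi> z) = \<phi> (flow l z)"
proof (induction l arbitrary: z)
  case (Cons e l)
  have "move (map_prod \<phi> \<phi> e) (\<phi> z) = \<phi> (move e z)"
    using assms by (auto simp: move_def bij_def inj_eq)
  then show ?case using Cons by (simp add: flow_Cons)
qed simp

lemma survival_automorphism:
  assumes bij: "bij \<phi>" and aut: "\<And>a b. adj (\<phi> a) (\<phi> b) \<longleftrightarrow> adj a b" and "finite \<Lambda>"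
  shows "survival (\<phi> ` \<Lambda>) t {\<phi> x} = survival \<Lambda> t {x}"
proof -
  have "flow (map (map_prod \<phi> \<phi>) l) -` {\<phi> x} \<noteq> {} \<longleftrightarrow> flow l -` {x} \<noteq> {}" for l
  proof -
    have "(\<exists>z. flow (map (map_prod \<phi> \<phi>) l) z = \<phi> x) \<longleftrightarrow> (\<exists>z. flow (map (map_prod \<phi> \<phi>) l) (\<phi> z) = \<phi> x)"
      using bij by (metis bij_pointE)
    also have "\<dots> \<longleftrightarrow> (\<exists>z. flow l z = x)"
      using bij unfolding flow_map_automorphism[OF bij] by (auto simp: bij_def inj_eq)
    finally show ?thesis by (auto simp: vimage_def)
  qed
  then show ?thesis
    unfolding survival_def jump_law_automorphism[OF assms] by (simp add: vimage_def)
qed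

lemma image_ball:
  assumes bij: "bij \<phi>" and aut: "\<And>a b. adj (\<phi> a) (\<phi> b) \<longleftrightarrow> adj a b"
  shows "\<phi> ` graph_ball x n = graph_ball (\<phi> x) n"
proof (induction n)
  case (Suc n)
  have "nbrs adj (\<phi> y) = \<phi> ` nbrs adj y" for y
  proof (intro Set.set_eqI iffI)
    fix w assume w: "w \<in> nbrs adj (\<phi> y)"
    obtain z where "w = \<phi> z" using bij by (metis bij_pointE)
    then show "w \<in> \<phi> ` nbrs adj y" using w aut by (auto simp: nbrs_def)
  qed (auto simp: nbrs_def aut)
  then show ?case by (simp add: image_Un image_UN Suc[symmetric])
qed simp

end


section \<open>Asymptotics of the density\<close>

text \<open>\<open>S t x\<close> plays the occupation probability of the infinite system. The limit
  is required along every exhausting family, as neighbours of x are evaluated in balls around x, and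
  vertices are compared by moving the balls.\<close>

locale coalescing_density = vertex_transitive_graph adj D for adj :: "'v \<Rightarrow> 'v \<Rightarrow> bool" and D +
  fixes S :: "real \<Rightarrow> 'v \<Rightarrow> real"
  assumes survival_limit: "exhausting \<Lambda> \<Longrightarrow> 0 \<le> t \<Longrightarrow> (\<lambda>k. survival (\<Lambda> k) t {x}) \<longlonglongrightarrow> S t x"
begin

lemmas ball_limit = survival_limit[OF exhausting_ball]

lemma S_homogeneous:
  assumes t: "0 \<le> t"
  shows "S t x = S t y"
proof -
  obtain \<phi> where \<phi>: "bij \<phi>" "\<And>a b. adj (\<phi> a) (\<phi> b) \<longleftrightarrow> adj a b" "\<phi> x = y"
    using transitive by blast
  have "survival (graph_ball y k) t {y} = survival (graph_ball x k) t {x}" for k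
    using survival_automorphism[OF \<phi>(1,2) finite_ball[of x k], of t x] image_ball[OF \<phi>(1,2), of x k]
    by (simp add: \<phi>(3))
  then have "(\<lambda>k. survival (graph_ball x k) t {x}) \<longlonglongrightarrow> S t y"
    using ball_limit[OF t, where y = y and x = y] by simp
  then show ?thesis
    using ball_limit[OF t, where y = x and x = x] by (rule LIMSEQ_unique[rotated])
qed

lemma S_bounds:
  assumes "0 \<le> t"
  shows "0 \<le> S t x" "S t x \<le> 1"
  using ball_limit[OF assms, where y = x and x = x] survival_bounds
  by (auto intro: LIMSEQ_le_const LIMSEQ_le_const2)

lemma S_antimono:
  assumes "0 \<le> h" "0 \<le> t"
  shows "S (h + t) x \<le> S t x"
  using ball_limit[of "h + t", where y = x and x = x] ball_limit[of t, where y = x and x = x] assms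
  by (intro LIMSEQ_le[of "\<lambda>k. survival (graph_ball x k) (h + t) {x}" _ "\<lambda>k. survival (graph_ball x k) t {x}"])
     (auto intro!: exI[of _ 0] survival_antimono finite_ball)

lemma S_0: "S 0 x = 1"
proof -
  have "survival (graph_ball x k) 0 {x} = 1" for k
    by (simp add: survival_def jump_law_0 finite_ball)
  then show ?thesis
    using ball_limit[of 0, where y = x and x = x] by (simp add: LIMSEQ_const_iff)
qed

text \<open>With equal densities at x and its neighbours, the linear terms of
  \<open>survival_increment\<close> combine to S, leaving - \<delta> S^2. The error constant depends
  on D alone and so survives the limit of growing balls.\<close>

lemma S_increment:
  assumes t: "0 \<le> t" and \<delta>: "0 \<le> \<delta>"
  shows "S t x - \<delta> * (S t x)\<^sup>2 - local_const * \<delta>\<^sup>2 \<le> S (t + \<delta>) x"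
proof -
  let ?f = "\<lambda>k y. survival (graph_ball x k) t {y}"
  have L: "(\<lambda>k. ?f k y) \<longlonglongrightarrow> S t x" for y
    using ball_limit[OF t, where y = x and x = y] S_homogeneous[OF t, of y x] by simp
  have "(\<lambda>k. (1 - \<delta>) * ?f k x + \<delta> / D * (1 - ?f k x) * (\<Sum>v\<in>nbrs adj x. ?f k v) - local_const * \<delta>\<^sup>2)
     \<longlonglongrightarrow> (1 - \<delta>) * S t x + \<delta> / D * (1 - S t x) * (\<Sum>v\<in>nbrs adj x. S t x) - local_const * \<delta>\<^sup>2"
    by (intro tendsto_intros L)
  moreover have "(\<lambda>k. survival (graph_ball x k) (t + \<delta>) {x}) \<longlonglongrightarrow> S (t + \<delta>) x"
    by (rule ball_limit) (use t \<delta> in auto)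
  moreover have "(1 - \<delta>) * ?f k x + \<delta> / D * (1 - ?f k x) * (\<Sum>v\<in>nbrs adj x. ?f k v) - local_const * \<delta>\<^sup>2
      \<le> survival (graph_ball x k) (t + \<delta>) {x}" if "1 \<le> k" for k
    by (rule survival_increment[OF finite_ball t \<delta>]) (rule ball_mono[OF that])
  ultimately have "(1 - \<delta>) * S t x + \<delta> / D * (1 - S t x) * (\<Sum>v\<in>nbrs adj x. S t x) - local_const * \<delta>\<^sup>2
      \<le> S (t + \<delta>) x"
    by (intro LIMSEQ_le) auto
  then show ?thesis
    using D_pos by (simp add: card_nbrs algebra_simps power2_eq_square)
qed

text \<open>A discrete form of integrating S' \<ge> - S^2: take n steps of length h/n, bound S along
  the way by its value at t, and let the sum of the quadratic errors vanish.\<close>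

lemma S_drop:
  assumes t: "0 \<le> t" and h: "0 \<le> h"
  shows "S t x - S (h + t) x \<le> h * (S t x)\<^sup>2"
proof -
  have K: "0 \<le> local_const" by (simp add: local_const_def)
  have steps: "S t x - real i * (\<delta> * (S t x)\<^sup>2 + local_const * \<delta>\<^sup>2) \<le> S (t + real i * \<delta>) x"
    if \<delta>: "0 \<le> \<delta>" for \<delta> i
  proof (induction i)
    case (Suc i)
    let ?s = "t + real i * \<delta>"
    have s: "0 \<le> ?s" using t \<delta> by simp
    have "S ?s x \<le> S t x" using S_antimono[of "real i * \<delta>" t x] t \<delta> by (simp add: add.commute)
    then have "\<delta> * (S ?s x)\<^sup>2 \<le> \<delta> * (S t x)\<^sup>2"
      using S_bounds[OF s] \<delta> by (intro mult_left_mono power_mono) auto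
    then have "S ?s x - \<delta> * (S t x)\<^sup>2 - local_const * \<delta>\<^sup>2 \<le> S (?s + \<delta>) x"
      using S_increment[OF s \<delta>, of x] by linarith
    moreover have "t + real (Suc i) * \<delta> = ?s + \<delta>" by (simp add: algebra_simps)
    ultimately show ?case using Suc by (simp add: algebra_simps)
  qed simp
  have "S t x - S (h + t) x \<le> h * (S t x)\<^sup>2 + local_const * h\<^sup>2 / real n" if "0 < n" for n
  proof -
    have e1: "real n * (h / n * (S t x)\<^sup>2 + local_const * (h / n)\<^sup>2) = h * (S t x)\<^sup>2 + local_const * h\<^sup>2 / real n"
      using that by (simp add: field_simps power2_eq_square)
    have e2: "t + real n * (h / n) = h + t" using that by simp
    have "0 \<le> h / n" using h by simp
    from steps[OF this, of n] show ?thesis unfolding e1 e2 by linarith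
  qed
  then have "\<forall>\<^sub>F n in sequentially. S t x - S (h + t) x \<le> h * (S t x)\<^sup>2 + local_const * h\<^sup>2 / real n"
    by (intro eventually_sequentiallyI[of 1]) auto
  moreover have "(\<lambda>n. h * (S t x)\<^sup>2 + local_const * h\<^sup>2 / real n) \<longlonglongrightarrow> h * (S t x)\<^sup>2 + 0"
    by (intro tendsto_intros lim_const_over_n)
  ultimately show ?thesis
    by (intro tendsto_lowerbound[of _ "h * (S t x)\<^sup>2" sequentially]) auto
qed

text \<open>By \<open>S_drop\<close> and S^2 \<le> S, a time step of 1/2 loses at most half of
  S.\<close>

lemma S_pos:
  assumes "0 \<le> t"
  shows "0 < S t x"
proof -
  have "0 < S (real n / 2) x" for n
  proof (induction n)
    case 0
    then show ?case by (simp add: S_0)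
  next
    case (Suc n)
    let ?s = "S (real n / 2) x"
    have "?s - S (1 / 2 + real n / 2) x \<le> 1 / 2 * ?s\<^sup>2" by (rule S_drop) auto
    moreover have "?s\<^sup>2 \<le> ?s" using S_bounds[of "real n / 2" x] by (simp add: power2_eq_square mult_left_le)
    ultimately have "?s / 2 \<le> S (1 / 2 + real n / 2) x" by linarith
    moreover have "1 / 2 + real n / 2 = real (Suc n) / 2" by simp
    ultimately show ?case using Suc by simp
  qed
  moreover obtain n :: nat where "2 * t \<le> n" using real_arch_simple by blast
  then have "S (real n / 2) x \<le> S t x"
    using S_antimono[of "real n / 2 - t" t x] assms by simp
  ultimately show ?thesis by (meson less_le_trans)
qed

lemma card_ball_unbounded: "\<forall>\<^sub>F k in sequentially. j < card (graph_ball x k)"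
proof -
  obtain F :: "'v set" where F: "finite F" "card F = Suc j"
    using infinite_arbitrarily_large[OF infinite_vertices] by blast
  have "\<forall>\<^sub>F k in sequentially. \<forall>y\<in>F. graph_ball y 0 \<subseteq> graph_ball x k"
    using exhausting_ball[of x] unfolding exhausting_def by (intro eventually_ball_finite[OF F(1)]) blast
  then show ?thesis
  proof eventually_elim
    case (elim k)
    then have "F \<subseteq> graph_ball x k" by auto
    from card_mono[OF finite_ball this] show ?case using F(2) by simp
  qed
qed

text \<open>A cluster of size \<open>j\<close> loses a site within a fixed time with a probability bounded below; so
  small clusters are at most as likely as the drop in density, up to a constant.\<close>

lemma size_prob_small:
  assumes g: "\<And>t. 0 \<le> t \<Longrightarrow> 0 < g t" "\<And>h t. 0 \<le> h \<Longrightarrow> 0 \<le> t \<Longrightarrow> g (h + t) \<le> g t"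
    and drop: "\<And>h \<epsilon>. 0 < h \<Longrightarrow> 0 < \<epsilon> \<Longrightarrow> \<forall>\<^sub>F t in at_top. S t x - S (h + t) x \<le> \<epsilon> * g t"
  shows "0 < \<epsilon> \<Longrightarrow> \<forall>\<^sub>F t in at_top. \<forall>\<^sub>F k in sequentially. size_prob (graph_ball x k) t x (Suc j) \<le> \<epsilon> * g t"
proof (induction j arbitrary: \<epsilon>)
  case 0
  let ?h = "loss_time 1" and ?c = "loss_rate 1"
  have pos: "0 < ?h" "0 < ?c" by (rule loss_pos)+
  \<comment> \<open>The factor 1/2 makes the inequality for the limit strict, so that it passes to
    all large k.\<close>
  have "0 < \<epsilon> * ?c / 2" using 0 pos by simp
  from drop[OF pos(1) this] eventually_ge_at_top[of 0] show ?case
  proof eventually_elim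
    case (elim t)
    have "(\<lambda>k. survival (graph_ball x k) t {x} - survival (graph_ball x k) (?h + t) {x}) \<longlonglongrightarrow> S t x - S (?h + t) x"
      using elim(2) pos by (intro tendsto_diff ball_limit) auto
    moreover have "S t x - S (?h + t) x < \<epsilon> * ?c * g t"
    proof -
      have "0 < \<epsilon> * ?c * g t" using 0 pos g(1)[OF elim(2)] by simp
      then show ?thesis using elim(1) by simp
    qed
    ultimately have "\<forall>\<^sub>F k in sequentially. survival (graph_ball x k) t {x} - survival (graph_ball x k) (?h + t) {x} < \<epsilon> * ?c * g t"
      by (rule order_tendstoD(2))
    with card_ball_unbounded[of 1 x] show ?case
    proof eventually_elim
      case (elim k)
      have "?c * size_prob (graph_ball x k) t x 1 \<le> ?c * (\<epsilon> * g t)"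
        using survival_loss[OF \<open>0 \<le> t\<close>, of x k] elim by (simp add: mult_ac)
      then show ?case using pos by simp
    qed
  qed
next
  case (Suc j)
  let ?j = "Suc (Suc j)"
  let ?h = "loss_time ?j" and ?c = "loss_rate ?j"
  have pos: "0 < ?h" "0 < ?c" by (rule loss_pos)+
  have "0 < \<epsilon> * ?c" using Suc.prems pos by simp
  from Suc.IH[OF this] obtain t0 where
    t0: "\<And>t. t0 \<le> t \<Longrightarrow> \<forall>\<^sub>F k in sequentially. size_prob (graph_ball x k) t x (Suc j) \<le> \<epsilon> * ?c * g t"
    by (auto simp: eventually_at_top_linorder)
  show ?case
    using eventually_ge_at_top[of t0] eventually_ge_at_top[of 0]
  proof eventually_elim
    case (elim t)
    \<comment> \<open>The bound for the smaller size is used at the later time; as g decreases, it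
      is at most the bound with g at t.\<close>
    have "t0 \<le> ?h + t" using elim pos(1) by simp
    from t0[OF this] card_ball_unbounded[of ?j x] show ?case
    proof eventually_elim
      case (elim k)
      have "?c * size_prob (graph_ball x k) t x ?j \<le> size_prob (graph_ball x k) (?h + t) x (Suc j)"
        using size_prob_loss[OF \<open>0 \<le> t\<close> _ elim(2)] by simp
      also have "\<dots> \<le> \<epsilon> * ?c * g (?h + t)" by (rule elim(1))
      also have "\<dots> \<le> \<epsilon> * ?c * g t"
        using g(2)[of ?h t] pos \<open>0 \<le> t\<close> Suc.prems by (intro mult_left_mono) auto
      finally have "?c * size_prob (graph_ball x k) t x ?j \<le> ?c * (\<epsilon> * g t)" by (simp add: mult_ac)
      then show ?case using pos by simp
    qed
  qed
qed

text \<open>A decreasing function bounded below is eventually within \<epsilon> of its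
  infimum.\<close>

lemma S_drop_uniform:
  assumes "0 < \<epsilon>"
  shows "\<forall>\<^sub>F t in at_top. \<forall>h\<ge>0. S t x - S (h + t) x \<le> \<epsilon>"
proof -
  define L where "L = Inf ((\<lambda>t. S t x) ` {0..})"
  have bdd: "bdd_below ((\<lambda>t. S t x) ` {0..})"
    using S_bounds by (intro bdd_belowI[of _ 0]) auto
  have "\<exists>y\<in>(\<lambda>t. S t x) ` {0..}. y < L + \<epsilon>"
    using cInf_lessD[of "(\<lambda>t. S t x) ` {0..}" "L + \<epsilon>"] assms by (simp add: L_def)
  then obtain t0 where t0: "0 \<le> t0" "S t0 x < L + \<epsilon>" by auto
  show ?thesis
    using eventually_ge_at_top[of t0]
  proof eventually_elim
    case (elim t)
    show ?case
    proof (intro allI impI)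
      fix h :: real assume h: "0 \<le> h"
      have "L \<le> S (h + t) x" unfolding L_def by (rule cInf_lower[OF _ bdd]) (use elim t0 h in auto)
      moreover have "S t x \<le> S t0 x" using S_antimono[of "t - t0" t0 x] elim t0 by simp
      ultimately show "S t x - S (h + t) x \<le> \<epsilon>" using t0 by linarith
    qed
  qed
qed

text \<open>The \<open>max 1 J\<close> keeps the empty cluster out of the tail when J = 0.\<close>

lemma survival_split:
  "survival (graph_ball x k) t {x} =
     (\<Sum>j=1..<J. size_prob (graph_ball x k) t x j) +
     measure_pmf.prob (jump_law (graph_ball x k) t) {l. max 1 J \<le> card (flow l -` {x})}"
proof -
  let ?P = "measure_pmf.prob (jump_law (graph_ball x k) t)"
  have ne: "flow l -` {x} \<noteq> {} \<longleftrightarrow> 1 \<le> card (flow l -` {x})" for l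
    by (simp add: Suc_le_eq card_gt_0_iff finite_vimage_flow)
  have eq: "{l. flow l -` {x} \<noteq> {}} =
      (\<Union>j\<in>{1..<J}. {l. card (flow l -` {x}) = j}) \<union> {l. max 1 J \<le> card (flow l -` {x})}"
    unfolding ne by auto
  have "?P {l. flow l -` {x} \<noteq> {}} = ?P (\<Union>j\<in>{1..<J}. {l. card (flow l -` {x}) = j}) + ?P {l. max 1 J \<le> card (flow l -` {x})}"
    unfolding eq by (rule measure_pmf.finite_measure_Union) auto
  also have "?P (\<Union>j\<in>{1..<J}. {l. card (flow l -` {x}) = j}) = (\<Sum>j=1..<J. ?P {l. card (flow l -` {x}) = j})"
  proof (rule measure_pmf.finite_measure_finite_Union)
    show "disjoint_family_on (\<lambda>j. {l. card (flow l -` {x}) = j}) {1..<J}"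
      unfolding disjoint_family_on_def by blast
  qed simp_all
  finally show ?thesis unfolding survival_def size_prob_def .
qed

text \<open>The comparison function g is left open for two uses: g = 1 gives that S tends to 0, and
  with this \<open>S_drop\<close> permits g = S.\<close>

lemma sum_size_prob_small:
  assumes g: "\<And>t. 0 \<le> t \<Longrightarrow> 0 < g t" "\<And>h t. 0 \<le> h \<Longrightarrow> 0 \<le> t \<Longrightarrow> g (h + t) \<le> g t"
    and drop: "\<And>h \<epsilon>. 0 < h \<Longrightarrow> 0 < \<epsilon> \<Longrightarrow> \<forall>\<^sub>F t in at_top. S t x - S (h + t) x \<le> \<epsilon> * g t"
    and \<epsilon>: "0 < \<epsilon>"
  shows "\<forall>\<^sub>F t in at_top. \<forall>\<^sub>F k in sequentially. (\<Sum>j=1..<J. size_prob (graph_ball x k) t x j) \<le> \<epsilon> * g t"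
proof -
  have "\<forall>\<^sub>F t in at_top. \<forall>j\<in>{1..<J}. \<forall>\<^sub>F k in sequentially. size_prob (graph_ball x k) t x j \<le> \<epsilon> / J * g t"
  proof (rule eventually_ball_finite)
    show "\<forall>j\<in>{1..<J}. \<forall>\<^sub>F t in at_top. \<forall>\<^sub>F k in sequentially. size_prob (graph_ball x k) t x j \<le> \<epsilon> / J * g t"
    proof
      fix j assume j: "j \<in> {1..<J}"
      then have "0 < \<epsilon> / J" "j = Suc (j - 1)" using \<epsilon> by auto
      then show "\<forall>\<^sub>F t in at_top. \<forall>\<^sub>F k in sequentially. size_prob (graph_ball x k) t x j \<le> \<epsilon> / J * g t"
        using size_prob_small[of g x "\<epsilon> / J" "j - 1"] g drop by simp
    qed
  qed simp
  with eventually_ge_at_top[of 0] show ?thesis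
  proof eventually_elim
    case (elim t)
    have "\<forall>\<^sub>F k in sequentially. \<forall>j\<in>{1..<J}. size_prob (graph_ball x k) t x j \<le> \<epsilon> / J * g t"
      using elim(2) by (intro eventually_ball_finite) auto
    then show ?case
    proof eventually_elim
      case (elim k)
      have "(\<Sum>j=1..<J. size_prob (graph_ball x k) t x j) \<le> (\<Sum>j=1..<J. \<epsilon> / J * g t)"
        using elim by (intro sum_mono) auto
      also have "\<dots> = real (J - 1) * (\<epsilon> / J * g t)" by simp
      also have "\<dots> \<le> real J * (\<epsilon> / J * g t)"
        using \<epsilon> g(1)[OF \<open>0 \<le> t\<close>] by (intro mult_right_mono) auto
      also have "\<dots> \<le> \<epsilon> * g t"
        using \<epsilon> g(1)[OF \<open>0 \<le> t\<close>] by (cases "J = 0") auto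
      finally show ?case .
    qed
  qed
qed

lemma S_tendsto_0: "((\<lambda>t. S t x) \<longlongrightarrow> 0) at_top"
proof (rule tendstoI)
  fix e :: real assume e: "0 < e"
  \<comment> \<open>Clusters of at least J sites then have probability at most e/2 by
    \<open>prob_large_cluster\<close>; the smaller ones contribute e/3.\<close>
  obtain J :: nat where J: "2 / e < J" using reals_Archimedean2 by blast
  then have J0: "0 < real J" using e by (metis divide_pos_pos less_trans zero_less_numeral)
  have "\<forall>\<^sub>F t in at_top. \<forall>\<^sub>F k in sequentially. (\<Sum>j=1..<J. size_prob (graph_ball x k) t x j) \<le> e / 3 * 1"
  proof (rule sum_size_prob_small)
    fix h \<epsilon> :: real assume h: "0 < h" and "0 < \<epsilon>"
    show "\<forall>\<^sub>F t in at_top. S t x - S (h + t) x \<le> \<epsilon> * 1"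
      using S_drop_uniform[OF \<open>0 < \<epsilon>\<close>, of x]
    proof eventually_elim
      case (elim t)
      then show ?case using h by simp
    qed
  qed (use e in auto)
  with eventually_ge_at_top[of 0] show "\<forall>\<^sub>F t in at_top. dist (S t x) 0 < e"
  proof eventually_elim
    case (elim t)
    have "\<forall>\<^sub>F k in sequentially. survival (graph_ball x k) t {x} \<le> e / 3 + e / 2"
      using elim(2)
    proof eventually_elim
      case (elim k)
      let ?p = "measure_pmf.prob (jump_law (graph_ball x k) t) {l. J \<le> card (flow l -` {x})}"
      have "real J * ?p \<le> 1" by (rule prob_large_cluster) (use finite_ball \<open>0 \<le> t\<close> in auto)
      moreover have "1 \<le> e / 2 * J" using J e by (simp add: field_simps)
      ultimately have "real J * ?p \<le> real J * (e / 2)" by (simp add: mult_ac)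
      then have "?p \<le> e / 2" using J0 by simp
      moreover have "measure_pmf.prob (jump_law (graph_ball x k) t) {l. max 1 J \<le> card (flow l -` {x})} \<le> ?p"
        by (rule measure_pmf.finite_measure_mono) auto
      ultimately show ?case unfolding survival_split[of x k t J] using elim by linarith
    qed
    then have "S t x \<le> e / 3 + e / 2"
      using ball_limit[OF elim(1), where y = x and x = x] by (intro tendsto_upperbound[of _ "S t x" sequentially]) auto
    then show ?case using S_bounds(1)[OF elim(1), of x] e by (simp add: dist_real_def)
  qed
qed

text \<open>On a cluster of n \<ge> 1 sites the two integrands differ by 2/3 (1/2)^n. From size J on
  this is at most 2/3 \<epsilon>, and the smaller sizes together have probability at most \<epsilon>
  S.\<close>

theorem density_ratio:
  assumes A: "\<And>t. 0 \<le> t \<Longrightarrow> (\<lambda>k. measure_pmf.expectation (jump_law (graph_ball x k) t)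
      (\<lambda>l. 2 / 3 * (1 - (- 1 / 2) ^ card (flow l -` {x})))) \<longlonglongrightarrow> A t"
  shows "A \<sim>[at_top] (\<lambda>t. 2 / 3 * S t x)"
  unfolding asymp_equiv_altdef
proof (rule landau_o.smallI)
  fix c :: real assume c: "0 < c"
  \<comment> \<open>Small and large clusters contribute \<epsilon> each, and 2 \<epsilon> \<le>
    c.\<close>
  define \<epsilon> where "\<epsilon> = c / 3"
  have \<epsilon>: "0 < \<epsilon>" using c by (simp add: \<epsilon>_def)
  obtain J where J: "(1 / 2 :: real) ^ J < \<epsilon>" using real_arch_pow_inv[OF \<epsilon>, of "1 / 2"] by auto
  have "\<forall>\<^sub>F t in at_top. \<forall>\<^sub>F k in sequentially. (\<Sum>j=1..<J. size_prob (graph_ball x k) t x j) \<le> \<epsilon> * S t x"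
  proof (rule sum_size_prob_small)
    fix h e :: real assume h: "0 < h" and e: "0 < e"
    \<comment> \<open>As soon as S < e/h, the drop of at most h S^2 is at most e S.\<close>
    have "\<forall>\<^sub>F t in at_top. S t x < e / h"
      by (rule order_tendstoD(2)[OF S_tendsto_0]) (use h e in simp)
    with eventually_ge_at_top[of 0] show "\<forall>\<^sub>F t in at_top. S t x - S (h + t) x \<le> e * S t x"
    proof eventually_elim
      case (elim t)
      have "S t x - S (h + t) x \<le> h * (S t x)\<^sup>2" by (rule S_drop) (use elim h in auto)
      also have "\<dots> = (h * S t x) * S t x" by (simp add: power2_eq_square)
      also have "\<dots> \<le> e * S t x"
        using elim h S_bounds[OF elim(1), of x] by (intro mult_right_mono) (auto simp: field_simps)
      finally show ?case .
    qed
  qed (use \<epsilon> S_pos S_antimono in auto)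
  with eventually_ge_at_top[of 0] show "\<forall>\<^sub>F t in at_top. norm (A t - 2 / 3 * S t x) \<le> c * norm (2 / 3 * S t x)"
  proof eventually_elim
    case (elim t)
    let ?n = "\<lambda>l. card (flow l -` {x})"
    have le: "\<forall>\<^sub>F k in sequentially.
       \<bar>measure_pmf.expectation (jump_law (graph_ball x k) t) (\<lambda>l. 2 / 3 * (1 - (- 1 / 2) ^ ?n l)) -
         2 / 3 * survival (graph_ball x k) t {x}\<bar> \<le> 2 / 3 * (\<epsilon> * S t x + \<epsilon> * survival (graph_ball x k) t {x})"
      using elim(2)
    proof eventually_elim
      case (elim k)
      let ?E = "measure_pmf.expectation (jump_law (graph_ball x k) t)"
      have b: "\<bar>2 / 3 * (1 - y) - 2 / 3 * z\<bar> \<le> 3"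
        if "- 1 / 2 \<le> y" "y \<le> 1" "0 \<le> z" "z \<le> 1" for y z :: real
        using that by (intro abs_leI) (simp_all add: field_simps)
      have i1: "integrable (jump_law (graph_ball x k) t) (\<lambda>l. 2 / 3 * (1 - (- 1 / 2) ^ ?n l) :: real)"
      proof (rule integrable_pmf_bounded)
        fix l show "\<bar>2 / 3 * (1 - (- 1 / 2) ^ ?n l) :: real\<bar> \<le> 3"
          using b[OF minus_half_power_bounds order.refl zero_le_one, of "?n l"]
          by (simp only: mult_zero_right diff_zero)
      qed
      have i2: "integrable (jump_law (graph_ball x k) t) (\<lambda>l. of_bool (flow l -` {x} \<noteq> {}) :: real)"
        by (rule integrable_pmf_bounded[where B = 1]) simp
      have "\<bar>?E (\<lambda>l. 2 / 3 * (1 - (- 1 / 2) ^ ?n l)) - 2 / 3 * survival (graph_ball x k) t {x}\<bar> =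
        \<bar>?E (\<lambda>l. 2 / 3 * (1 - (- 1 / 2) ^ ?n l) - 2 / 3 * of_bool (flow l -` {x} \<noteq> {}))\<bar>"
        unfolding survival_def prob_pmf_of_bool using i1 i2 by simp
      also have "\<dots> \<le> ?E (\<lambda>l. \<bar>2 / 3 * (1 - (- 1 / 2) ^ ?n l) - 2 / 3 * of_bool (flow l -` {x} \<noteq> {})\<bar>)"
        by (rule integral_abs_bound)
      also have "\<dots> \<le> ?E (\<lambda>l. 2 / 3 * ((\<Sum>j=1..<J. of_bool (?n l = j)) + \<epsilon> * of_bool (flow l -` {x} \<noteq> {})))"
      proof (rule expectation_pmf_mono[where B = 3 and B' = "real J + \<epsilon>"])
        fix l
        show "\<bar>2 / 3 * (1 - (- 1 / 2) ^ ?n l) - 2 / 3 * of_bool (flow l -` {x} \<noteq> {})\<bar> \<le>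
          2 / 3 * ((\<Sum>j=1..<J. of_bool (?n l = j)) + \<epsilon> * of_bool (flow l -` {x} \<noteq> {}))"
        proof (cases "flow l -` {x} = {}")
          case False
          then have n: "1 \<le> ?n l" by (simp add: Suc_le_eq card_gt_0_iff finite_vimage_flow)
          have abs: "\<bar>(- 1 / 2 :: real) ^ ?n l\<bar> = (1 / 2) ^ ?n l" by (simp add: power_abs)
          have ob: "of_bool (flow l -` {x} \<noteq> {}) = (1 :: real)" using False by simp
          have e: "2 / 3 * (1 - y) - 2 / 3 * 1 = - (2 / 3 * y)" for y :: real by (simp add: field_simps)
          have "(1 / 2 :: real) ^ ?n l \<le> (\<Sum>j=1..<J. of_bool (?n l = j)) + \<epsilon>"
          proof (cases "?n l < J")
            case True
            have "(\<Sum>j=1..<J. of_bool (?n l = j) :: real) = (\<Sum>j=1..<J. if j = ?n l then 1 else 0)"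
              by (intro sum.cong) auto
            then have "(\<Sum>j=1..<J. of_bool (?n l = j) :: real) = 1" using n True by simp
            moreover have "(1 / 2 :: real) ^ ?n l \<le> 1" by (simp add: power_le_one)
            ultimately show ?thesis using \<epsilon> by linarith
          next
            case False
            then have "(1 / 2 :: real) ^ ?n l \<le> (1 / 2) ^ J" by (intro power_decreasing) auto
            moreover have "0 \<le> (\<Sum>j=1..<J. of_bool (?n l = j) :: real)" by (intro sum_nonneg) auto
            ultimately show ?thesis using J by linarith
          qed
          from mult_left_mono[OF this, of "2 / 3"] show ?thesis
            unfolding ob e abs_minus_cancel abs_mult abs by simp
        qed simp
        show "\<bar>\<bar>2 / 3 * (1 - (- 1 / 2) ^ ?n l) - 2 / 3 * of_bool (flow l -` {x} \<noteq> {}) :: real\<bar>\<bar> \<le> 3"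
          unfolding abs_idempotent by (rule b[OF minus_half_power_bounds]) auto
        have "0 \<le> (\<Sum>j=1..<J. of_bool (?n l = j) :: real)" by (intro sum_nonneg) auto
        moreover have "(\<Sum>j=1..<J. of_bool (?n l = j) :: real) \<le> (\<Sum>j=1..<J. 1)" by (intro sum_mono) auto
        moreover have "(\<Sum>j=1..<J. 1 :: real) \<le> real J" by simp
        moreover have "0 \<le> \<epsilon> * of_bool (flow l -` {x} \<noteq> {})" "\<epsilon> * of_bool (flow l -` {x} \<noteq> {}) \<le> \<epsilon>"
          using \<epsilon> by auto
        moreover have "\<bar>2 / 3 * (s + e)\<bar> \<le> b + \<epsilon>"
          if "0 \<le> s" "s \<le> u" "u \<le> b" "0 \<le> e" "e \<le> \<epsilon>" for s u b e :: real
          using that by (intro abs_leI) (simp_all add: field_simps)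
        ultimately show "\<bar>2 / 3 * ((\<Sum>j=1..<J. of_bool (?n l = j)) + \<epsilon> * of_bool (flow l -` {x} \<noteq> {}))\<bar> \<le> real J + \<epsilon>"
          by blast
      qed
      also have "\<dots> = 2 / 3 * ((\<Sum>j=1..<J. size_prob (graph_ball x k) t x j) + \<epsilon> * survival (graph_ball x k) t {x})"
      proof -
        have i3: "integrable (jump_law (graph_ball x k) t) (\<lambda>l. of_bool (Q l) :: real)" for Q
          by (rule integrable_pmf_bounded[where B = 1]) simp
        show ?thesis
          unfolding survival_def size_prob_def prob_pmf_of_bool
          by (simp only: integral_mult_right_zero Bochner_Integration.integral_add
              Bochner_Integration.integral_sum i3 integrable_mult_right Bochner_Integration.integrable_sum)
      qed
      also have "\<dots> \<le> 2 / 3 * (\<epsilon> * S t x + \<epsilon> * survival (graph_ball x k) t {x})" using elim by simp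
      finally show ?case .
    qed
    have L: "(\<lambda>k. survival (graph_ball x k) t {x}) \<longlonglongrightarrow> S t x"
      by (rule ball_limit[OF elim(1)])
    have "(\<lambda>k. 2 / 3 * (\<epsilon> * S t x + \<epsilon> * survival (graph_ball x k) t {x}))
        \<longlonglongrightarrow> 2 / 3 * (\<epsilon> * S t x + \<epsilon> * S t x)"
      by (intro tendsto_intros L)
    moreover have "(\<lambda>k. \<bar>measure_pmf.expectation (jump_law (graph_ball x k) t) (\<lambda>l. 2 / 3 * (1 - (- 1 / 2) ^ ?n l)) -
         2 / 3 * survival (graph_ball x k) t {x}\<bar>) \<longlonglongrightarrow> \<bar>A t - 2 / 3 * S t x\<bar>"
      by (rule tendsto_rabs[OF tendsto_diff[OF A[OF elim(1)] tendsto_mult_left[OF L]]])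
    ultimately have "\<bar>A t - 2 / 3 * S t x\<bar> \<le> 2 / 3 * (\<epsilon> * S t x + \<epsilon> * S t x)"
      using le by (rule tendsto_le[OF sequentially_bot])
    also have "\<dots> \<le> c * (2 / 3 * S t x)"
      using S_bounds(1)[OF elim(1), of x] c by (simp add: \<epsilon>_def mult_right_mono)
    finally show ?case using S_bounds(1)[OF elim(1), of x] by simp
  qed
qed

end

section \<open>The graphs of the theorem\<close>

text \<open>The vertex \<open>undefined\<close> only serves as a reference: transitivity gives all
  vertices its degree.\<close>

lemma vertex_transitive_graphI:
  fixes adj :: "'v \<Rightarrow> 'v \<Rightarrow> bool"
  assumes g: "simple_connected_graph adj" and inf: "infinite (UNIV :: 'v set)"
    and tr: "\<And>u v. \<exists>\<phi>. bij \<phi> \<and> (\<forall>a b. adj (\<phi> a) (\<phi> b) \<longleftrightarrow> adj a b) \<and> \<phi> u = v"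
  shows "vertex_transitive_graph adj (card (nbrs adj undefined))"
proof
  fix u :: 'v
  obtain \<phi> where \<phi>: "bij \<phi>" "\<And>a b. adj (\<phi> a) (\<phi> b) \<longleftrightarrow> adj a b" "\<phi> undefined = u"
    using tr by blast
  have "nbrs adj u = \<phi> ` nbrs adj undefined"
  proof (intro Set.set_eqI iffI)
    fix w assume w: "w \<in> nbrs adj u"
    obtain z where "w = \<phi> z" using \<phi>(1) by (metis bij_pointE)
    then show "w \<in> \<phi> ` nbrs adj undefined" using w \<phi>(2,3) by (auto simp: nbrs_def)
  qed (use \<phi>(2,3) in \<open>auto simp: nbrs_def\<close>)
  moreover have "inj_on \<phi> (nbrs adj undefined)"
    using bij_is_inj[OF \<phi>(1)] inj_on_subset by blast
  ultimately show "card (nbrs adj u) = card (nbrs adj undefined)"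
    by (simp add: card_image)
qed (use g inf tr in \<open>auto simp: simple_connected_graph_def\<close>)

text \<open>Translations act transitively, and the constant vectors already are infinitely many
  points.\<close>

lemma lattice_infinite_transitive:
  fixes adj :: "'v \<Rightarrow> 'v \<Rightarrow> bool"
  assumes "is_integer_lattice adj"
  shows "infinite (UNIV :: 'v set)" "\<exists>\<phi>. bij \<phi> \<and> (\<forall>a b. adj (\<phi> a) (\<phi> b) \<longleftrightarrow> adj a b) \<and> \<phi> u = v"
proof -
  obtain d f where d: "0 < d" and f: "bij_betw f (UNIV :: 'v set) {xs :: int list. length xs = d}"
    and adj: "\<And>u v. adj u v \<longleftrightarrow> (\<Sum>i<d. \<bar>f u ! i - f v ! i\<bar>) = 1"
    using assms unfolding is_integer_lattice_def by blast
  have "infinite {xs :: int list. length xs = d}"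
  proof -
    have "inj (replicate d :: int \<Rightarrow> int list)" using d by (auto intro!: injI)
    then have "infinite (range (replicate d :: int \<Rightarrow> int list))"
      by (simp add: finite_image_iff infinite_UNIV_int)
    moreover have "range (replicate d :: int \<Rightarrow> int list) \<subseteq> {xs. length xs = d}" by auto
    ultimately show ?thesis by (rule infinite_super[rotated])
  qed
  then show "infinite (UNIV :: 'v set)" using bij_betw_finite[OF f] by simp
  \<comment> \<open>In coordinates, the translation that takes a to b.\<close>
  define \<tau> where "\<tau> a b xs = map (\<lambda>i. xs ! i - f a ! i + f b ! i) [0..<d]" for a b :: 'v and xs :: "int list"
  define g where "g = inv_into UNIV f"
  have fg: "f (g xs) = xs" if "length xs = d" for xs
    using f that unfolding g_def bij_betw_def by (intro f_inv_into_f) auto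
  have len: "length (f a) = d" for a using f by (auto simp: bij_betw_def)
  have gf: "g (f a) = a" for a using f unfolding g_def bij_betw_def by (intro inv_into_f_f) auto
  define \<phi> where "\<phi> a b w = g (\<tau> a b (f w))" for a b w
  have f\<phi>: "f (\<phi> a b w) = \<tau> a b (f w)" for a b w
    unfolding \<phi>_def by (rule fg) (simp add: \<tau>_def)
  have inv: "\<phi> b a (\<phi> a b w) = w" for a b w
  proof -
    have "f (\<phi> b a (\<phi> a b w)) = f w"
      unfolding f\<phi> by (rule nth_equalityI) (auto simp: \<tau>_def len)
    then show ?thesis by (metis gf)
  qed
  have "bij (\<phi> u v)" by (rule bij_betwI[of _ _ _ "\<phi> v u"]) (auto simp: inv)
  moreover have "adj (\<phi> u v a) (\<phi> u v b) \<longleftrightarrow> adj a b" for a b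
    unfolding adj f\<phi> by (simp add: \<tau>_def)
  moreover have "\<phi> u v u = v"
  proof -
    have "f (\<phi> u v u) = f v" unfolding f\<phi> by (rule nth_equalityI) (auto simp: \<tau>_def len)
    then show ?thesis by (metis gf)
  qed
  ultimately show "\<exists>\<phi>. bij \<phi> \<and> (\<forall>a b. adj (\<phi> a) (\<phi> b) \<longleftrightarrow> adj a b) \<and> \<phi> u = v" by blast
qed

text \<open>An infinite orbit requires infinitely many vertices, and the elements of the group
  preserve adjacency.\<close>

lemma group_infinite_transitive:
  fixes adj :: "'v \<Rightarrow> 'v \<Rightarrow> bool"
  assumes "automorphism_subgroup adj \<Gamma>" "transitive_action \<Gamma>" "infinitely_accessible adj \<Gamma>"
  shows "infinite (UNIV :: 'v set)" "\<exists>\<phi>. bij \<phi> \<and> (\<forall>a b. adj (\<phi> a) (\<phi> b) \<longleftrightarrow> adj a b) \<and> \<phi> u = v"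
proof -
  show "infinite (UNIV :: 'v set)"
    using assms(3) unfolding infinitely_accessible_def by (metis rev_finite_subset subset_UNIV)
  obtain \<phi> where "\<phi> \<in> \<Gamma>" "\<phi> u = v"
    using assms(2) unfolding transitive_action_def moving_def by blast
  then show "\<exists>\<phi>. bij \<phi> \<and> (\<forall>a b. adj (\<phi> a) (\<phi> b) \<longleftrightarrow> adj a b) \<and> \<phi> u = v"
    using assms(1) unfolding automorphism_subgroup_def kernel_automorphisms_def by blast
qed

theorem theorem4:
  fixes adj :: "'v \<Rightarrow> 'v \<Rightarrow> bool" and x0 :: 'v
    and M :: "'a measure" and \<xi> :: "real \<Rightarrow> 'v \<Rightarrow> 'a \<Rightarrow> int"
    and M' :: "'b measure" and \<zeta> :: "real \<Rightarrow> 'v \<Rightarrow> 'b \<Rightarrow> nat"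
  assumes "simple_connected_graph adj"
    and "is_integer_lattice adj \<or>
         ((\<exists>\<Gamma>. automorphism_subgroup adj \<Gamma> \<and> transitive_action \<Gamma> \<and> unimodular_action \<Gamma> \<and>
               infinitely_accessible adj \<Gamma>) \<and>
          srw_transient adj)"
    and "dlacs adj M \<xi>"
    and "coalescing_random_walk adj M' \<zeta>"
  shows "(\<lambda>t. measure M {\<omega> \<in> space M. \<xi> t x0 \<omega> \<noteq> 0})
           \<sim>[at_top] (\<lambda>t. 2 / 3 * measure M' {\<omega> \<in> space M'. \<zeta> t x0 \<omega> = 1})"
proof -
  have "infinite (UNIV :: 'v set) \<and> (\<forall>u v. \<exists>\<phi>. bij \<phi> \<and> (\<forall>a b. adj (\<phi> a) (\<phi> b) \<longleftrightarrow> adj a b) \<and> \<phi> u = v)"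
    using assms(2)
  proof
    assume "is_integer_lattice adj"
    from lattice_infinite_transitive[OF this] show ?thesis by simp
  next
    assume "(\<exists>\<Gamma>. automorphism_subgroup adj \<Gamma> \<and> transitive_action \<Gamma> \<and> unimodular_action \<Gamma> \<and>
               infinitely_accessible adj \<Gamma>) \<and> srw_transient adj"
    then obtain \<Gamma> where "automorphism_subgroup adj \<Gamma>" "transitive_action \<Gamma>" "infinitely_accessible adj \<Gamma>"
      by blast
    from group_infinite_transitive[OF this] show ?thesis by simp
  qed
  then interpret vertex_transitive_graph adj "card (nbrs adj undefined)"
    using assms(1) by (intro vertex_transitive_graphI) auto
  obtain \<eta> where \<eta>: "reacting_walks adj annihilate_coalesce (charge_law 1) M \<eta>"
    "\<And>t x \<omega>. 0 \<le> t \<Longrightarrow> \<omega> \<in> space M \<Longrightarrow> \<xi> t x \<omega> = charge (\<eta> t x \<omega>)"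
    using assms(3) unfolding dlacs_def charge_law_1[symmetric] by blast
  obtain \<eta>' where \<eta>': "reacting_walks adj (\<lambda>(_ :: unit) _. Some ()) (occupied_law 1) M' \<eta>'"
    "\<And>t x \<omega>. 0 \<le> t \<Longrightarrow> \<omega> \<in> space M' \<Longrightarrow> \<zeta> t x \<omega> = (if \<eta>' t x \<omega> = None then 0 else 1)"
    using assms(4) unfolding coalescing_random_walk_def occupied_law_def by auto
  define A where "A t = measure M {\<omega> \<in> space M. \<eta> t x0 \<omega> \<in> - {None}}" for t
  define S where "S t x = measure M' {\<omega> \<in> space M'. \<eta>' t x \<omega> \<in> - {None}}" for t x
  interpret coalescing_density adj "card (nbrs adj undefined)" S
  proof
    fix \<Lambda> t x assume \<Lambda>: "exhausting \<Lambda>" and t: "0 \<le> (t :: real)"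
    have "measure_pmf.expectation (jump_law (\<Lambda> k) t)
        (\<lambda>l. measure_pmf.prob (occupied_law (card (flow l -` {x}))) (- {None})) = survival (\<Lambda> k) t {x}" for k
      unfolding survival_def prob_pmf_of_bool prob_occupied_law
      by (intro Bochner_Integration.integral_cong refl) (simp add: card_eq_0_iff finite_vimage_flow)
    then show "(\<lambda>k. survival (\<Lambda> k) t {x}) \<longlonglongrightarrow> S t x"
      using occupation_limit[OF \<eta>'(1) merging_laws_occupied \<Lambda> t, where x = x and S = "- {None}"] by (simp add: S_def)
  qed
  have "A \<sim>[at_top] (\<lambda>t. 2 / 3 * S t x0)"
  proof (rule density_ratio)
    fix t :: real assume "0 \<le> t"
    from occupation_limit[OF \<eta>(1) merging_laws_charge exhausting_ball[of x0] this, where x = x0 and S = "- {None}"]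
    show "(\<lambda>k. measure_pmf.expectation (jump_law (graph_ball x0 k) t)
      (\<lambda>l. 2 / 3 * (1 - (- 1 / 2) ^ card (flow l -` {x0})))) \<longlonglongrightarrow> A t"
      by (simp add: prob_charge_law A_def)
  qed
  \<comment> \<open>The process is tied to the particle states at nonnegative times only, hence
    equality eventually.\<close>
  moreover have "\<forall>\<^sub>F t in at_top. measure M {\<omega> \<in> space M. \<xi> t x0 \<omega> \<noteq> 0} = A t"
    using eventually_ge_at_top[of 0]
  proof eventually_elim
    case (elim t)
    have ch: "charge s \<noteq> 0 \<longleftrightarrow> s \<in> - {None}" for s
      by (cases s) (auto split: particle_type.split)
    show ?case unfolding A_def
      by (intro arg_cong[where f = "measure M"] Collect_cong) (simp only: \<eta>(2)[OF elim] ch cong: conj_cong)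
  qed
  moreover have "\<forall>\<^sub>F t in at_top. 2 / 3 * measure M' {\<omega> \<in> space M'. \<zeta> t x0 \<omega> = 1} = 2 / 3 * S t x0"
    using eventually_ge_at_top[of 0]
  proof eventually_elim
    case (elim t)
    have "{\<omega> \<in> space M'. \<zeta> t x0 \<omega> = 1} = {\<omega> \<in> space M'. \<eta>' t x0 \<omega> \<in> - {None}}"
      using \<eta>'(2)[OF elim] by (auto split: if_splits)
    then show ?case by (simp add: S_def)
  qed
  ultimately show ?thesis by (subst asymp_equiv_cong)
qed

end
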